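(* Let $n\ge2$. A complete set of primitive orthogonal idempotents of the algebra $\mathcal{W}^\pm_n$ is given by $\frac12(I^+_{k,n}+I^-_{k,n})$ for $1\le k\le n$, $k\equiv n\pmod2$; $\frac12(J^+_{l,n}+J^-_{l,n}-I^+_{l,n}-I^-_{l,n})$ for $0\le l\le n-4$, $l\equiv n\pmod 2$; and $\frac12(J^+_{m,n}-J^-_{m,n})$ for $0\le m\le n-2$, $m\equiv n\pmod 2$.
   Context: Noncommutative symmetric functions: $\mathbf{Sym}=\bigoplus_n\mathbf{Sym}_n$ over $\mathbb{Q}$ with ribbon basis $R_I$ ($I$ compositions of $n$; a composition $(i_1,\dots,i_r)$ has descent set $\{i_1,\dots,i_1+\dots+i_{r-1}\}$), $R_\emptyset=1$. $\mathbf{Sym}_n$ is identified with the descent algebra $\mathcal{D}_n\subseteq\mathbb{Q}[\mathfrak{S}_n]$ via $R_I\mapsto\sum\{\sigma:\mathrm{Des}(\sigma)=\text{descent set of }I\}$, $\mathrm{Des}(\sigma)=\{i:\sigma(i)>\sigma(i+1)\}$; the internal product is that of $\mathbb{Q}[\mathfrak{S}_n]$ (with $(\alpha\beta)(i)=\alpha(\beta(i))$) in each degree and zero across degrees. External product: $R_{(i_1,\dots,i_r)}\star R_{(j_1,\dots,j_s)}=R_{(i_1,\dots,i_r,j_1,\dots,j_s)}+R_{(i_1,\dots,i_{r-1},i_r+j_1,j_2,\dots,j_s)}$; both products extend to the completion $\widehat{\mathbf{Sym}}$ of formal sums of homogeneous elements. For $F$ with zero degree-$0$ part, $\log_\star(1+F)=\sum_{m\ge1}\frac{(-1)^{m-1}}{m}F^{\star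 m}$, $\exp_\star F=\sum_{m\ge0}\frac1{m!}F^{\star m}$, and $(1+F)^{\star c}=\exp_\star(c\log_\star(1+F))$ for $c\in\mathbb{Q}$. Let $V_1^+=\sum_{i\ge0}R_{(i)}$, $V_1^-=\sum_{i\ge0}R_{(1^i)}$, $V_2^+=V_1^+\star V_1^-$, $V_2^-=V_1^-\star V_1^+$; $I_1^-=\frac12\log_\star V_2^-$, $I_1^+=\frac12\log_\star V_2^+$, $I_k^\pm=\frac1{k!}(I_1^\pm)^{\star k}$ ($I_0^\pm=1$), $J_0^+=V_1^+\star(V_2^-)^{\star(-1/2)}$, $J_0^-=V_1^-\star(V_2^+)^{\star(-1/2)}$, $J_k^+=J_0^+\star I_k^-$, $J_k^-=J_0^-\star I_k^+$; subscripts $k,n$ denote degree-$n$ components. An alternating run of $\sigma\in\mathfrak{S}_n$ is a maximal monotone sequence of consecutive entries of $\sigma(1),\dots,\sigma(n)$; $W_k^+$ (resp. $W_k^-$) is the sum of all $\sigma\in\mathfrak{S}_n$ with exactly $k$ alternating runs whose first run is ascending (resp. descending), and $\mathcal{W}_n^\pm=\mathrm{span}\{W_k^+,W_k^-:1\le k\le n-1\}$, a subalgebra of $\mathbb{Q}[\mathfrak{S}_n]$. *)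

theory Defs
  imports
    Complex_Main
    "HOL-Algebra.Ring"
    "HOL-Combinatorics.Permutations"
    "HOL-Library.Groups_Big_Fun"
    "HOL-Number_Theory.Cong"
begin

section \<open>Idempotents of a ring\<close>

definition idempotent_elem :: "('a, 'm) ring_scheme \<Rightarrow> 'a \<Rightarrow> bool" where
  "idempotent_elem R e \<longleftrightarrow> e \<in> carrier R \<and> e \<otimes>\<^bsub>R\<^esub> e = e"

definition orthogonal_elems :: "('a, 'm) ring_scheme \<Rightarrow> 'a \<Rightarrow> 'a \<Rightarrow> bool" where
  "orthogonal_elems R e f \<longleftrightarrow> e \<otimes>\<^bsub>R\<^esub> f = \<zero>\<^bsub>R\<^esub> \<and> f \<otimes>\<^bsub>R\<^esub> e = \<zero>\<^bsub>R\<^esub>"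

definition primitive_idempotent :: "('a, 'm) ring_scheme \<Rightarrow> 'a \<Rightarrow> bool" where
  "primitive_idempotent R e \<longleftrightarrow>
     idempotent_elem R e \<and> e \<noteq> \<zero>\<^bsub>R\<^esub> \<and>
     (\<forall>f g. idempotent_elem R f \<and> idempotent_elem R g \<and> orthogonal_elems R f g \<and>
            e = f \<oplus>\<^bsub>R\<^esub> g \<longrightarrow> f = \<zero>\<^bsub>R\<^esub> \<or> g = \<zero>\<^bsub>R\<^esub>)"

definition complete_primitive_orthogonal_idempotents ::
    "('a, 'm) ring_scheme \<Rightarrow> 'i set \<Rightarrow> ('i \<Rightarrow> 'a) \<Rightarrow> bool" where
  "complete_primitive_orthogonal_idempotents R A e \<longleftrightarrow>
     finite A \<and>
     (\<forall>i\<in>A. primitive_idempotent R (e i)) \<and>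
     (\<forall>i\<in>A. \<forall>j\<in>A. i \<noteq> j \<longrightarrow> orthogonal_elems R (e i) (e j)) \<and>
     finsum R e A = \<one>\<^bsub>R\<^esub>"


section \<open>The completed algebra of noncommutative symmetric functions\<close>

definition composition :: "nat list \<Rightarrow> bool" where
  "composition I \<longleftrightarrow> (\<forall>i\<in>set I. 0 < i)"

text \<open>
  A formal sum of homogeneous elements is represented by its coefficients in the ribbon basis:
  \<open>F I\<close> is the coefficient of the ribbon indexed by the composition \<open>I\<close>, and \<open>F\<close> is \<open>0\<close> on
  lists that are not compositions. The degree of the ribbon of \<open>I\<close> is \<open>sum_list I\<close>.
\<close>

type_synonym nsym = "nat list \<Rightarrow> rat"

definition ribbon :: "nat list \<Rightarrow> nsym" where
  "ribbon I = (\<lambda>K. if K = I then 1 else 0)"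

definition ribbon_prod :: "nat list \<Rightarrow> nat list \<Rightarrow> nsym" where
  "ribbon_prod I J =
     (if I = [] then ribbon J
      else if J = [] then ribbon I
      else (\<lambda>K. ribbon (I @ J) K + ribbon (butlast I @ (last I + hd J) # tl J) K))"

definition ext_prod :: "nsym \<Rightarrow> nsym \<Rightarrow> nsym"  (infixl "\<star>" 70) where
  "F \<star> G = (\<lambda>K. \<Sum>(I, J) \<in> {(I, J). composition I \<and> composition J \<and>
                                     sum_list I + sum_list J = sum_list K}.
              F I * G J * ribbon_prod I J K)"

primrec ext_power :: "nsym \<Rightarrow> nat \<Rightarrow> nsym" where
  "ext_power F 0 = ribbon []"
| "ext_power F (Suc m) = F \<star> ext_power F m"

definition nsym_scale :: "rat \<Rightarrow> nsym \<Rightarrow> nsym" where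
  "nsym_scale c F = (\<lambda>K. c * F K)"

text \<open>
  Sum of a family that is locally finite, i.e. each ribbon has a nonzero coefficient in only
  finitely many members. For the logarithm and the exponential this holds by the lemma below.
\<close>

definition formal_sum :: "(nat \<Rightarrow> nsym) \<Rightarrow> nsym" where
  "formal_sum f = (\<lambda>K. Sum_any (\<lambda>m. f m K))"

lemma ext_power_eq_0:
  assumes "F [] = 0" and "sum_list K < m"
  shows "ext_power F m K = 0"
  using assms(2)
proof (induction m arbitrary: K)
  case 0
  then show ?case by simp
next
  case (Suc m)
  have "F I * ext_power F m J * ribbon_prod I J K = 0"
    if "composition I" "sum_list I + sum_list J = sum_list K" for I J
  proof (cases I)
    case Nil
    then show ?thesis using assms(1) by simp
  next
    case (Cons i I')
    then have "0 < sum_list I"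
      using that(1) by (simp add: composition_def)
    then have "sum_list J < m"
      using that(2) Suc.prems by linarith
    then show ?thesis using Suc.IH by simp
  qed
  then show ?case
    by (auto simp: ext_prod_def intro!: sum.neutral)
qed

definition nsym_log :: "nsym \<Rightarrow> nsym" where
  "nsym_log G = formal_sum (\<lambda>m. if m = 0 then (\<lambda>K. 0)
     else nsym_scale ((-1) ^ (m - 1) / of_nat m) (ext_power (\<lambda>K. G K - ribbon [] K) m))"

definition nsym_exp :: "nsym \<Rightarrow> nsym" where
  "nsym_exp F = formal_sum (\<lambda>m. nsym_scale (1 / fact m) (ext_power F m))"

definition nsym_rpow :: "nsym \<Rightarrow> rat \<Rightarrow> nsym" where
  "nsym_rpow G c = nsym_exp (nsym_scale c (nsym_log G))"

definition V1_plus :: nsym where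
  "V1_plus = formal_sum (\<lambda>i. ribbon (if i = 0 then [] else [i]))"

definition V1_minus :: nsym where
  "V1_minus = formal_sum (\<lambda>i. ribbon (replicate i 1))"

definition V2_plus :: nsym where
  "V2_plus = V1_plus \<star> V1_minus"

definition V2_minus :: nsym where
  "V2_minus = V1_minus \<star> V1_plus"

definition I_plus :: "nat \<Rightarrow> nsym" where
  "I_plus k = nsym_scale (1 / fact k) (ext_power (nsym_scale (1/2) (nsym_log V2_plus)) k)"

definition I_minus :: "nat \<Rightarrow> nsym" where
  "I_minus k = nsym_scale (1 / fact k) (ext_power (nsym_scale (1/2) (nsym_log V2_minus)) k)"

definition J_plus :: "nat \<Rightarrow> nsym" where
  "J_plus k = V1_plus \<star> nsym_rpow V2_minus (-1/2) \<star> I_minus k"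

definition J_minus :: "nat \<Rightarrow> nsym" where
  "J_minus k = V1_minus \<star> nsym_rpow V2_plus (-1/2) \<star> I_plus k"


section \<open>The group algebra of the symmetric group and the descent algebra\<close>

definition sym_group_algebra :: "nat \<Rightarrow> ((nat \<Rightarrow> nat) \<Rightarrow> rat) ring" where
  "sym_group_algebra n =
     \<lparr> carrier = {f. \<forall>\<sigma>. \<not> \<sigma> permutes {1..n} \<longrightarrow> f \<sigma> = 0},
       monoid.mult = (\<lambda>f g \<sigma>. \<Sum>(\<alpha>, \<beta>) \<in> {(\<alpha>, \<beta>). \<alpha> permutes {1..n} \<and> \<beta> permutes {1..n} \<and>
                                                 \<alpha> \<circ> \<beta> = \<sigma>}. f \<alpha> * g \<beta>),
       one = (\<lambda>\<sigma>. if \<sigma> = id then 1 else 0),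
       zero = (\<lambda>\<sigma>. 0),
       add = (\<lambda>f g \<sigma>. f \<sigma> + g \<sigma>) \<rparr>"

definition perm_descents :: "nat \<Rightarrow> (nat \<Rightarrow> nat) \<Rightarrow> nat set" where
  "perm_descents n \<sigma> = {i. 1 \<le> i \<and> i < n \<and> \<sigma> i > \<sigma> (i + 1)}"

definition composition_descents :: "nat list \<Rightarrow> nat set" where
  "composition_descents I = {sum_list (take r I) |r. 1 \<le> r \<and> r < length I}"

text \<open>The image in the group algebra of the degree-\<open>n\<close> component of \<open>F\<close>.\<close>

definition descent_embed :: "nat \<Rightarrow> nsym \<Rightarrow> (nat \<Rightarrow> nat) \<Rightarrow> rat" where
  "descent_embed n F = (\<lambda>\<sigma>. \<Sum>I \<in> {I. composition I \<and> sum_list I = n}.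
     F I * (if \<sigma> permutes {1..n} \<and> perm_descents n \<sigma> = composition_descents I then 1 else 0))"


section \<open>Alternating runs\<close>

definition monotone_segment :: "nat \<Rightarrow> (nat \<Rightarrow> nat) \<Rightarrow> nat \<Rightarrow> nat \<Rightarrow> bool" where
  "monotone_segment n \<sigma> a b \<longleftrightarrow> 1 \<le> a \<and> a \<le> b \<and> b \<le> n \<and>
     (strict_mono_on {a..b} \<sigma> \<or> strict_antimono_on {a..b} \<sigma>)"

text \<open>A run is recorded as the pair of its first and last position.\<close>

definition alternating_runs :: "nat \<Rightarrow> (nat \<Rightarrow> nat) \<Rightarrow> (nat \<times> nat) set" where
  "alternating_runs n \<sigma> = {(a, b). monotone_segment n \<sigma> a b \<and>
     \<not> (\<exists>c d. monotone_segment n \<sigma> c d \<and> {a..b} \<subset> {c..d})}"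

definition W_plus :: "nat \<Rightarrow> nat \<Rightarrow> (nat \<Rightarrow> nat) \<Rightarrow> rat" where
  "W_plus n k = (\<lambda>\<sigma>. if \<sigma> permutes {1..n} \<and> card (alternating_runs n \<sigma>) = k \<and>
     (\<exists>b. (1, b) \<in> alternating_runs n \<sigma> \<and> strict_mono_on {1..b} \<sigma>) then 1 else 0)"

definition W_minus :: "nat \<Rightarrow> nat \<Rightarrow> (nat \<Rightarrow> nat) \<Rightarrow> rat" where
  "W_minus n k = (\<lambda>\<sigma>. if \<sigma> permutes {1..n} \<and> card (alternating_runs n \<sigma>) = k \<and>
     (\<exists>b. (1, b) \<in> alternating_runs n \<sigma> \<and> strict_antimono_on {1..b} \<sigma>) then 1 else 0)"

definition W_algebra :: "nat \<Rightarrow> ((nat \<Rightarrow> nat) \<Rightarrow> rat) ring" where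
  "W_algebra n = (sym_group_algebra n)
     \<lparr> carrier := {(\<lambda>\<sigma>. \<Sum>k\<in>{1..n-1}. x k * W_plus n k \<sigma> + y k * W_minus n k \<sigma>) |x y. True} \<rparr>"


section \<open>The family of idempotents\<close>

datatype idem_index = Idx_I nat | Idx_JI nat | Idx_J nat

definition idem_indices :: "nat \<Rightarrow> idem_index set" where
  "idem_indices n =
     {Idx_I k |k. 1 \<le> k \<and> k \<le> n \<and> [k = n] (mod 2)} \<union>
     {Idx_JI l |l. l + 4 \<le> n \<and> [l = n] (mod 2)} \<union>
     {Idx_J m |m. m + 2 \<le> n \<and> [m = n] (mod 2)}"

fun idem_nsym :: "idem_index \<Rightarrow> nsym" where
  "idem_nsym (Idx_I k) = (\<lambda>K. 1/2 * (I_plus k K + I_minus k K))"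
| "idem_nsym (Idx_JI l) = (\<lambda>K. 1/2 * (J_plus l K + J_minus l K - I_plus l K - I_minus l K))"
| "idem_nsym (Idx_J m) = (\<lambda>K. 1/2 * (J_plus m K - J_minus m K))"

end

theory Submission
  imports
    Defs
    "HOL-Computational_Algebra.Formal_Power_Series"
    "HOL-Computational_Algebra.Polynomial"
begin

text \<open>
  Let \<open>V\<^sub>m\<^sup>s\<close> be the \<open>\<star>\<close>-product of \<open>m\<close> factors \<open>V\<^sub>1\<^sup>\<plusminus>\<close> of alternating signs starting with \<open>s\<close>.
  Its degree \<open>n\<close> part is \<open>\<Sum>k. m\<^sup>k I\<^sub>k\<^sup>s\<close> for even \<open>m\<close> and \<open>\<Sum>k. m\<^sup>k J\<^sub>k\<^sup>s\<close> for odd \<open>m\<close>, by the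
  exponential and logarithm series. In the group algebra \<open>V\<^sub>m\<^sup>s\<close> is the sum, over all colourings of
  \<open>{1..n}\<close> with \<open>m\<close> colours, of the permutation that sorts by colour and, within a colour,
  increasingly or decreasingly according to the parity of the colour. Composing two sorting
  permutations sorts by pairs of colours, so \<open>V\<^sub>i\<^sup>s V\<^sub>j\<^sup>t\<close> is \<open>V\<^sub>i\<^sub>j\<^sup>s\<close> for even \<open>i\<close> and \<open>V\<^sub>i\<^sub>j\<^sup>s\<^sup>t\<close> for odd
  \<open>i\<close>. Comparing coefficients of \<open>i\<^sup>k j\<^sup>l\<close> gives the multiplication table of the \<open>I\<^sub>k\<^sup>\<plusminus>\<close>, \<open>J\<^sub>k\<^sup>\<plusminus>\<close>, in which
  the given elements \<open>e\<close> are orthogonal idempotents with \<open>e x e\<close> a multiple of \<open>e\<close> for every \<open>I\<close>, \<open>J\<close>.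

  The coefficient of \<open>V\<^sub>m\<^sup>s\<close> at a permutation depends only on its number of runs and on its first
  direction, and is triangular in the number of runs, so the \<open>V\<^sub>m\<^sup>\<plusminus>\<close> span the algebra of runs and
  the idempotents are primitive. They sum to \<open>V\<^sub>1\<^sup>+ = 1\<close> because \<open>I\<^sub>k\<close> and \<open>J\<^sub>k\<close> vanish in degrees of the
  other parity (\<open>V\<^sub>1\<^sup>-\<close> is inverse to \<open>V\<^sub>1\<^sup>+\<close> up to the sign of the degree) and because
  \<open>I\<^sub>n\<^sup>\<plusminus> = J\<^sub>n\<^sup>\<plusminus>\<close> and \<open>J\<^sub>n\<^sub>-\<^sub>2\<^sup>+ + J\<^sub>n\<^sub>-\<^sub>2\<^sup>- = I\<^sub>n\<^sub>-\<^sub>2\<^sup>+ + I\<^sub>n\<^sub>-\<^sub>2\<^sup>-\<close> in degree \<open>n\<close>. They do not vanish at the identity,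
  where \<open>I\<^sub>k\<^sup>\<plusminus>\<close>, \<open>J\<^sub>k\<^sup>+\<close>, \<open>J\<^sub>k\<^sup>-\<close> have the generating functions \<open>A\<^sup>k / k!\<close>, \<open>B A\<^sup>k / k!\<close>,
  \<open>B\<^sup>-\<^sup>1 A\<^sup>k / k!\<close> with \<open>A = artanh x\<close> and \<open>B = (1 - x\<^sup>2)\<^sup>-\<^sup>1\<^sup>/\<^sup>2\<close>.
\<close>

section \<open>Cutting compositions at a given degree\<close>

text \<open>A composition is pictured as a sequence of cells grouped into parts. Cutting after
  \<open>i\<close> cells splits a part that straddles the cut, so cutting is dual to the product of
  ribbons: the two ribbons in that product are the two ways to undo a cut.\<close>

fun cut_left :: "nat \<Rightarrow> nat list \<Rightarrow> nat list" where
  "cut_left i [] = []"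
| "cut_left i (k # K) = (if i = 0 then [] else if i < k then [i] else k # cut_left (i - k) K)"

fun cut_right :: "nat \<Rightarrow> nat list \<Rightarrow> nat list" where
  "cut_right i [] = []"
| "cut_right i (k # K) = (if i < k then (k - i) # K else cut_right (i - k) K)"

lemma composition_simps [simp]:
  "composition []"
  "composition (k # K) \<longleftrightarrow> 0 < k \<and> composition K"
  "composition (I @ J) \<longleftrightarrow> composition I \<and> composition J"
  by (auto simp: composition_def)

lemma sum_list_composition_eq_0_iff: "composition K \<Longrightarrow> sum_list K = 0 \<longleftrightarrow> K = []"
  by (cases K) auto

lemma cut_left_0 [simp]: "cut_left 0 K = []"
  by (cases K) auto

lemma cut_right_0 [simp]: "composition K \<Longrightarrow> cut_right 0 K = K"
  by (cases K) auto

lemma sum_list_cut_left [simp]: "sum_list (cut_left i K) = min i (sum_list K)"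
  by (induction i K rule: cut_left.induct) auto

lemma sum_list_cut_right [simp]: "sum_list (cut_right i K) = sum_list K - i"
  by (induction i K rule: cut_right.induct) auto

lemma composition_cut_left [simp]: "composition K \<Longrightarrow> composition (cut_left i K)"
  by (induction i K rule: cut_left.induct) auto

lemma composition_cut_right [simp]: "composition K \<Longrightarrow> composition (cut_right i K)"
  by (induction i K rule: cut_right.induct) auto

lemma cut_left_all [simp]: "sum_list K \<le> i \<Longrightarrow> composition K \<Longrightarrow> cut_left i K = K"
  by (induction i K rule: cut_left.induct) auto

lemma cut_right_all [simp]: "sum_list K \<le> i \<Longrightarrow> composition K \<Longrightarrow> cut_right i K = []"
  by (induction i K rule: cut_right.induct) auto

lemma cut_left_cut_left: "cut_left i (cut_left j K) = cut_left (min i j) K"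
proof (induction K arbitrary: i j)
  case (Cons k K)
  have "min i j - k = min (i - k) (j - k)" by linarith
  then have "cut_left (i - k) (cut_left (j - k) K) = cut_left (min i j - k) K"
    using Cons[of "i - k" "j - k"] by argo
  then show ?case by (cases "i \<le> j"; cases "i < k"; cases "j < k") auto
qed auto

lemma cut_right_cut_right: "composition K \<Longrightarrow> cut_right i (cut_right j K) = cut_right (i + j) K"
proof (induction K arbitrary: j)
  case (Cons k K)
  have "i + (j - k) = i + j - k" if "\<not> j < k" using that by linarith
  moreover have "i - (k - j) = i + j - k" if "j < k" using that by linarith
  ultimately show ?case using Cons by auto
qed auto

lemma cut_left_cut_right:
  "composition K \<Longrightarrow> cut_left i (cut_right j K) = cut_right j (cut_left (i + j) K)"
proof (induction K arbitrary: j)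
  case (Cons k K)
  have "i + (j - k) = i + j - k" if "\<not> j < k" using that by linarith
  moreover have "i - (k - j) = i + j - k" if "j < k" using that by linarith
  ultimately show ?case using Cons by auto
qed auto

lemma cut_append:
  assumes "composition I" "composition J"
  shows "cut_left (sum_list I) (I @ J) = I" "cut_right (sum_list I) (I @ J) = J"
  using assms by (induction I) auto

lemma cut_merge:
  assumes "composition I" "composition J" "I \<noteq> []" "J \<noteq> []"
  shows "cut_left (sum_list I) (butlast I @ (last I + hd J) # tl J) = I"
    and "cut_right (sum_list I) (butlast I @ (last I + hd J) # tl J) = J"
proof -
  obtain j J' where J: "J = j # J'" using assms(4) by (cases J) auto
  from assms(1,3) have "cut_left (sum_list I) (butlast I @ (last I + j) # J') = I \<and>
      cut_right (sum_list I) (butlast I @ (last I + j) # J') = j # J'"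
    using assms(2) J by (induction I rule: induct_list012) auto
  with J show "cut_left (sum_list I) (butlast I @ (last I + hd J) # tl J) = I"
    "cut_right (sum_list I) (butlast I @ (last I + hd J) # tl J) = J" by auto
qed

text \<open>A cut falls either between two parts, and then concatenation undoes it, or inside a
  part, and then merging the two end parts does.\<close>

lemma join_cut:
  assumes "composition K" "cut_left i K \<noteq> []" "cut_right i K \<noteq> []"
  shows "K = cut_left i K @ cut_right i K \<or>
         K = butlast (cut_left i K) @ (last (cut_left i K) + hd (cut_right i K)) # tl (cut_right i K)"
  using assms
proof (induction i K rule: cut_left.induct)
  case (2 i k K)
  consider "i < k" | "i = k" | "k < i" by linarith
  then show ?case
  proof cases
    case 1
    with "2.prems" show ?thesis by auto
  next
    case 2
    with "2.prems" show ?thesis by auto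
  next
    case 3
    then have "cut_left (i - k) K \<noteq> []"
      using "2.prems" by (cases K) auto
    moreover have "K = cut_left (i - k) K @ cut_right (i - k) K \<or>
        K = butlast (cut_left (i - k) K) @
          (last (cut_left (i - k) K) + hd (cut_right (i - k) K)) # tl (cut_right (i - k) K)"
      using 3 "2.prems" calculation by (intro "2.IH") auto
    ultimately show ?thesis using 3 by simp
  qed
qed auto

lemma length_le_sum_list_composition: "composition K \<Longrightarrow> length K \<le> sum_list K"
  by (induction K) auto

lemma finite_compositions_le: "finite {I. composition I \<and> sum_list I \<le> N}"
proof (rule finite_subset)
  show "{I. composition I \<and> sum_list I \<le> N} \<subseteq> {I. set I \<subseteq> {..N} \<and> length I \<le> N}"
    using length_le_sum_list_composition by (force dest: member_le_sum_list)
qed (rule finite_lists_length_le, simp)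

lemma ribbon_prod_eq_cut:
  assumes "composition I" "composition J" "composition K" "sum_list I + sum_list J = sum_list K"
  shows "ribbon_prod I J K =
           (if cut_left (sum_list I) K = I \<and> cut_right (sum_list I) K = J then 1 else 0)"
proof (cases "I = [] \<or> J = []")
  case True
  show ?thesis
  proof (cases "I = []")
    case True
    then show ?thesis using assms(3) by (simp add: ribbon_prod_def ribbon_def)
  next
    case False
    with True have "J = []" "sum_list K = sum_list I" using assms(4) by auto
    then have "cut_left (sum_list I) K = K" "cut_right (sum_list I) K = []"
      using assms(3) by auto
    then show ?thesis using False \<open>J = []\<close> by (simp only: ribbon_prod_def ribbon_def) simp
  qed
next
  case False
  let ?M = "butlast I @ (last I + hd J) # tl J"
  \<comment> \<open>The two compositions differ in length, so their ribbons are distinct and no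
    coefficient is 2.\<close>
  have ne: "I @ J \<noteq> ?M"
  proof
    assume "I @ J = ?M"
    then have "length (I @ J) = length ?M" by (rule arg_cong)
    with False show False by (cases I rule: rev_cases; cases J) auto
  qed
  have "cut_left (sum_list I) K = I \<and> cut_right (sum_list I) K = J \<longleftrightarrow> K = I @ J \<or> K = ?M"
    using join_cut[OF assms(3), of "sum_list I"] False
      cut_append[OF assms(1,2)] cut_merge[OF assms(1,2)] by auto
  with ne False show ?thesis
    by (auto simp: ribbon_prod_def ribbon_def)
qed

section \<open>The external product as a sum over cuts\<close>

lemma ribbon_prod_not_composition:
  assumes "composition I" "composition J" "\<not> composition K"
  shows "ribbon_prod I J K = 0"
proof -
  have "composition (butlast I @ (last I + hd J) # tl J)" if "I \<noteq> []" "J \<noteq> []"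
    using assms(1,2) that by (cases I rule: rev_cases; cases J) auto
  moreover have "composition (I @ J)" using assms by simp
  ultimately have "K \<noteq> I @ J" "I \<noteq> [] \<Longrightarrow> J \<noteq> [] \<Longrightarrow> K \<noteq> butlast I @ (last I + hd J) # tl J"
    "K \<noteq> I" "K \<noteq> J"
    using assms by blast+
  then show ?thesis by (simp add: ribbon_prod_def ribbon_def)
qed

lemma ext_prod_not_composition [simp]: "\<not> composition K \<Longrightarrow> (F \<star> G) K = 0"
  by (auto simp: ext_prod_def ribbon_prod_not_composition intro!: sum.neutral)

text \<open>Only pairs obtained by cutting \<open>K\<close> contribute, and the degree of the left
  piece determines the pair. The double sum over compositions becomes a sum over one number.\<close>

lemma ext_prod_composition:
  assumes "composition K"
  shows "(F \<star> G) K = (\<Sum>i\<le>sum_list K. F (cut_left i K) * G (cut_right i K))"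
proof -
  let ?S = "{(I, J). composition I \<and> composition J \<and> sum_list I + sum_list J = sum_list K}"
  let ?h = "\<lambda>i. (cut_left i K, cut_right i K)"
  have fin: "finite ?S"
    by (rule finite_subset[OF _ finite_cartesian_product[OF finite_compositions_le[of "sum_list K"]
          finite_compositions_le[of "sum_list K"]]]) auto
  have inj: "inj_on ?h {..sum_list K}"
    by (rule inj_on_inverseI[of _ "sum_list \<circ> fst"]) auto
  have "(F \<star> G) K = (\<Sum>(I, J)\<in>?S. F I * G J * 
           (if cut_left (sum_list I) K = I \<and> cut_right (sum_list I) K = J then 1 else 0))"
    using assms by (auto simp: ext_prod_def ribbon_prod_eq_cut intro!: sum.cong)
  also have "\<dots> = (\<Sum>(I, J)\<in>?h ` {..sum_list K}. F I * G J)"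
  proof (rule sum.mono_neutral_cong_right[OF fin])
    have "(I, J) \<in> ?h ` {..sum_list K}"
      if "cut_left (sum_list I) K = I" "cut_right (sum_list I) K = J" 
        "sum_list I + sum_list J = sum_list K" for I J
      using that by (intro image_eqI[of _ _ "sum_list I"]) auto
    then show "\<forall>x\<in>?S - ?h ` {..sum_list K}. (case x of (I, J) \<Rightarrow> F I * G J *
        (if cut_left (sum_list I) K = I \<and> cut_right (sum_list I) K = J then 1 else 0)) = 0"
      by auto
  qed (use assms in auto)
  also have "\<dots> = (\<Sum>i\<le>sum_list K. F (cut_left i K) * G (cut_right i K))"
    by (subst sum.reindex[OF inj]) simp
  finally show ?thesis .
qed

lemma ext_prod_assoc: "F \<star> G \<star> H = F \<star> (G \<star> H)"
proof
  fix K
  show "(F \<star> G \<star> H) K = (F \<star> (G \<star> H)) K"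
  proof (cases "composition K")
    case True
    let ?N = "sum_list K"
    have "(F \<star> G \<star> H) K =
        (\<Sum>j\<le>?N. \<Sum>i\<le>j. F (cut_left i K) * G (cut_right i (cut_left j K)) * H (cut_right j K))"
      unfolding ext_prod_composition[OF True]
    proof (intro sum.cong refl)
      fix j assume "j \<in> {..?N}"
      then show "(F \<star> G) (cut_left j K) * H (cut_right j K) =
          (\<Sum>i\<le>j. F (cut_left i K) * G (cut_right i (cut_left j K)) * H (cut_right j K))"
        using True by (simp add: ext_prod_composition sum_distrib_right cut_left_cut_left min_absorb1)
    qed
    also have "\<dots> = (\<Sum>(j, i)\<in>(SIGMA j:{..?N}. {..j}).
        F (cut_left i K) * G (cut_right i (cut_left j K)) * H (cut_right j K))"
      by (subst sum.Sigma) auto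
    \<comment> \<open>Both bracketings cut \<open>K\<close> twice. On one side the second cut is
      measured from the beginning of \<open>K\<close>, on the other from the first cut, hence the
      shift between \<open>j\<close> and \<open>i + j\<close>.\<close>
    also have "\<dots> = (\<Sum>(i, j)\<in>(SIGMA i:{..?N}. {..?N - i}).
        F (cut_left i K) * (G (cut_left j (cut_right i K)) * H (cut_right j (cut_right i K))))"
      by (rule sum.reindex_bij_witness[of _ "\<lambda>(i, j). (i + j, i)" "\<lambda>(j, i). (i, j - i)"])
        (use True in \<open>auto simp: cut_left_cut_right cut_right_cut_right\<close>)
    also have "\<dots> = (\<Sum>i\<le>?N. \<Sum>j\<le>?N - i.
        F (cut_left i K) * (G (cut_left j (cut_right i K)) * H (cut_right j (cut_right i K))))"
      by (subst sum.Sigma) auto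
    also have "\<dots> = (F \<star> (G \<star> H)) K"
      unfolding ext_prod_composition[OF True]
      using True by (intro sum.cong refl) (simp add: ext_prod_composition sum_distrib_left)
    finally show ?thesis .
  qed simp
qed

text \<open>The type \<open>nsym\<close> admits values on lists that are not compositions, where
  every product is 0. Hence \<open>ribbon []\<close> is a unit only for the elements singled out
  here.\<close>

definition supported :: "nsym \<Rightarrow> bool" where
  "supported F \<longleftrightarrow> (\<forall>K. \<not> composition K \<longrightarrow> F K = 0)"

lemma supported_ext_prod [simp]: "supported (F \<star> G)"
  by (simp add: supported_def)

lemma supported_ribbon_Nil [simp]: "supported (ribbon [])"
  by (auto simp: supported_def ribbon_def)

lemma supported_ext_power [simp]: "supported (ext_power F m)"
  by (cases m) auto

lemma cut_left_eq_Nil_iff: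
  "composition K \<Longrightarrow> cut_left i K = [] \<longleftrightarrow> i = 0 \<or> K = []"
  by (cases K) auto

lemma cut_right_eq_Nil_iff:
  "composition K \<Longrightarrow> cut_right i K = [] \<longleftrightarrow> sum_list K \<le> i"
  using sum_list_composition_eq_0_iff[of "cut_right i K"] by simp

lemma ribbon_Nil_ext_prod [simp]:
  assumes "supported F"
  shows "ribbon [] \<star> F = F"
proof
  fix K
  show "(ribbon [] \<star> F) K = F K"
  proof (cases "composition K")
    case True
    have "(ribbon [] \<star> F) K = (\<Sum>i\<le>sum_list K. if i = 0 then F K else 0)"
      unfolding ext_prod_composition[OF True]
      using True by (intro sum.cong) (auto simp: ribbon_def cut_left_eq_Nil_iff)
    then show ?thesis by simp
  qed (use assms in \<open>simp add: supported_def\<close>)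
qed

lemma ext_prod_ribbon_Nil [simp]:
  assumes "supported F"
  shows "F \<star> ribbon [] = F"
proof
  fix K
  show "(F \<star> ribbon []) K = F K"
  proof (cases "composition K")
    case True
    have "(F \<star> ribbon []) K = (\<Sum>i\<le>sum_list K. if i = sum_list K then F K else 0)"
      unfolding ext_prod_composition[OF True]
      using True by (intro sum.cong) (auto simp: ribbon_def cut_right_eq_Nil_iff)
    then show ?thesis by simp
  qed (use assms in \<open>simp add: supported_def\<close>)
qed

lemma ext_prod_Nil [simp]: "(F \<star> G) [] = F [] * G []"
  by (simp add: ext_prod_composition)

lemma ext_power_add: "ext_power F (a + b) = ext_power F a \<star> ext_power F b"
  by (induction a) (auto simp: ext_prod_assoc)

unbundle fps_syntax

section \<open>Substitution of noncommutative symmetric functions into power series\<close>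

text \<open>If \<open>X\<close> has no part in degree 0, then \<open>ext_power X m\<close> has none
  below degree \<open>m\<close>, so truncation at the degree of \<open>K\<close> loses nothing.
  Logarithms and powers of one element thus become identities between commutative power
  series.\<close>

definition fps_eval :: "nsym \<Rightarrow> rat fps \<Rightarrow> nsym" where
  "fps_eval X P = (\<lambda>K. \<Sum>m\<le>sum_list K. P $ m * ext_power X m K)"

lemma fps_eval_extend:
  assumes "X [] = 0" "sum_list K \<le> N"
  shows "fps_eval X P K = (\<Sum>m\<le>N. P $ m * ext_power X m K)"
  unfolding fps_eval_def using assms
  by (intro sum.mono_neutral_left) (auto simp: ext_power_eq_0)

lemma formal_sum_eq_sum:
  assumes "\<And>m. N < m \<Longrightarrow> f m K = 0"
  shows "formal_sum f K = (\<Sum>m\<le>N. f m K)"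
proof -
  have "{m. f m K \<noteq> 0} \<subseteq> {..N}"
    using assms by (auto simp: not_less[symmetric])
  then show ?thesis
    unfolding formal_sum_def by (intro Sum_any.expand_superset) auto
qed

lemma supported_fps_eval [simp]: "supported (fps_eval X P)"
  using supported_ext_power[of X] by (auto simp: supported_def fps_eval_def intro!: sum.neutral)

text \<open>Powers of a single element multiply by adding exponents, so substitution is a ring
  homomorphism although \<star> is not commutative.\<close>

lemma fps_eval_mult:
  assumes "X [] = 0"
  shows "fps_eval X (P * Q) = fps_eval X P \<star> fps_eval X Q"
proof
  fix K
  show "fps_eval X (P * Q) K = (fps_eval X P \<star> fps_eval X Q) K"
  proof (cases "composition K")
    case True
    let ?N = "sum_list K"
    let ?p = "ext_power X"
    \<comment> \<open>Both truncations are raised to the common bound \<open>?N\<close>, so that the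
      ranges no longer depend on the cut.\<close>
    have "(fps_eval X P \<star> fps_eval X Q) K =
        (\<Sum>i\<le>?N. (\<Sum>a\<le>?N. P $ a * ?p a (cut_left i K)) * (\<Sum>b\<le>?N. Q $ b * ?p b (cut_right i K)))"
      unfolding ext_prod_composition[OF True]
    proof (intro sum.cong refl arg_cong2[of _ _ _ _ "(*)"])
      fix i
      show "fps_eval X P (cut_left i K) = (\<Sum>a\<le>?N. P $ a * ?p a (cut_left i K))"
        by (rule fps_eval_extend[of X, OF assms]) simp
      show "fps_eval X Q (cut_right i K) = (\<Sum>b\<le>?N. Q $ b * ?p b (cut_right i K))"
        by (rule fps_eval_extend[of X, OF assms]) simp
    qed
    also have "\<dots> = (\<Sum>i\<le>?N. \<Sum>a\<le>?N. \<Sum>b\<le>?N. P $ a * Q $ b * (?p a (cut_left i K) * ?p b (cut_right i K)))"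
      by (simp add: sum_product mult_ac)
    also have "\<dots> = (\<Sum>a\<le>?N. \<Sum>b\<le>?N. \<Sum>i\<le>?N. P $ a * Q $ b * (?p a (cut_left i K) * ?p b (cut_right i K)))"
      by (subst sum.swap) (intro sum.cong refl sum.swap)
    also have "\<dots> = (\<Sum>a\<le>?N. \<Sum>b\<le>?N. P $ a * Q $ b * ?p (a + b) K)"
      by (simp add: ext_power_add ext_prod_composition[OF True] sum_distrib_left)
    also have "\<dots> = (\<Sum>(a, b)\<in>{..?N} \<times> {..?N}. P $ a * Q $ b * ?p (a + b) K)"
      by (simp add: sum.cartesian_product)
    also have "\<dots> = (\<Sum>(a, b)\<in>{(a, b). a + b \<le> ?N}. P $ a * Q $ b * ?p (a + b) K)"
      by (rule sum.mono_neutral_right, auto) (metis ext_power_eq_0[of X, OF assms] not_le)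
    also have "\<dots> = (\<Sum>m\<le>?N. \<Sum>a\<le>m. P $ a * Q $ (m - a) * ?p m K)"
      by (subst sum.triangle_reindex_eq) simp
    also have "\<dots> = fps_eval X (P * Q) K"
      by (simp add: fps_eval_def fps_mult_nth sum_distrib_right atLeast0AtMost)
    finally show ?thesis ..
  next
    case False
    then show ?thesis using supported_fps_eval[of X "P * Q"] by (simp add: supported_def)
  qed
qed

lemma fps_eval_1 [simp]: "fps_eval X 1 = ribbon []"
proof
  fix K
  have "fps_eval X 1 K = (\<Sum>m\<le>sum_list K. if m = 0 then ribbon [] K else 0)"
    unfolding fps_eval_def by (intro sum.cong) auto
  then show "fps_eval X 1 K = ribbon [] K" by simp
qed

lemma fps_eval_const_mult: "fps_eval X (fps_const c * P) = nsym_scale c (fps_eval X P)"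
  by (simp add: fps_eval_def nsym_scale_def sum_distrib_left mult_ac)

lemma fps_eval_power:
  assumes "X [] = 0"
  shows "ext_power (fps_eval X P) k = fps_eval X (P ^ k)"
  by (induction k) (simp_all add: fps_eval_mult[of X, OF assms])

lemma fps_eval_1_plus_X:
  assumes "X [] = 0" "supported X"
  shows "fps_eval X (1 + fps_X) = (\<lambda>K. ribbon [] K + X K)"
proof
  fix K
  have "fps_eval X (1 + fps_X) K = (\<Sum>m\<le>Suc (sum_list K). (1 + fps_X) $ m * ext_power X m K)"
    by (rule fps_eval_extend[of X, OF assms(1)]) simp
  also have "\<dots> = (\<Sum>m\<in>{0, 1}. (1 + fps_X) $ m * ext_power X m K)"
    by (rule sum.mono_neutral_right) auto
  finally show "fps_eval X (1 + fps_X) K = ribbon [] K + X K"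
    using assms by simp
qed

lemma fps_eval_exp_compose:
  assumes "X [] = 0" "P $ 0 = 0"
  shows "(\<Sum>k\<le>sum_list K. 1 / fact k * fps_eval X (P ^ k) K) = fps_eval X (fps_exp 1 oo P) K"
proof -
  let ?N = "sum_list K"
  have "(\<Sum>k\<le>?N. 1 / fact k * fps_eval X (P ^ k) K) =
      (\<Sum>k\<le>?N. \<Sum>m\<le>?N. 1 / fact k * (P ^ k) $ m * ext_power X m K)"
    by (simp add: fps_eval_def sum_distrib_left mult_ac)
  also have "\<dots> = (\<Sum>m\<le>?N. (\<Sum>k\<le>?N. 1 / fact k * (P ^ k) $ m) * ext_power X m K)"
    by (subst sum.swap) (simp add: sum_distrib_right)
  also have "\<dots> = (\<Sum>m\<le>?N. (fps_exp 1 oo P) $ m * ext_power X m K)"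
  proof (intro sum.cong refl arg_cong2[of _ _ _ _ "(*)"])
    fix m assume "m \<in> {..?N}"
    then have "(\<Sum>k\<le>?N. 1 / fact k * (P ^ k) $ m) = (\<Sum>k\<in>{0..m}. 1 / fact k * (P ^ k) $ m)"
      using startsby_zero_power_prefix[OF assms(2)]
      by (intro sum.mono_neutral_right) auto
    then show "(\<Sum>k\<le>?N. 1 / fact k * (P ^ k) $ m) = (fps_exp 1 oo P) $ m"
      by (simp add: fps_compose_nth)
  qed
  finally show ?thesis by (simp add: fps_eval_def)
qed

text \<open>Both series solve \<open>f' = c f / (1 + x)\<close> with
  \<open>f(0) = 1\<close>.\<close>

lemma fps_exp_compose_ln: "fps_exp 1 oo (fps_const c * fps_ln 1) = fps_binomial (c :: rat)"
proof -
  let ?a = "fps_exp 1 oo (fps_const c * fps_ln 1)"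
  have "fps_deriv ?a = ?a * (fps_const c * inverse (1 + fps_X))"
    by (simp add: fps_compose_deriv fps_ln_deriv)
  then have "fps_deriv ?a = fps_const c * ?a / (1 + fps_X)"
    by (simp add: fps_divide_unit mult_ac)
  moreover have "?a $ 0 = 1" by simp
  ultimately show ?thesis using fps_binomial_ODE_unique' by blast
qed

definition aug :: "nsym \<Rightarrow> nsym" where
  "aug G = (\<lambda>K. G K - ribbon [] K)"

lemma aug_Nil: "G [] = 1 \<Longrightarrow> aug G [] = 0"
  by (simp add: aug_def ribbon_def)

lemma supported_aug: "supported G \<Longrightarrow> supported (aug G)"
  by (auto simp: aug_def supported_def ribbon_def)

lemma fps_eval_aug: 
  assumes "G [] = 1" "supported G"
  shows "fps_eval (aug G) (1 + fps_X) = G"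
  using fps_eval_1_plus_X[of "aug G"] aug_Nil[of G] supported_aug[of G] assms by (simp add: aug_def)

lemma nsym_log_eq:
  assumes "G [] = 1"
  shows "nsym_log G = fps_eval (aug G) (fps_ln 1)"
proof
  fix K
  have "nsym_log G K = (\<Sum>m\<le>sum_list K. (if m = 0 then (\<lambda>K. 0)
     else nsym_scale ((-1) ^ (m - 1) / of_nat m) (ext_power (\<lambda>K. G K - ribbon [] K) m)) K)"
    unfolding nsym_log_def using aug_Nil[of G, OF assms]
    by (intro formal_sum_eq_sum) (auto simp: nsym_scale_def ext_power_eq_0 aug_def)
  also have "\<dots> = fps_eval (aug G) (fps_ln 1) K"
    unfolding fps_eval_def by (intro sum.cong) (auto simp: nsym_scale_def fps_ln_nth aug_def)
  finally show "nsym_log G K = fps_eval (aug G) (fps_ln 1) K" .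
qed

lemma nsym_rpow_eq:
  assumes "G [] = 1"
  shows "nsym_rpow G c = fps_eval (aug G) (fps_binomial c)"
proof
  fix K
  let ?P = "fps_const c * fps_ln 1 :: rat fps"
  have "nsym_rpow G c K = (\<Sum>m\<le>sum_list K. nsym_scale (1 / fact m) (ext_power (fps_eval (aug G) ?P) m) K)"
    unfolding nsym_rpow_def nsym_exp_def nsym_log_eq[of G, OF assms] fps_eval_const_mult[symmetric]
    by (intro formal_sum_eq_sum)
      (simp add: nsym_scale_def ext_power_eq_0 fps_eval_def)
  also have "\<dots> = (\<Sum>m\<le>sum_list K. 1 / fact m * fps_eval (aug G) (?P ^ m) K)"
    by (simp add: fps_eval_power aug_Nil[of G, OF assms] nsym_scale_def)
  also have "\<dots> = fps_eval (aug G) (fps_exp 1 oo ?P) K"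
    using aug_Nil[of G, OF assms] by (intro fps_eval_exp_compose) auto
  finally show "nsym_rpow G c K = fps_eval (aug G) (fps_binomial c) K"
    by (simp add: fps_exp_compose_ln)
qed

section \<open>The elements \<open>V\<close>, \<open>I\<close> and \<open>J\<close>\<close>

text \<open>The sign is a Boolean, with \<open>True\<close> for \<open>+\<close>.\<close>

definition V1 :: "bool \<Rightarrow> nsym" where
  "V1 s = (if s then V1_plus else V1_minus)"

definition V2 :: "bool \<Rightarrow> nsym" where
  "V2 s = (if s then V2_plus else V2_minus)"

definition I_sgn :: "bool \<Rightarrow> nat \<Rightarrow> nsym" where
  "I_sgn s k = (if s then I_plus k else I_minus k)"

definition J_sgn :: "bool \<Rightarrow> nat \<Rightarrow> nsym" where
  "J_sgn s k = (if s then J_plus k else J_minus k)"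

primrec V :: "nat \<Rightarrow> bool \<Rightarrow> nsym" where
  "V 0 s = ribbon []"
| "V (Suc m) s = V1 s \<star> V m (\<not> s)"

lemma V1_plus_eq: "V1_plus K = (if K = (if sum_list K = 0 then [] else [sum_list K]) then 1 else 0)"
proof -
  have "V1_plus K = (\<Sum>i\<in>{sum_list K}. ribbon (if i = 0 then [] else [i]) K)"
    unfolding V1_plus_def formal_sum_def
    by (rule Sum_any.expand_superset) (auto simp: ribbon_def)
  then show ?thesis by (simp add: ribbon_def)
qed

lemma V1_minus_eq: "V1_minus K = (if K = replicate (sum_list K) 1 then 1 else 0)"
proof -
  have "V1_minus K = (\<Sum>i\<in>{sum_list K}. ribbon (replicate i 1) K)"
    unfolding V1_minus_def formal_sum_def
    by (rule Sum_any.expand_superset) (auto simp: ribbon_def sum_list_replicate split: if_splits)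
  then show ?thesis by (simp add: ribbon_def)
qed

lemma supported_V1 [simp]: "supported (V1 s)"
proof -
  have "composition (if m = 0 then [] else [m])" "composition (replicate m 1)" for m
    by (auto simp: composition_def)
  then have "V1_plus K = 0" "V1_minus K = 0" if "\<not> composition K" for K
    using that unfolding V1_plus_eq V1_minus_eq by metis+
  then show ?thesis by (simp add: supported_def V1_def)
qed

lemma V1_Nil [simp]: "V1 s [] = 1"
  by (simp add: V1_def V1_plus_eq V1_minus_eq)

lemma V2_eq: "V2 s = V1 s \<star> V1 (\<not> s)"
  by (simp add: V2_def V1_def V2_plus_def V2_minus_def)

lemma supported_V2 [simp]: "supported (V2 s)"
  by (simp add: V2_eq)

lemma V2_Nil [simp]: "V2 s [] = 1"
  by (simp add: V2_eq)

lemma aug_V2_Nil [simp]: "aug (V2 s) [] = 0"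
  by (simp add: aug_Nil)

lemma V_even: "V (2 * j) s = ext_power (V2 s) j"
  by (induction j) (auto simp: V2_eq ext_prod_assoc)

lemma V_odd: "V (Suc (2 * j)) s = V1 s \<star> ext_power (V2 (\<not> s)) j"
  by (simp only: V.simps V_even)

lemma I_sgn_eq:
  "I_sgn s k = nsym_scale (1 / fact k) (fps_eval (aug (V2 s)) ((fps_const (1/2) * fps_ln 1) ^ k))"
proof -
  have "I_sgn s k = nsym_scale (1 / fact k) (ext_power (nsym_scale (1/2) (nsym_log (V2 s))) k)"
    by (simp add: I_sgn_def V2_def I_plus_def I_minus_def)
  then show ?thesis
    by (simp only: nsym_log_eq V2_Nil fps_eval_const_mult[symmetric] fps_eval_power aug_V2_Nil)
qed

lemma J_sgn_eq: "J_sgn s k = V1 s \<star> fps_eval (aug (V2 (\<not> s))) (fps_binomial (-1/2)) \<star> I_sgn (\<not> s) k"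
proof -
  have "J_sgn s k = V1 s \<star> nsym_rpow (V2 (\<not> s)) (-1/2) \<star> I_sgn (\<not> s) k"
    by (simp add: J_sgn_def V2_def I_sgn_def V1_def J_plus_def J_minus_def)
  then show ?thesis by (simp only: nsym_rpow_eq V2_Nil)
qed

lemma I_sgn_eq_0: "sum_list K < k \<Longrightarrow> I_sgn s k K = 0"
  using startsby_zero_power_prefix[of "fps_const (1/2) * fps_ln 1 :: rat fps" k]
  by (auto simp: I_sgn_eq nsym_scale_def fps_eval_def intro!: sum.neutral)

text \<open>The power \<open>c\<close> of \<open>V2 s\<close> is the exponential of
  \<open>2 * c\<close> times half its logarithm, and half the logarithm is what \<open>I_sgn\<close>
  is built from. The free bound \<open>N\<close> serves the pieces of a cut.\<close>

lemma V2_power_expansion: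
  assumes "sum_list K \<le> N"
  shows "fps_eval (aug (V2 s)) (fps_binomial c) K = (\<Sum>k\<le>N. (2 * c) ^ k * I_sgn s k K)"
proof -
  have "(\<Sum>k\<le>N. (2 * c) ^ k * I_sgn s k K) = (\<Sum>k\<le>sum_list K. (2 * c) ^ k * I_sgn s k K)"
    using assms by (intro sum.mono_neutral_right) (auto simp: I_sgn_eq_0)
  also have "\<dots> = (\<Sum>k\<le>sum_list K. 1 / fact k * fps_eval (aug (V2 s)) ((fps_const c * fps_ln 1) ^ k) K)"
  proof (intro sum.cong refl)
    fix k
    have "(fps_const c * fps_ln 1) ^ k = fps_const ((2 * c) ^ k) * (fps_const (1/2) * fps_ln 1 :: rat fps) ^ k"
    proof -
      have "fps_const c * fps_ln 1 = fps_const (2 * c) * (fps_const (1/2) * fps_ln 1 :: rat fps)"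
        by (simp add: mult.assoc[symmetric])
      then show ?thesis by (simp only: power_mult_distrib fps_const_power)
    qed
    then show "(2 * c) ^ k * I_sgn s k K = 1 / fact k * fps_eval (aug (V2 s)) ((fps_const c * fps_ln 1) ^ k) K"
      by (simp add: I_sgn_eq fps_eval_const_mult nsym_scale_def)
  qed
  also have "\<dots> = fps_eval (aug (V2 s)) (fps_exp 1 oo (fps_const c * fps_ln 1)) K"
    by (intro fps_eval_exp_compose) auto
  finally show ?thesis by (simp add: fps_exp_compose_ln)
qed

text \<open>Splitting off the exponent \<open>-1/2\<close> completes \<open>V1 s\<close> to
  \<open>J_sgn s 0\<close>. What remains has exponent \<open>c + 1/2\<close>, whose double
  \<open>2 * c + 1\<close> is the number of alternating factors when \<open>c\<close> is a natural
  number.\<close>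

lemma V1_V2_power_expansion:
  "(V1 s \<star> fps_eval (aug (V2 (\<not> s))) (fps_binomial c)) K =
     (\<Sum>k\<le>sum_list K. (2 * c + 1) ^ k * J_sgn s k K)"
proof (cases "composition K")
  case True
  let ?N = "sum_list K"
  let ?E = "fps_eval (aug (V2 (\<not> s)))"
  let ?F = "V1 s \<star> ?E (fps_binomial (-1/2))"
  have "fps_binomial c = fps_binomial (-1/2) * fps_binomial (c + 1/2)"
    by (simp add: fps_binomial_add_mult[symmetric])
  then have "(V1 s \<star> ?E (fps_binomial c)) K = (?F \<star> ?E (fps_binomial (c + 1/2))) K"
    by (simp add: fps_eval_mult ext_prod_assoc)
  also have "\<dots> = (\<Sum>i\<le>?N. ?F (cut_left i K) * (\<Sum>k\<le>?N. (2 * c + 1) ^ k * I_sgn (\<not> s) k (cut_right i K)))"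
    unfolding ext_prod_composition[OF True, of ?F]
    by (intro sum.cong refl, subst V2_power_expansion[of _ ?N]) (auto simp: algebra_simps)
  also have "\<dots> = (\<Sum>k\<le>?N. (2 * c + 1) ^ k * (?F \<star> I_sgn (\<not> s) k) K)"
    unfolding ext_prod_composition[OF True, of ?F] sum_distrib_left
    by (subst sum.swap) (simp add: mult_ac)
  finally show ?thesis by (simp add: J_sgn_eq)
next
  case False
  then show ?thesis by (simp add: J_sgn_eq)
qed

lemma V_expansion:
  "V m s K = (\<Sum>k\<le>sum_list K. of_nat m ^ k * (if even m then I_sgn s k K else J_sgn s k K))"
proof (cases "even m")
  case True
  then obtain j where m: "m = 2 * j" by blast
  have "V m s = fps_eval (aug (V2 s)) (fps_binomial (of_nat j))"
    by (simp add: m V_even fps_binomial_of_nat fps_eval_power[symmetric] fps_eval_aug)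
  then show ?thesis using V2_power_expansion[of K "sum_list K" s "of_nat j"] m by simp
next
  case False
  then obtain j where m: "m = Suc (2 * j)" by (auto elim: oddE)
  have "V m s = V1 s \<star> fps_eval (aug (V2 (\<not> s))) (fps_binomial (of_nat j))"
    by (simp only: m V_odd fps_binomial_of_nat fps_eval_power[symmetric] fps_eval_aug 
        V2_Nil supported_V2 aug_V2_Nil)
  then show ?thesis using V1_V2_power_expansion[of s "of_nat j" K] m by (simp add: add.commute)
qed

section \<open>Recursion for products with \<open>V1\<close>\<close>

text \<open>A new cell is placed before \<open>K\<close>, inside the first part for an ascent and as
  a part of its own for a descent. Starting from \<open>[1]\<close> this produces every nonempty
  composition, which yields induction along words of directions.\<close>

definition attach :: "bool \<Rightarrow> nat list \<Rightarrow> nat list" where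
  "attach d K = (if d then Suc (hd K) # tl K else 1 # K)"

lemma attach_neq_Nil [simp]: "attach d K \<noteq> []"
  by (simp add: attach_def)

lemma composition_attach [simp]: "composition K \<Longrightarrow> composition (attach d K)"
  by (cases K) (auto simp: attach_def)

lemma sum_list_attach [simp]: "K \<noteq> [] \<Longrightarrow> sum_list (attach d K) = Suc (sum_list K)"
  by (cases K) (auto simp: attach_def)

lemma cut_left_attach:
  assumes "composition K" "K \<noteq> []"
  shows "cut_left (Suc i) (attach d K) = (if i = 0 then [1] else attach d (cut_left i K))"
  using assms by (cases K) (auto simp: attach_def)

lemma cut_right_attach:
  assumes "composition K" "K \<noteq> []"
  shows "cut_right (Suc i) (attach d K) = cut_right i K"
  using assms by (cases K) (auto simp: attach_def)

text \<open>\<open>V1_plus\<close> lives on single rows and \<open>V1_minus\<close> on single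
  columns, so only repetitions of the direction \<open>s\<close> survive.\<close>

lemma V1_attach:
  assumes "composition K" "K \<noteq> []"
  shows "V1 s (attach d K) = (if d = s then V1 s K else 0)"
  using assms by (cases K) (auto simp: attach_def V1_def V1_plus_eq V1_minus_eq)

lemma composition_induct [consumes 2, case_names single attach]:
  assumes "composition K" "K \<noteq> []"
    and "P [1]" and "\<And>d K. composition K \<Longrightarrow> K \<noteq> [] \<Longrightarrow> P K \<Longrightarrow> P (attach d K)"
  shows "P K"
  using assms(1,2)
proof (induction "sum_list K" arbitrary: K rule: less_induct)
  case less
  then obtain k K' where K: "K = k # K'" "0 < k" "composition K'" by (cases K) auto
  consider "k = 1" "K' = []" | "k = 1" "K' \<noteq> []" | "k > 1" using K by linarith
  then show ?case
  proof cases
    case 1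
    then show ?thesis using K assms(3) by simp
  next
    case 2
    then have "P (attach False K')" using K less.hyps by (intro assms(4)) auto
    then show ?thesis using 2 K by (simp add: attach_def)
  next
    case 3
    then have "P (attach True ((k - 1) # K'))" using K less.hyps by (intro assms(4)) auto
    then show ?thesis using 3 K by (simp add: attach_def)
  qed
qed

lemma V1_single [simp]: "V1 s [Suc 0] = 1"
  by (simp add: V1_def V1_plus_eq V1_minus_eq)

lemma V1_prod_single: "(V1 s \<star> G) [Suc 0] = G [Suc 0] + G []"
  by (simp add: ext_prod_composition)

lemma V1_prod_attach:
  assumes "composition K" "K \<noteq> []"
  shows "(V1 s \<star> G) (attach d K) = G (attach d K) + (if d = s then (V1 s \<star> G) K else G K)"
proof -
  let ?f = "\<lambda>i. V1 s (cut_left i K) * G (cut_right i K)"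
  have K: "composition (attach d K)" using assms by simp
  have "(V1 s \<star> G) (attach d K) = G (attach d K) +
      (\<Sum>i\<le>sum_list K. V1 s (cut_left (Suc i) (attach d K)) * G (cut_right (Suc i) (attach d K)))"
    using assms by (simp add: ext_prod_composition sum.atMost_Suc_shift del: sum.atMost_Suc)
  also have "(\<Sum>i\<le>sum_list K. V1 s (cut_left (Suc i) (attach d K)) * G (cut_right (Suc i) (attach d K))) =
      (\<Sum>i\<le>sum_list K. if i = 0 then G K else if d = s then ?f i else 0)"
    using assms by (intro sum.cong refl)
      (auto simp: cut_left_attach cut_right_attach V1_attach cut_left_eq_Nil_iff)
  also have "\<dots> = (if d = s then (V1 s \<star> G) K else G K)"
  proof (cases "d = s")
    case True
    then show ?thesis using assms by (auto simp: ext_prod_composition intro!: sum.cong)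
  next
    case False
    then have "(\<Sum>i\<le>sum_list K. if i = 0 then G K else if d = s then ?f i else 0) =
        (\<Sum>i\<le>sum_list K. if i = 0 then G K else 0)"
      by (simp only: if_False)
    with False show ?thesis by simp
  qed
  finally show ?thesis .
qed

section \<open>Parity\<close>

text \<open>The substitution of \<open>- x\<close> for the grading variable \<open>x\<close>. It
  will turn \<open>m\<close> into \<open>- m\<close> in the expansion of \<open>V m s\<close>, which
  is the source of the parity statement.\<close>

definition degree_sign :: "nsym \<Rightarrow> nsym" where
  "degree_sign F = (\<lambda>K. (-1) ^ sum_list K * F K)"

lemma degree_sign_Nil [simp]: "degree_sign F [] = F []"
  by (simp add: degree_sign_def)

lemma supported_degree_sign [simp]: "supported F \<Longrightarrow> supported (degree_sign F)"
  by (simp add: degree_sign_def supported_def)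

lemma degree_sign_ribbon_Nil [simp]: "degree_sign (ribbon []) = ribbon []"
  by (auto simp: degree_sign_def ribbon_def)

lemma degree_sign_ext_prod: "degree_sign (F \<star> G) = degree_sign F \<star> degree_sign G"
proof
  fix K
  show "degree_sign (F \<star> G) K = (degree_sign F \<star> degree_sign G) K"
  proof (cases "composition K")
    case True
    have "(-1) ^ sum_list K = (-1 :: rat) ^ min i (sum_list K) * (-1) ^ (sum_list K - i)" 
      if "i \<le> sum_list K" for i
      using that by (simp add: power_add[symmetric])
    then show ?thesis
      unfolding degree_sign_def ext_prod_composition[OF True] sum_distrib_left
      by (intro sum.cong refl) (simp add: mult_ac)
  qed (simp add: degree_sign_def)
qed

text \<open>This lifts the classical relation between complete and elementary symmetric functions.
  In the recursion for \<open>attach d K\<close> the two terms cancel if \<open>d\<close> differs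
  from \<open>s\<close>; if \<open>d = s\<close>, one is 0 outright and the other by
  induction.\<close>

lemma V1_inverse: "V1 s \<star> degree_sign (V1 (\<not> s)) = ribbon []"
proof
  fix K
  show "(V1 s \<star> degree_sign (V1 (\<not> s))) K = ribbon [] K"
  proof (cases "composition K \<and> K \<noteq> []")
    case True
    then have "composition K" "K \<noteq> []" by auto
    then have "(V1 s \<star> degree_sign (V1 (\<not> s))) K = 0"
    proof (induction rule: composition_induct)
      case single
      then show ?case by (simp add: V1_prod_single degree_sign_def)
    next
      case (attach d K)
      then show ?case by (auto simp: V1_prod_attach degree_sign_def V1_attach)
    qed
    with True show ?thesis by (simp add: ribbon_def)
  next
    case False
    then show ?thesis by (cases "K = []") (auto simp: ribbon_def)
  qed
qed

text \<open>The signed factors come in the order that makes the product collapse from the middle: an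
  inner \<open>V1\<close> meets its signed inverse, then the outer one does.\<close>

lemma ext_power_V2_inverse: "ext_power (V2 s) j \<star> degree_sign (ext_power (V2 s) j) = ribbon []"
proof (induction j)
  case (Suc j)
  have V2: "V2 s \<star> degree_sign (V2 s) = ribbon []"
  proof -
    have "V2 s \<star> degree_sign (V2 s) = V1 s \<star> ((V1 (\<not> s) \<star> degree_sign (V1 s)) \<star> degree_sign (V1 (\<not> s)))"
      by (simp only: V2_eq degree_sign_ext_prod ext_prod_assoc)
    also have "\<dots> = ribbon []"
      using V1_inverse[of "\<not> s"] by (simp add: V1_inverse)
    finally show ?thesis .
  qed
  have "ext_power (V2 s) (Suc j) = ext_power (V2 s) j \<star> V2 s"
    using ext_power_add[of "V2 s" j 1] by simp
  then have "ext_power (V2 s) (Suc j) \<star> degree_sign (ext_power (V2 s) (Suc j)) =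
      V2 s \<star> ((ext_power (V2 s) j \<star> degree_sign (ext_power (V2 s) j)) \<star> degree_sign (V2 s))"
    by (metis ext_prod_assoc ext_power.simps(2) degree_sign_ext_prod)
  then show ?case using Suc V2 by simp
qed simp

text \<open>The binomial series gives a left inverse of the power, and it must equal the right
  inverse just found.\<close>

lemma degree_sign_ext_power_V2:
  "degree_sign (ext_power (V2 s) j) = fps_eval (aug (V2 s)) (fps_binomial (- of_nat j))"
proof -
  let ?E = "\<lambda>c. fps_eval (aug (V2 s)) (fps_binomial c)"
  have p: "ext_power (V2 s) j = ?E (of_nat j)"
    by (simp add: fps_binomial_of_nat fps_eval_power[symmetric] fps_eval_aug)
  have "?E (- of_nat j) \<star> ext_power (V2 s) j = ribbon []"
    by (simp add: p fps_eval_mult[symmetric] fps_binomial_add_mult[symmetric])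
  then have "degree_sign (ext_power (V2 s) j) = ?E (- of_nat j) \<star> (ext_power (V2 s) j \<star> degree_sign (ext_power (V2 s) j))"
    by (simp add: ext_prod_assoc[symmetric])
  then show ?thesis by (simp add: ext_power_V2_inverse)
qed

lemma degree_sign_V_expansion:
  "degree_sign (V m s) K = (\<Sum>k\<le>sum_list K. (- of_nat m) ^ k * (if even m then I_sgn s k K else J_sgn s k K))"
proof (cases "even m")
  case True
  then obtain j where m: "m = 2 * j" by blast
  then show ?thesis
    using V2_power_expansion[of K "sum_list K" s "- of_nat j"] by (simp add: V_even degree_sign_ext_power_V2)
next
  case False
  then obtain j where m: "m = Suc (2 * j)" by (auto elim: oddE)
  let ?E = "\<lambda>c. fps_eval (aug (V2 (\<not> s))) (fps_binomial c)"
  \<comment> \<open>This writes the signed \<open>V1 s\<close> as \<open>V1 s\<close> times the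
    inverse of \<open>V2\<close>, so the sign change stays within the family, with exponent
    \<open>-1 - j\<close> in place of \<open>j\<close>.\<close>
  have "V1 s \<star> ?E (-1) = V1 s \<star> degree_sign (V2 (\<not> s))"
    using degree_sign_ext_power_V2[of "\<not> s" 1] by simp
  also have "\<dots> = (V1 s \<star> degree_sign (V1 (\<not> s))) \<star> degree_sign (V1 s)"
    by (simp add: V2_eq degree_sign_ext_prod ext_prod_assoc)
  finally have "degree_sign (V1 s) = V1 s \<star> ?E (-1)" by (simp add: V1_inverse)
  then have "degree_sign (V m s) = V1 s \<star> (?E (-1) \<star> ?E (- of_nat j))"
    by (simp only: m V_odd degree_sign_ext_prod degree_sign_ext_power_V2 ext_prod_assoc)
  then have "degree_sign (V m s) = V1 s \<star> ?E (-1 - of_nat j)"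
    by (simp add: fps_eval_mult[symmetric] fps_binomial_add_mult[symmetric])
  moreover have "2 * (-1 - of_nat j) + 1 = - (of_nat m :: rat)" by (simp add: m)
  ultimately show ?thesis using V1_V2_power_expansion[of s "-1 - of_nat j" K] m by simp
qed

text \<open>A polynomial with infinitely many roots is zero. Only arguments of one parity
  \<open>b\<close> are available, because \<open>V m s\<close> expands in \<open>I\<close> for even
  \<open>m\<close> and in \<open>J\<close> for odd \<open>m\<close>.\<close>

lemma power_sum_coeffs_eq_0:
  fixes a :: "nat \<Rightarrow> rat"
  assumes "\<And>m. even m = b \<Longrightarrow> (\<Sum>k\<le>n. of_nat m ^ k * a k) = 0" and "k \<le> n"
  shows "a k = 0"
proof (rule ccontr)
  define p where "p = (\<Sum>k\<le>n. monom (a k) k)"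
  assume "a k \<noteq> 0"
  moreover have "coeff p k = a k" 
    using assms(2) by (simp add: p_def coeff_sum)
  ultimately have "p \<noteq> 0" by auto
  then have "finite {x. poly p x = 0}" by (rule poly_roots_finite)
  moreover have "of_nat ` {m. even m = b} \<subseteq> {x. poly p x = 0}"
    using assms(1) by (auto simp: p_def poly_sum poly_monom mult.commute)
  ultimately have "finite (of_nat ` {m. even m = b} :: rat set)" by (rule rev_finite_subset)
  then have "finite {m :: nat. even m = b}"
    by (rule finite_imageD) (simp add: inj_on_def)
  moreover have "range (\<lambda>j. if b then 2 * j else Suc (2 * j)) \<subseteq> {m :: nat. even m = b}" by auto
  ultimately have "finite (range (\<lambda>j :: nat. if b then 2 * j else Suc (2 * j)))" by (rule rev_finite_subset)
  then have "finite (UNIV :: nat set)"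
    by (rule finite_imageD) (auto simp: inj_on_def split: if_splits)
  then show False by simp
qed

lemma power_sum_coeffs_eq:
  fixes a a' :: "nat \<Rightarrow> rat"
  assumes "\<And>m. even m = b \<Longrightarrow> (\<Sum>k\<le>n. of_nat m ^ k * a k) = (\<Sum>k\<le>n. of_nat m ^ k * a' k)"
    and "k \<le> n"
  shows "a k = a' k"
  using power_sum_coeffs_eq_0[where b = b and n = n and a = "\<lambda>k. a k - a' k"] assms
  by (simp add: right_diff_distrib sum_subtractf)

text \<open>The second argument is the parity of the number of factors: \<open>True\<close> (even) selects \<open>I\<close>,
  \<open>False\<close> selects \<open>J\<close>.\<close>

definition E_sgn :: "bool \<Rightarrow> bool \<Rightarrow> nat \<Rightarrow> nsym" where
  "E_sgn s b k = (\<lambda>K. if b then I_sgn s k K else J_sgn s k K)"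

lemma V_eq_sum_E: "V m s K = (\<Sum>k\<le>sum_list K. of_nat m ^ k * E_sgn s (even m) k K)"
  by (simp add: V_expansion E_sgn_def)

text \<open>In degree \<open>N\<close>, \<open>degree_sign\<close> multiplies the expansion of
  \<open>V m s\<close> by \<open>(-1)^N\<close>, and it also replaces \<open>m\<close> by
  \<open>- m\<close>. Comparing coefficients of \<open>m^k\<close> leaves 0 unless the parities of
  \<open>k\<close> and \<open>N\<close> agree.\<close>

lemma E_sgn_parity:
  assumes "k \<le> sum_list K" "odd (k + sum_list K)"
  shows "E_sgn s b k K = 0"
proof -
  have "(-1) ^ sum_list K * E_sgn s b k K = (-1) ^ k * E_sgn s b k K"
  proof (rule power_sum_coeffs_eq[where b = b and n = "sum_list K" and a = "\<lambda>k. (-1) ^ sum_list K * E_sgn s b k K"])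
    fix m :: nat assume m: "even m = b"
    have "(-1) ^ sum_list K * V m s K = degree_sign (V m s) K" by (simp add: degree_sign_def)
    also have "\<dots> = (\<Sum>k\<le>sum_list K. of_nat m ^ k * ((-1) ^ k * E_sgn s b k K))"
      by (auto simp: degree_sign_V_expansion E_sgn_def m[symmetric] power_minus[of "of_nat m"] mult_ac intro!: sum.cong)
    finally show "(\<Sum>k\<le>sum_list K. of_nat m ^ k * ((-1) ^ sum_list K * E_sgn s b k K)) =
        (\<Sum>k\<le>sum_list K. of_nat m ^ k * ((-1) ^ k * E_sgn s b k K))"
      by (simp add: V_eq_sum_E m sum_distrib_left mult_ac)
  qed fact
  with assms(2) show ?thesis by (cases "even k") auto
qed

section \<open>Top components\<close>

lemma cut_left_Suc_0 [simp]: "composition K \<Longrightarrow> K \<noteq> [] \<Longrightarrow> cut_left (Suc 0) K = [Suc 0]"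
  by (cases K) auto

text \<open>With no part in degree 0, each of the \<open>sum_list K\<close> factors must take
  exactly one cell, so only the cut after the first cell survives.\<close>

lemma ext_power_top:
  assumes "F [] = 0" "composition K"
  shows "ext_power F (sum_list K) K = F [1] ^ sum_list K"
  using assms(2)
proof (induction "sum_list K" arbitrary: K)
  case 0
  then have "K = []" using sum_list_composition_eq_0_iff by auto
  then show ?case by (simp add: ribbon_def)
next
  case (Suc n)
  then have "K \<noteq> []" by auto
  have "ext_power F (Suc n) K = (\<Sum>i\<le>sum_list K. F (cut_left i K) * ext_power F n (cut_right i K))"
    using Suc.prems by (simp add: ext_prod_composition)
  also have "\<dots> = (\<Sum>i\<in>{1}. F (cut_left i K) * ext_power F n (cut_right i K))"
  proof (rule sum.mono_neutral_right)
    show "\<forall>i\<in>{..sum_list K} - {1}. F (cut_left i K) * ext_power F n (cut_right i K) = 0"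
    proof
      fix i assume i: "i \<in> {..sum_list K} - {1}"
      show "F (cut_left i K) * ext_power F n (cut_right i K) = 0"
      proof (cases "i = 0")
        case False
        with i Suc.hyps(2) have "ext_power F n (cut_right i K) = 0"
          by (intro ext_power_eq_0[of F, OF assms(1)]) auto
        then show ?thesis by simp
      qed (use assms in simp)
    qed
  qed (use Suc.hyps(2) in auto)
  also have "\<dots> = F [1] * F [1] ^ n"
  proof -
    have "ext_power F (sum_list (cut_right 1 K)) (cut_right 1 K) = F [1] ^ sum_list (cut_right 1 K)"
      using Suc.prems Suc.hyps(2) by (intro Suc.hyps(1)) auto
    moreover have "sum_list (cut_right 1 K) = n" using Suc.hyps(2) by simp
    ultimately show ?thesis using Suc.prems \<open>K \<noteq> []\<close> by simp
  qed
  finally show ?case by (simp add: Suc.hyps(2)[symmetric])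
qed

text \<open>Half the logarithm of \<open>V2 s\<close> has coefficient 1 at \<open>[1]\<close>,
  because \<open>V2 s\<close> has coefficient 2 there.\<close>

lemma I_sgn_top:
  assumes "composition K"
  shows "I_sgn s (sum_list K) K = 1 / fact (sum_list K)"
proof -
  let ?L = "fps_eval (aug (V2 s)) (fps_const (1/2) * fps_ln 1)"
  have "V2 s [1] = 2" by (simp add: V2_eq V1_prod_single)
  then have "?L [1] = 1"
    by (simp add: fps_eval_def aug_def fps_ln_nth ext_prod_composition ribbon_def)
  moreover have "?L [] = 0" by (simp add: fps_eval_def)
  ultimately have "ext_power ?L (sum_list K) K = 1" 
    using ext_power_top[of ?L K] assms by simp
  then show ?thesis by (simp add: I_sgn_eq nsym_scale_def fps_eval_power)
qed

lemma I_sgn_0 [simp]: "I_sgn s 0 = ribbon []"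
  by (simp add: I_sgn_eq nsym_scale_def)

lemma J_sgn_prod: "J_sgn s k = J_sgn s 0 \<star> I_sgn (\<not> s) k"
  by (simp add: J_sgn_eq)

lemma J_sgn_0_Nil [simp]: "J_sgn s 0 [] = 1"
  by (simp add: J_sgn_eq fps_eval_def ribbon_def)

lemma J_sgn_top:
  assumes "composition K"
  shows "J_sgn s (sum_list K) K = 1 / fact (sum_list K)"
proof -
  have "J_sgn s (sum_list K) K =
      (\<Sum>i\<le>sum_list K. J_sgn s 0 (cut_left i K) * I_sgn (\<not> s) (sum_list K) (cut_right i K))"
    by (subst J_sgn_prod) (simp add: ext_prod_composition assms)
  also have "\<dots> = (\<Sum>i\<in>{0}. J_sgn s 0 (cut_left i K) * I_sgn (\<not> s) (sum_list K) (cut_right i K))"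
    by (rule sum.mono_neutral_right) (auto intro!: I_sgn_eq_0)
  finally show ?thesis using assms by (simp add: I_sgn_top)
qed

text \<open>The expansion at \<open>m = 1\<close> writes \<open>V1 s\<close> in degree 2 as the sum
  of \<open>J_sgn s k\<close> for \<open>k\<close> up to 2; the middle term vanishes by parity and
  the last is \<open>1/2\<close>. Each of the two compositions of 2 occurs in exactly one of
  \<open>V1_plus\<close> and \<open>V1_minus\<close>.\<close>

lemma J_sgn_0_degree_2:
  assumes "composition K" "sum_list K = 2"
  shows "J_sgn True 0 K + J_sgn False 0 K = 0"
proof -
  have eq: "V1 s K = J_sgn s 0 K + 1 / 2" for s
  proof -
    have "V1 s K = (\<Sum>k\<le>2. J_sgn s k K)"
      using V_expansion[of 1 s K] assms by simp
    moreover have "J_sgn s 1 K = 0" using E_sgn_parity[of 1 K s False] assms by (simp add: E_sgn_def)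
    moreover have "J_sgn s 2 K = 1/2" using J_sgn_top[of K s] assms by (simp add: fact_numeral)
    ultimately show ?thesis by (simp add: numeral_2_eq_2)
  qed
  have "K = [2] \<or> K = [1, 1]"
  proof -
    obtain k K' where K: "K = k # K'" "0 < k" "composition K'" using assms by (cases K) auto
    show ?thesis
    proof (cases "k = 1")
      case True
      then obtain k' K'' where "K' = k' # K''" using K assms by (cases K') auto
      with K True assms have "k' + sum_list K'' = 1" "0 < k'" by auto
      then have "k' = 1" "sum_list K'' = 0" by linarith+
      with K \<open>K' = k' # K''\<close> True show ?thesis using sum_list_composition_eq_0_iff[of K''] by auto
    next
      case False
      with K assms have "k + sum_list K' = 2" "0 < k" "k \<noteq> 1" by auto
      then have "k = 2" "sum_list K' = 0" by linarith+
      with K show ?thesis using sum_list_composition_eq_0_iff[of K'] by auto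
    qed
  qed
  then have "V1 True K + V1 False K = 1"
    by (auto simp: V1_def V1_plus_eq V1_minus_eq numeral_2_eq_2)
  then show ?thesis using eq[of True] eq[of False] by simp
qed

text \<open>In \<open>J_sgn s 0 \<star> I_sgn (\<not> s) (N - 2)\<close> the second factor needs at
  least \<open>N - 2\<close> cells, so the first takes 0, 1 or 2. Degree 1 is excluded by parity,
  and degree 2 cancels over the two signs. This is why the second family of idempotents stops at
  \<open>n - 4\<close>.\<close>

lemma J_sgn_subtop:
  assumes "composition K" "2 \<le> sum_list K"
  shows "J_sgn True (sum_list K - 2) K + J_sgn False (sum_list K - 2) K =
         I_sgn True (sum_list K - 2) K + I_sgn False (sum_list K - 2) K"
proof -
  let ?N = "sum_list K"
  have eq: "J_sgn s (?N - 2) K = I_sgn (\<not> s) (?N - 2) K + J_sgn s 0 (cut_left 2 K) / fact (?N - 2)" for s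
  proof -
    let ?f = "\<lambda>i. J_sgn s 0 (cut_left i K) * I_sgn (\<not> s) (?N - 2) (cut_right i K)"
    have "J_sgn s (?N - 2) K = (\<Sum>i\<le>?N. ?f i)"
      by (subst J_sgn_prod) (simp add: ext_prod_composition assms)
    also have "\<dots> = (\<Sum>i\<le>2. ?f i)"
      using assms(2) by (intro sum.mono_neutral_right) (auto intro!: I_sgn_eq_0)
    also have "\<dots> = ?f 0 + ?f 1 + ?f 2" by (simp add: numeral_2_eq_2)
    also have "?f 1 = 0"
    proof -
      have "K \<noteq> []" using assms(2) by auto
      then show ?thesis
        using E_sgn_parity[of 0 "[Suc 0]" s False] assms(1) by (simp add: E_sgn_def)
    qed
    also have "?f 2 = J_sgn s 0 (cut_left 2 K) / fact (?N - 2)"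
      using I_sgn_top[of "cut_right 2 K" "\<not> s"] assms by simp
    finally show ?thesis using assms by simp
  qed
  have "J_sgn True 0 (cut_left 2 K) + J_sgn False 0 (cut_left 2 K) = 0"
    using assms by (intro J_sgn_0_degree_2) auto
  then show ?thesis using eq[of True] eq[of False]
    by (simp add: add_divide_distrib[symmetric])
qed

section \<open>Restriction to one-row ribbons\<close>

definition row :: "nat \<Rightarrow> nat list" where
  "row n = (if n = 0 then [] else [n])"

text \<open>Rows are cut into rows, so this is a ring homomorphism to commutative power series. The
  row of length \<open>n\<close> corresponds to the identity permutation, at which the idempotents
  are shown not to vanish.\<close>

definition row_fps :: "nsym \<Rightarrow> rat fps" where
  "row_fps F = Abs_fps (\<lambda>n. F (row n))"

lemma row_fps_nth [simp]: "row_fps F $ n = F (row n)"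
  by (simp add: row_fps_def)

lemma composition_row [simp]: "composition (row n)"
  by (simp add: row_def)

lemma sum_list_row [simp]: "sum_list (row n) = n"
  by (simp add: row_def)

lemma row_fps_ext_prod: "row_fps (F \<star> G) = row_fps F * row_fps G"
proof (rule fps_ext)
  fix n
  have "cut_left i (row n) = row i" "cut_right i (row n) = row (n - i)" if "i \<le> n" for i
    using that by (auto simp: row_def)
  then show "row_fps (F \<star> G) $ n = (row_fps F * row_fps G) $ n"
    by (simp add: ext_prod_composition fps_mult_nth atLeast0AtMost)
qed

lemma row_fps_ribbon_Nil [simp]: "row_fps (ribbon []) = 1"
  by (rule fps_ext) (auto simp: ribbon_def row_def)

lemma row_fps_ext_power: "row_fps (ext_power F m) = row_fps F ^ m"
  by (induction m) (simp_all add: row_fps_ext_prod)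

lemma row_fps_fps_eval: "row_fps (fps_eval X P) = P oo row_fps X"
proof (rule fps_ext)
  fix n
  have "ext_power X m (row n) = (row_fps X ^ m) $ n" for m
    by (simp add: row_fps_ext_power[symmetric])
  then show "row_fps (fps_eval X P) $ n = (P oo row_fps X) $ n"
    by (simp add: fps_eval_def fps_compose_nth atLeast0AtMost)
qed

lemma row_fps_nsym_scale: "row_fps (nsym_scale c F) = fps_const c * row_fps F"
  by (rule fps_ext) (simp add: nsym_scale_def)

lemma row_fps_V1: "row_fps (V1 s) = (if s then inverse (1 - fps_X) else 1 + fps_X)"
proof -
  have "V1_plus (row n) = 1" for n
    unfolding V1_plus_eq[of "row n"] sum_list_row by (simp only: row_def refl if_True)
  then have "row_fps (V1 True) = Abs_fps (\<lambda>n. 1)"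
    by (simp add: fps_eq_iff V1_def)
  moreover have "row_fps (V1 False) = 1 + fps_X"
  proof (rule fps_ext)
    fix n
    have "row n = replicate n 1 \<longleftrightarrow> n \<le> 1"
      by (cases n) (auto simp: row_def)
    then show "row_fps (V1 False) $ n = (1 + fps_X) $ n"
      by (simp add: V1_def V1_minus_eq[of "row n"])
  qed
  moreover have "inverse (1 - fps_X) = (Abs_fps (\<lambda>n. 1) :: rat fps)"
    by (rule fps_inverse_unique, rule fps_ext) (simp add: left_diff_distrib)
  ultimately show ?thesis by (cases s) simp_all
qed

definition V2_aug_fps :: "rat fps" where
  "V2_aug_fps = (1 + fps_X) * inverse (1 - fps_X) - 1"

text \<open>The two orders of the factors in \<open>V2\<close> give the same series because power
  series commute.\<close>

lemma row_fps_aug_V2: "row_fps (aug (V2 s)) = V2_aug_fps"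
proof -
  have "row_fps (aug (V2 s)) = row_fps (V2 s) - row_fps (ribbon [])"
    by (rule fps_ext) (simp add: aug_def ribbon_def row_def)
  then show ?thesis
    by (cases s) (simp_all add: V2_eq row_fps_ext_prod row_fps_V1 V2_aug_fps_def mult.commute)
qed

lemma V2_aug_fps_0 [simp]: "V2_aug_fps $ 0 = 0"
  by (simp add: V2_aug_fps_def)

definition artanh_fps :: "rat fps" where
  "artanh_fps = (fps_const (1/2) * fps_ln 1) oo V2_aug_fps"

lemma row_fps_I_sgn: "row_fps (I_sgn s k) = fps_const (1 / fact k) * artanh_fps ^ k"
  by (simp add: I_sgn_eq row_fps_nsym_scale row_fps_fps_eval row_fps_aug_V2 artanh_fps_def
      fps_compose_power)

lemma fps_X_unit: "(1 - fps_X) * inverse (1 - fps_X) = (1 :: rat fps)"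
  by (rule inverse_mult_eq_1') simp

text \<open>The relation \<open>(1 - x) (1 + Y) = 1 + x\<close> and its derivative stand in for
  computing with the quotient \<open>(1 + x) / (1 - x)\<close>, half of whose logarithm is
  artanh.\<close>

lemma artanh_fps_deriv: "(1 - fps_X\<^sup>2) * fps_deriv artanh_fps = 1"
proof -
  define Y where "Y = V2_aug_fps"
  define A where "A = artanh_fps"
  have h: "(1 - fps_X) * (1 + Y) = 1 + fps_X"
    using fps_X_unit by (simp add: Y_def V2_aug_fps_def mult.left_commute[of "1 - fps_X"])
  then have "fps_deriv ((1 - fps_X) * (1 + Y)) = fps_deriv (1 + fps_X)" by simp
  then have h': "(1 - fps_X) * fps_deriv Y = 1 + (1 + Y)"
    by (simp add: algebra_simps)
  have "fps_deriv A = (fps_const (1/2) * inverse (1 + fps_X) oo V2_aug_fps) * fps_deriv Y"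
    by (simp add: A_def Y_def artanh_fps_def fps_compose_deriv fps_ln_deriv)
  also have "fps_const (1/2) * inverse (1 + fps_X) oo V2_aug_fps = fps_const (1/2) * inverse (1 + Y)"
    by (simp add: fps_compose_mult_distrib fps_inverse_compose fps_compose_add_distrib Y_def)
  finally have "(1 + Y) * fps_deriv A = fps_const (1/2) * ((1 + Y) * inverse (1 + Y)) * fps_deriv Y"
    by (simp add: mult_ac)
  also have "(1 + Y) * inverse (1 + Y) = 1"
    by (rule inverse_mult_eq_1') (simp add: Y_def)
  finally have a: "(1 + Y) * fps_deriv A = fps_const (1/2) * fps_deriv Y" by simp
  have "(1 - fps_X\<^sup>2) * fps_deriv A = (1 - fps_X) * ((1 - fps_X) * (1 + Y)) * fps_deriv A"
    unfolding h by (simp add: algebra_simps power2_eq_square)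
  also have "\<dots> = (1 - fps_X) * (1 - fps_X) * ((1 + Y) * fps_deriv A)" by (simp only: mult_ac)
  also have "\<dots> = fps_const (1/2) * ((1 - fps_X) * ((1 - fps_X) * fps_deriv Y))"
    unfolding a by (simp only: mult_ac)
  also have "\<dots> = fps_const (1/2) * ((1 - fps_X) + (1 - fps_X) * (1 + Y))"
    by (simp only: h' distrib_left mult_1_right)
  also have "\<dots> = fps_const (1/2) * 2" by (simp only: h) simp
  also have "\<dots> = 1" by (simp add: numeral_fps_const)
  finally show ?thesis by (simp add: A_def)
qed

lemma fps_one_minus_X2_mult_nth:
  "((1 - fps_X\<^sup>2) * P) $ n = P $ n - (if n < 2 then 0 else P $ (n - 2))" for P :: "rat fps"
  by (simp add: left_diff_distrib fps_X_power_mult_nth)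

lemma artanh_fps_nth: "artanh_fps $ n = (if odd n then 1 / of_nat n else 0)"
proof (cases n)
  case 0
  then show ?thesis by (simp add: artanh_fps_def)
next
  case (Suc m)
  have "fps_deriv artanh_fps $ m = (if even m then 1 else 0)"
  proof (induction m rule: less_induct)
    case (less m)
    have "((1 - fps_X\<^sup>2) * fps_deriv artanh_fps) $ m = (if m = 0 then 1 else 0)"
      by (simp only: artanh_fps_deriv fps_one_nth)
    then have "fps_deriv artanh_fps $ m - (if m < 2 then 0 else fps_deriv artanh_fps $ (m - 2)) =
        (if m = 0 then 1 else 0)"
      by (simp only: fps_one_minus_X2_mult_nth)
    then show ?case
      using less[of "m - 2"] by (cases "m < 2") (auto simp: less_2_cases_iff simp del: fps_deriv_nth)
  qed
  then have "of_nat (Suc m) * artanh_fps $ Suc m = (if even m then 1 else 0)" by simp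
  then have "artanh_fps $ Suc m = (if even m then 1 else 0) / of_nat (Suc m)"
    by (metis nonzero_mult_div_cancel_left of_nat_neq_0)
  then show ?thesis using Suc by simp
qed

definition nonneg_fps :: "rat fps \<Rightarrow> bool" where
  "nonneg_fps P \<longleftrightarrow> (\<forall>n. 0 \<le> P $ n)"

lemma nonneg_fps_mult: "nonneg_fps P \<Longrightarrow> nonneg_fps Q \<Longrightarrow> nonneg_fps (P * Q)"
  by (auto simp: nonneg_fps_def fps_mult_nth intro!: sum_nonneg)

lemma nonneg_fps_power: "nonneg_fps P \<Longrightarrow> nonneg_fps (P ^ k)"
  by (induction k) (auto intro: nonneg_fps_mult simp: nonneg_fps_def[of 1])

lemma fps_mult_pos:
  assumes "nonneg_fps P" "nonneg_fps Q" "0 < P $ i" "0 < Q $ j"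
  shows "0 < (P * Q) $ (i + j)"
proof -
  have "0 < P $ i * Q $ (i + j - i)" using assms by simp
  also have "\<dots> \<le> (\<Sum>l=0..i + j. P $ l * Q $ (i + j - l))"
    using assms(1,2) by (intro member_le_sum) (auto simp: nonneg_fps_def)
  finally show ?thesis by (simp add: fps_mult_nth)
qed

lemma nonneg_artanh: "nonneg_fps artanh_fps"
  by (simp add: nonneg_fps_def artanh_fps_nth)

lemma artanh_power_pos:
  assumes "1 \<le> k" "k \<le> n" "even (n + k)"
  shows "0 < (artanh_fps ^ k) $ n"
  using assms
proof (induction k arbitrary: n rule: nat_induct_at_least)
  case base
  then show ?case by (auto simp: artanh_fps_nth)
next
  case (Suc k)
  \<comment> \<open>One factor contributes its linear term, and the remaining power keeps the right
    parity.\<close>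
  then have "0 < (artanh_fps * artanh_fps ^ k) $ (1 + (n - 1))"
    by (intro fps_mult_pos nonneg_artanh nonneg_fps_power Suc.IH) (auto simp: artanh_fps_nth)
  with Suc.prems show ?case by simp
qed

text \<open>This is the series \<open>(1 - x^2)^(-1/2)\<close>, by \<open>J0_fps_square\<close>; the
  other sign gives its inverse, by \<open>row_fps_J_False\<close>.\<close>

definition J0_fps :: "rat fps" where
  "J0_fps = row_fps (J_sgn True 0)"

lemma row_fps_J_sgn_0: 
  "row_fps (J_sgn s 0) = row_fps (V1 s) * (fps_binomial (-1/2) oo V2_aug_fps)"
  by (simp add: J_sgn_eq row_fps_ext_prod row_fps_fps_eval row_fps_aug_V2)

lemma row_fps_J_sgn:
  "row_fps (J_sgn s k) = row_fps (J_sgn s 0) * (fps_const (1 / fact k) * artanh_fps ^ k)"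
  by (subst J_sgn_prod) (simp add: row_fps_ext_prod row_fps_I_sgn)

lemma row_fps_J_False: "row_fps (J_sgn False 0) = (1 - fps_X\<^sup>2) * J0_fps"
proof -
  have "(1 - fps_X\<^sup>2) * inverse (1 - fps_X) = (1 + fps_X) * ((1 - fps_X) * inverse (1 - fps_X :: rat fps))"
    by (simp add: algebra_simps power2_eq_square)
  then have "(1 - fps_X\<^sup>2) * inverse (1 - fps_X) = (1 + fps_X :: rat fps)"
    by (simp only: fps_X_unit mult_1_right)
  then show ?thesis by (simp add: J0_fps_def row_fps_J_sgn_0 row_fps_V1 mult.assoc[symmetric])
qed

lemma J0_fps_square: "(1 - fps_X\<^sup>2) * J0_fps\<^sup>2 = 1"
proof -
  define H where "H = fps_binomial (-1/2) oo V2_aug_fps"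
  have "H\<^sup>2 * (1 + V2_aug_fps) = (fps_binomial (-1/2) * fps_binomial (-1/2) * fps_binomial 1) oo V2_aug_fps"
    by (simp add: H_def power2_eq_square fps_compose_mult_distrib fps_binomial_1 fps_compose_add_distrib)
  also have "\<dots> = 1" by (simp add: fps_binomial_add_mult[symmetric])
  finally have H: "H\<^sup>2 * ((1 + fps_X) * inverse (1 - fps_X)) = 1" by (simp add: V2_aug_fps_def)
  have B: "J0_fps = inverse (1 - fps_X) * H"
    by (simp add: J0_fps_def row_fps_J_sgn_0 row_fps_V1 H_def)
  have "(1 - fps_X\<^sup>2) * J0_fps\<^sup>2 = (1 + fps_X) * ((1 - fps_X) * inverse (1 - fps_X)) * (inverse (1 - fps_X) * H\<^sup>2)"
    by (simp add: B power2_eq_square algebra_simps)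
  also have "\<dots> = 1" using H by (simp only: fps_X_unit mult_1_right) (simp add: mult_ac)
  finally show ?thesis .
qed

lemma J0_fps_0: "J0_fps $ 0 = 1"
  by (simp add: J0_fps_def row_def)

lemma J0_fps_deriv: "(1 - fps_X\<^sup>2) * fps_deriv J0_fps = fps_X * J0_fps"
proof -
  have "fps_deriv ((1 - fps_X\<^sup>2) * J0_fps\<^sup>2) = 0" by (simp only: J0_fps_square) simp
  \<comment> \<open>The derivative of the square relation has the factor \<open>2 * J0_fps\<close>,
    which can be cancelled.\<close>
  then have "(2 * J0_fps) * ((1 - fps_X\<^sup>2) * fps_deriv J0_fps - fps_X * J0_fps) = 0"
    by (simp add: power2_eq_square algebra_simps)
  moreover have "J0_fps \<noteq> 0" using J0_fps_0 by auto
  ultimately show ?thesis by simp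
qed

lemma J0_fps_1: "J0_fps $ 1 = 0"
proof -
  have "((1 - fps_X\<^sup>2) * fps_deriv J0_fps) $ 0 = (fps_X * J0_fps) $ 0" by (simp only: J0_fps_deriv)
  then show ?thesis by (simp add: fps_one_minus_X2_mult_nth)
qed

lemma J0_fps_rec: "of_nat (n + 2) * J0_fps $ (n + 2) = of_nat (n + 1) * J0_fps $ n"
proof -
  have "((1 - fps_X\<^sup>2) * fps_deriv J0_fps) $ (n + 1) = (fps_X * J0_fps) $ (n + 1)" by (simp only: J0_fps_deriv)
  then show ?thesis
    by (cases n) (simp_all add: fps_one_minus_X2_mult_nth algebra_simps numeral_2_eq_2)
qed

lemma J0_fps_nth: "if even n then 0 < J0_fps $ n else J0_fps $ n = 0"
proof (induction n rule: less_induct)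
  case (less n)
  consider "n = 0" | "n = 1" | m where "n = m + 2"
    by (metis One_nat_def add_2_eq_Suc' not0_implies_Suc)
  then show ?case
  proof cases
    case 3
    have "of_nat n * J0_fps $ n = of_nat (m + 1) * J0_fps $ m" using J0_fps_rec[of m] 3 by simp
    moreover have "if even m then 0 < J0_fps $ m else J0_fps $ m = 0" using less[of m] 3 by simp
    ultimately have "if even n then 0 < of_nat n * J0_fps $ n else of_nat n * J0_fps $ n = 0" 
      using 3 by auto
    then show ?thesis using 3 by (auto simp: zero_less_mult_iff split: if_splits)
  qed (use J0_fps_0 J0_fps_1 in auto)
qed

lemma J0_fps_nonneg: "0 \<le> J0_fps $ n"
  using J0_fps_nth[of n] by (auto split: if_splits)

text \<open>The term of degree \<open>d\<close> in \<open>P\<close> is paired with the term of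
  degree \<open>n - d\<close> in the power of artanh; nothing can cancel since all coefficients are
  nonnegative.\<close>

lemma prod_artanh_nonzero:
  assumes "nonneg_fps P" "\<And>j. even j \<Longrightarrow> d \<le> j \<Longrightarrow> 0 < P $ j" "even d" "k + d \<le> n" "even (n + k)"
  shows "0 < (P * (fps_const (1 / fact k) * artanh_fps ^ k)) $ n"
proof (cases "k = 0")
  case True
  then show ?thesis using assms by simp
next
  case False
  have "0 < (P * artanh_fps ^ k) $ (d + (n - d))"
    using assms False
    by (intro fps_mult_pos nonneg_fps_power nonneg_artanh artanh_power_pos) auto
  moreover have "(P * (fps_const (1 / fact k) * artanh_fps ^ k)) $ n = 1 / fact k * (P * artanh_fps ^ k) $ n"
    by (simp add: mult.left_commute[of P])
  ultimately show ?thesis using assms(4) by simp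
qed

lemma I_row_pos:
  assumes "1 \<le> k" "k \<le> n" "even (n + k)"
  shows "0 < I_sgn s k (row n)"
proof -
  have "I_sgn s k (row n) = 1 / fact k * (artanh_fps ^ k) $ n"
    using row_fps_I_sgn[of s k] by (metis fps_mult_left_const_nth row_fps_nth)
  then show ?thesis using artanh_power_pos[OF assms] by simp
qed

lemma J_diff_row_pos:
  assumes "k + 2 \<le> n" "even (n + k)"
  shows "0 < J_sgn True k (row n) - J_sgn False k (row n)"
proof -
  let ?P = "fps_X\<^sup>2 * J0_fps"
  have "J_sgn True k (row n) - J_sgn False k (row n) = 
      (row_fps (J_sgn True k) - row_fps (J_sgn False k)) $ n" by simp
  \<comment> \<open>Subtracting \<open>(1 - x^2) B\<close> from \<open>B\<close> leaves
    \<open>x^2 B\<close>, whose order 2 matches the bound on \<open>k\<close>.\<close>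
  also have "row_fps (J_sgn True k) - row_fps (J_sgn False k) = ?P * (fps_const (1 / fact k) * artanh_fps ^ k)"
    by (subst (1 2) row_fps_J_sgn) (simp only: row_fps_J_False J0_fps_def[symmetric], simp add: algebra_simps)
  also have "0 < \<dots> $ n"
    using assms by (intro prod_artanh_nonzero[of _ 2])
      (use J0_fps_nonneg J0_fps_nth in \<open>auto simp: nonneg_fps_def fps_X_power_mult_nth\<close>)
  finally show ?thesis .
qed

text \<open>The series \<open>B + 1/B - 2\<close> with \<open>B = J0_fps\<close> has order 4: by the
  recursion for \<open>B\<close>, its coefficient at \<open>x^j\<close> is
  \<open>(j - 2) / j\<close> times that of \<open>B\<close> at \<open>x^(j-2)\<close>, which
  vanishes for \<open>j = 2\<close>. Hence the bound \<open>k + 4 \<le> n\<close>.\<close>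

lemma JI_row_pos:
  assumes "k + 4 \<le> n" "even (n + k)"
  shows "0 < J_sgn True k (row n) + J_sgn False k (row n) - I_sgn True k (row n) - I_sgn False k (row n)"
proof -
  let ?P = "J0_fps + (1 - fps_X\<^sup>2) * J0_fps - 2"
  have P: "?P $ j = (if j < 2 then 0 else of_nat (j - 2) / of_nat j * J0_fps $ (j - 2))" for j
  proof (cases "j < 2")
    case True
    then have "j = 0 \<or> j = 1" by auto
    then show ?thesis using J0_fps_0 J0_fps_1 by (auto simp: fps_one_minus_X2_mult_nth fps_numeral_nth)
  next
    case False
    then obtain m where j: "j = m + 2" by (metis add.commute le_add_diff_inverse not_less)
    have "?P $ j = 2 * J0_fps $ j - J0_fps $ m"
      by (simp add: fps_one_minus_X2_mult_nth fps_numeral_nth j)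
    also have "J0_fps $ j = of_nat (m + 1) / of_nat (m + 2) * J0_fps $ m"
      using J0_fps_rec[of m] j by (simp add: field_simps)
    also have "2 * (of_nat (m + 1) / of_nat (m + 2) * J0_fps $ m) - J0_fps $ m = of_nat m / of_nat (m + 2) * J0_fps $ m"
      by (simp add: field_simps)
    finally show ?thesis using j by simp
  qed
  have "J_sgn True k (row n) + J_sgn False k (row n) - I_sgn True k (row n) - I_sgn False k (row n) = 
      (row_fps (J_sgn True k) + row_fps (J_sgn False k) - row_fps (I_sgn True k) - row_fps (I_sgn False k)) $ n" 
    by simp
  also have "row_fps (J_sgn True k) + row_fps (J_sgn False k) - row_fps (I_sgn True k) - row_fps (I_sgn False k)
      = ?P * (fps_const (1 / fact k) * artanh_fps ^ k)"
    by (subst (1 2) row_fps_J_sgn) 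
      (simp only: row_fps_J_False row_fps_I_sgn J0_fps_def[symmetric], simp add: algebra_simps)
  also have "0 < \<dots> $ n"
  proof (rule prod_artanh_nonzero[of _ 4])
    show "nonneg_fps ?P" unfolding nonneg_fps_def P using J0_fps_nonneg by simp
    show "0 < ?P $ j" if "even j" "4 \<le> j" for j
      unfolding P using that J0_fps_nth[of "j - 2"] by (auto split: if_splits)
  qed (use assms in auto)
  finally show ?thesis .
qed

section \<open>Coefficients of \<open>V\<close>\<close>

text \<open>A word records the directions between adjacent entries, \<open>True\<close> being an ascent.\<close>

fun word_comp :: "bool list \<Rightarrow> nat list" where
  "word_comp [] = [1]"
| "word_comp (d # w) = attach d (word_comp w)"

text \<open>A word \<open>w\<close> stands for a composition of \<open>length w + 1\<close>, never
  for the empty one, so the empty product has coefficient 0 at it. The last clause is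
  \<open>V1_prod_attach\<close>.\<close>

fun V_coeff :: "nat \<Rightarrow> bool \<Rightarrow> bool list \<Rightarrow> nat" where
  "V_coeff 0 s w = 0"
| "V_coeff (Suc m) s [] = Suc m"
| "V_coeff (Suc m) s (d # w) =
     V_coeff m (\<not> s) (d # w) + (if d = s then V_coeff (Suc m) s w else V_coeff m (\<not> s) w)"

lemma V_coeff_Nil [simp]: "V_coeff m s [] = m"
  by (cases m) auto

lemma word_comp_neq_Nil [simp]: "word_comp w \<noteq> []"
  by (cases w) auto

lemma composition_word_comp [simp]: "composition (word_comp w)"
  by (induction w) auto

lemma sum_list_word_comp [simp]: "sum_list (word_comp w) = Suc (length w)"
  by (induction w) auto

lemma V_Nil [simp]: "V m s [] = 1"
  by (induction m arbitrary: s) (auto simp: ribbon_def)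

lemma V_word_comp: "V m s (word_comp w) = of_nat (V_coeff m s w)"
proof (induction m arbitrary: s w)
  case 0
  then show ?case by (simp add: ribbon_def)
next
  case (Suc m)
  have IH: "V m s (word_comp w) = of_nat (V_coeff m s w)" for s w by fact
  show ?case
  proof (induction w)
    case Nil
    then show ?case using IH[of "\<not> s" "[]"] by (simp add: V1_prod_single)
  next
    case (Cons d w)
    then show ?case
      using IH[of "\<not> s" "d # w"] IH[of "\<not> s" w] by (simp add: V1_prod_attach)
  qed
qed

section \<open>Dependence of the coefficients on the number of runs\<close>

fun nruns :: "bool list \<Rightarrow> nat" where
  "nruns [] = 0"
| "nruns [d] = 1"
| "nruns (d # e # w) = (if d = e then nruns (e # w) else Suc (nruns (e # w)))"

lemma nruns_pos: "w \<noteq> [] \<Longrightarrow> 0 < nruns w"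
  by (induction w rule: nruns.induct) auto

lemma nruns_le_length: "nruns w \<le> length w"
  by (induction w rule: nruns.induct) auto

text \<open>Neither identity is provable alone: each one at \<open>m + 1\<close> follows from the other at \<open>m\<close>.\<close>

lemma V_coeff_exchange:
  "V_coeff m s (s # (\<not> s) # w) = V_coeff m s ((\<not> s) # (\<not> s) # w)"
  "V_coeff m s (s # s # w) = V_coeff m s ((\<not> s) # s # w) + V_coeff m s w"
proof (induction m arbitrary: s w)
  case (Suc m)
  {
    case 1
    then show ?case using Suc(2)[of "\<not> s" w] by simp
  next
    case 2
    then show ?case using Suc(1)[of "\<not> s" w] by simp
  }
qed simp_all

text \<open>One letter crosses the border between the first two runs. After one unfolding of the
  recursion, the remaining difference is the first identity of \<open>V_coeff_exchange\<close> at
  the sign \<open>d\<close>.\<close>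

lemma V_coeff_move: "V_coeff m s (d # d # (\<not> d) # w) = V_coeff m s (d # (\<not> d) # (\<not> d) # w)"
proof (induction m arbitrary: s)
  case (Suc m)
  show ?case
  proof (cases "d = s")
    case True
    then show ?thesis using Suc[of "\<not> s"] V_coeff_exchange(1)[of "Suc m" s w] by simp
  next
    case False
    then have "d = (\<not> s)" by auto
    then show ?thesis using Suc[of "\<not> s"] V_coeff_exchange(1)[of m "\<not> s" w] by simp
  qed
qed simp

definition V_coeff_equiv :: "bool list \<Rightarrow> bool list \<Rightarrow> bool" where
  "V_coeff_equiv w w' \<longleftrightarrow> (\<forall>m s. V_coeff m s w = V_coeff m s w')"

lemma V_coeff_equiv_refl [simp]: "V_coeff_equiv w w"
  by (simp add: V_coeff_equiv_def)

lemma V_coeff_equiv_trans [trans]: "V_coeff_equiv u v \<Longrightarrow> V_coeff_equiv v w \<Longrightarrow> V_coeff_equiv u w"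
  by (simp add: V_coeff_equiv_def)

lemma V_coeff_equiv_Cons: "V_coeff_equiv w w' \<Longrightarrow> V_coeff_equiv (d # w) (d # w')"
  unfolding V_coeff_equiv_def
proof (intro allI)
  fix m s
  assume "\<forall>m s. V_coeff m s w = V_coeff m s w'"
  then show "V_coeff m s (d # w) = V_coeff m s (d # w')"
    by (induction m arbitrary: s) auto
qed

text \<open>The normal form of a word with \<open>k\<close> runs: all runs but the last have length
  1.\<close>

fun canonical_word :: "bool \<Rightarrow> nat \<Rightarrow> nat \<Rightarrow> bool list" where
  "canonical_word d k 0 = []"
| "canonical_word d k (Suc l) = d # (if k \<le> 1 then canonical_word d k l else canonical_word (\<not> d) (k - 1) l)"

lemma length_canonical_word [simp]: "length (canonical_word d k l) = l"
  by (induction d k l rule: canonical_word.induct) auto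

lemma nruns_canonical_word: "1 \<le> k \<Longrightarrow> k \<le> l \<Longrightarrow> nruns (canonical_word d k l) = k"
proof (induction d k l rule: canonical_word.induct)
  case (2 d k l)
  show ?case
  proof (cases l)
    case 0
    with 2 show ?thesis by simp
  next
    case (Suc l')
    show ?thesis
    proof (cases "k = 1")
      case True
      then show ?thesis using 2 Suc by simp
    next
      case False
      then have "nruns (canonical_word (\<not> d) (k - 1) l) = k - 1" using 2 by simp
      then show ?thesis using False Suc 2 by simp
    qed
  qed
qed simp

lemma V_coeff_equiv_canonical_word: "w \<noteq> [] \<Longrightarrow> V_coeff_equiv w (canonical_word (hd w) (nruns w) (length w))"
proof (induction "length w" arbitrary: w rule: less_induct)
  case less
  obtain d w' where w: "w = d # w'" using less.prems by (cases w) auto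
  show ?case
  proof (cases "w' = []")
    case True
    then show ?thesis by (simp add: w)
  next
    case False
    let ?k = "nruns w'" and ?l = "length w'"
    have 1: "V_coeff_equiv w (d # canonical_word (hd w') ?k ?l)"
      using less.hyps[of w'] w False by (auto intro: V_coeff_equiv_Cons)
    have k: "1 \<le> ?k" using nruns_pos[OF False] by simp
    show ?thesis
    proof (cases "hd w' = d")
      case hd: False
      then have "nruns w = Suc ?k" using w False by (cases w') auto
      then show ?thesis using 1 hd k by (simp add: w)
    next
      case hd: True
      then have nr: "nruns w = ?k" using w False by (cases w') auto
      show ?thesis
      proof (cases "?k = 1")
        case True
        then show ?thesis using 1 hd nr by (simp add: w)
      next
        case k2: False
        have "?k \<le> ?l" by (rule nruns_le_length)
        then obtain l where l: "?l = Suc (Suc l)" using k k2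
          by (metis One_nat_def Suc_le_D le_SucE le_antisym le_zero_eq not_less_eq_eq)
        \<comment> \<open>The normalised tail has at least two runs, so it begins with
          \<open>d\<close> and its negation; \<open>z\<close> is what follows.\<close>
        define z where "z = (if ?k - 1 \<le> 1 then canonical_word (\<not> d) (?k - 1) l else canonical_word d (?k - 1 - 1) l)"
        have z: "canonical_word (\<not> d) (?k - 1) (Suc l) = (\<not> d) # z" by (simp add: z_def)
        have c: "canonical_word d ?k ?l = d # (\<not> d) # z"
          using k k2 z by (simp add: l)
        note 1
        \<comment> \<open>The surplus letter is pushed out of the first run. What follows the first
          letter then has one run fewer than \<open>w\<close> and is normalised by
          induction.\<close>
        also have "V_coeff_equiv (d # canonical_word (hd w') ?k ?l) (d # (\<not> d) # (\<not> d) # z)"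
          using hd c by (simp add: V_coeff_equiv_def V_coeff_move)
        also have "V_coeff_equiv \<dots> (d # canonical_word (\<not> d) (?k - 1) ?l)"
        proof (rule V_coeff_equiv_Cons)
          let ?u = "(\<not> d) # (\<not> d) # z"
          have "nruns (canonical_word (\<not> d) (?k - 1) (Suc l)) = ?k - 1"
            using k k2 \<open>?k \<le> ?l\<close> l by (intro nruns_canonical_word) auto
          then have "nruns ((\<not> d) # z) = ?k - 1" by (simp only: z)
          then have "nruns ?u = ?k - 1" by simp
          moreover have "length ?u = ?l"
            using l by (simp add: z_def)
          moreover have "V_coeff_equiv ?u (canonical_word (hd ?u) (nruns ?u) (length ?u))"
            using \<open>length ?u = ?l\<close> w by (intro less.hyps) auto
          ultimately show "V_coeff_equiv ?u (canonical_word (\<not> d) (?k - 1) ?l)" by simp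
        qed
        also have "d # canonical_word (\<not> d) (?k - 1) ?l = canonical_word (hd w) (nruns w) (length w)"
          using k k2 nr by (simp add: w)
        finally show ?thesis .
      qed
    qed
  qed
qed

lemma V_coeff_cong:
  assumes "w \<noteq> []" "w' \<noteq> []" "length w = length w'" "hd w = hd w'" "nruns w = nruns w'"
  shows "V_coeff m s w = V_coeff m s w'"
  using V_coeff_equiv_canonical_word[OF assms(1)] V_coeff_equiv_canonical_word[OF assms(2)] assms
  by (simp add: V_coeff_equiv_def)

text \<open>Successive runs need factors of alternating sign, and a word whose first direction is
  not \<open>s\<close> wastes the first factor. By \<open>V_coeff_pos\<close> the bound is sharp,
  which gives triangularity in the number of runs.\<close>

lemma V_coeff_eq_0:
  "w \<noteq> [] \<Longrightarrow> m < (if hd w = s then nruns w else Suc (nruns w)) \<Longrightarrow> V_coeff m s w = 0"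
proof (induction m s w rule: V_coeff.induct)
  case (3 m s d w)
  show ?case
  proof (cases w)
    case Nil
    with 3 show ?thesis by (cases "d = s") auto
  next
    case (Cons e w')
    with 3 show ?thesis by (cases "d = s"; cases "d = e") (auto split: if_splits)
  qed
qed auto

lemma V_coeff_pos:
  "w \<noteq> [] \<Longrightarrow> (if hd w = s then nruns w else Suc (nruns w)) \<le> m \<Longrightarrow> 0 < V_coeff m s w"
proof (induction m s w rule: V_coeff.induct)
  case (1 s w)
  then show ?case using nruns_pos[of w] by (auto split: if_splits)
next
  case (3 m s d w)
  show ?case
  proof (cases w)
    case Nil
    with 3 show ?thesis by (cases "d = s") auto
  next
    case (Cons e w')
    with 3 show ?thesis by (cases "d = s"; cases "d = e") (auto split: if_splits)
  qed
qed auto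

section \<open>Chains of colours\<close>

text \<open>These are the colours read along a permutation with directions \<open>w\<close>, where
  even colours have sign \<open>s\<close>. A repeated colour must follow the direction of its sign;
  a rise in colour allows either direction.\<close>

definition colour_chains :: "nat \<Rightarrow> bool \<Rightarrow> bool list \<Rightarrow> nat list set" where
  "colour_chains m s w = {xs. length xs = Suc (length w) \<and> (\<forall>x\<in>set xs. x < m) \<and>
     (\<forall>i<length w. xs ! i < xs ! Suc i \<or> xs ! i = xs ! Suc i \<and> (even (xs ! i) = s) = w ! i)}"

lemma colour_chains_Nil: "colour_chains m s [] = (\<lambda>x. [x]) ` {..<m}"
  by (auto simp: colour_chains_def length_Suc_conv)

lemma colour_chains_Cons:
  "x # y # ys \<in> colour_chains m s (d # w) \<longleftrightarrow>
     (x < y \<or> x = y \<and> (even x = s) = d) \<and> y # ys \<in> colour_chains m s w"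
  by (auto simp: colour_chains_def All_less_Suc2)

lemma map_Suc_colour_chains: "map Suc xs \<in> colour_chains (Suc m) s w \<longleftrightarrow> xs \<in> colour_chains m (\<not> s) w"
  by (auto simp: colour_chains_def)

lemma colour_chains_pos:
  assumes "x # xs \<in> colour_chains (Suc m) s w" "0 < x"
  shows "x # xs \<in> map Suc ` colour_chains m (\<not> s) w"
proof -
  have "\<forall>y\<in>set (x # xs). 0 < y"
    using assms
  proof (induction w arbitrary: x xs)
    case Nil
    then show ?case by (auto simp: colour_chains_Nil)
  next
    case (Cons d w)
    have "length xs = Suc (length w)" using Cons.prems(1) by (simp add: colour_chains_def)
    then obtain y ys where "xs = y # ys" by (cases xs) auto
    with Cons.prems have "y # ys \<in> colour_chains (Suc m) s w" "0 < y"
      by (auto simp: colour_chains_Cons)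
    then have "\<forall>z\<in>set (y # ys). 0 < z" by (rule Cons.IH)
    then show ?case using \<open>xs = y # ys\<close> Cons.prems(2) by simp
  qed
  then have "map Suc (map (\<lambda>y. y - 1) (x # xs)) = x # xs"
    by (simp add: map_idI)
  then show ?thesis
    using assms(1) map_Suc_colour_chains[of "map (\<lambda>y. y - 1) (x # xs)"] by (metis imageI)
qed

text \<open>Chains are divided by whether the first colour is 0. Removing colour 0 shifts the others
  down and negates the sign, which reproduces the recursion of \<open>V_coeff\<close>.\<close>

lemma colour_chains_Suc_Cons:
  "colour_chains (Suc m) s (d # w) = map Suc ` colour_chains m (\<not> s) (d # w) \<union>
     (#) 0 ` (if d = s then colour_chains (Suc m) s w else map Suc ` colour_chains m (\<not> s) w)" (is "?L = ?A \<union> ?B")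
proof (intro equalityI subsetI)
  fix xs assume xs: "xs \<in> ?L"
  then have "length xs = Suc (Suc (length w))" by (simp add: colour_chains_def)
  then obtain x y ys where eq: "xs = x # y # ys" by (auto simp: length_Suc_conv)
  show "xs \<in> ?A \<union> ?B"
  proof (cases "x = 0")
    case False
    then show ?thesis using xs colour_chains_pos[of x "y # ys"] by (auto simp: eq)
  next
    case True
    then have "0 < y \<or> y = 0 \<and> d = s" "y # ys \<in> colour_chains (Suc m) s w"
      using xs by (auto simp: eq colour_chains_Cons)
    then show ?thesis using True colour_chains_pos[of y ys m s w] by (auto simp: eq)
  qed
next
  have neq: "xs \<noteq> []" if "xs \<in> colour_chains m s w" for xs m s
    using that by (auto simp: colour_chains_def)
  fix xs assume "xs \<in> ?A \<union> ?B"
  then show "xs \<in> ?L"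
  proof
    assume "xs \<in> ?B"
    then obtain ys where ys: "xs = 0 # ys"
      "ys \<in> (if d = s then colour_chains (Suc m) s w else map Suc ` colour_chains m (\<not> s) w)" by auto
    show ?thesis
    proof (cases "d = s")
      case True
      with ys have "ys \<in> colour_chains (Suc m) s w" by simp
      then show ?thesis using neq[of ys] True ys(1) by (cases ys) (auto simp: colour_chains_Cons)
    next
      case False
      with ys obtain zs where "zs \<in> colour_chains m (\<not> s) w" "ys = map Suc zs" by auto
      then show ?thesis using neq[of zs] False ys(1) map_Suc_colour_chains[of zs m s w]
        by (cases zs) (auto simp: colour_chains_Cons)
    qed
  qed (auto simp: map_Suc_colour_chains)
qed

lemma card_colour_chains: "finite (colour_chains m s w) \<and> card (colour_chains m s w) = V_coeff m s w"
proof (induction m s w rule: V_coeff.induct)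
  case (1 s w)
  have "colour_chains 0 s w = {}" by (auto simp: colour_chains_def length_Suc_conv)
  then show ?case by simp
next
  case (2 m s)
  then show ?case by (simp add: colour_chains_Nil card_image inj_on_def)
next
  case (3 m s d w)
  let ?A = "map Suc ` colour_chains m (\<not> s) (d # w)"
  let ?B = "(#) 0 ` (if d = s then colour_chains (Suc m) s w else map Suc ` colour_chains m (\<not> s) w)"
  have inj: "inj_on (map Suc) S" for S
    by (rule inj_on_subset[OF inj_mapI]) auto
  have A: "finite ?A" "card ?A = V_coeff m (\<not> s) (d # w)"
    using 3 by (auto simp: card_image inj)
  have B: "finite ?B" "card ?B = (if d = s then V_coeff (Suc m) s w else V_coeff m (\<not> s) w)"
    using 3 by (auto simp: card_image inj)
  have "?A \<inter> ?B = {}" by auto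
  then show ?case using A B by (simp add: colour_chains_Suc_Cons card_Un_disjoint)
qed

section \<open>Sorting permutations\<close>

abbreviation perm_inv :: "(nat \<Rightarrow> nat) \<Rightarrow> nat \<Rightarrow> nat" where
  "perm_inv \<equiv> inv_into UNIV"

definition colour_less :: "(nat \<Rightarrow> bool) \<Rightarrow> (nat \<Rightarrow> nat) \<Rightarrow> nat \<Rightarrow> nat \<Rightarrow> bool" where
  "colour_less sg g x y \<longleftrightarrow> g x < g y \<or> g x = g y \<and> (if sg (g x) then x < y else y < x)"

definition sorts :: "nat \<Rightarrow> (nat \<Rightarrow> bool) \<Rightarrow> (nat \<Rightarrow> nat) \<Rightarrow> (nat \<Rightarrow> nat) \<Rightarrow> bool" where
  "sorts n sg g \<sigma> \<longleftrightarrow> (\<forall>p\<in>{1..n}. \<forall>q\<in>{1..n}. p < q \<longrightarrow> colour_less sg g (\<sigma> p) (\<sigma> q))"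

lemma colour_less_irrefl: "\<not> colour_less sg g x x"
  by (simp add: colour_less_def)

lemma colour_less_trans: "colour_less sg g x y \<Longrightarrow> colour_less sg g y z \<Longrightarrow> colour_less sg g x z"
  by (auto simp: colour_less_def split: if_splits)

lemma colour_less_linear: "x \<noteq> y \<Longrightarrow> colour_less sg g x y \<or> colour_less sg g y x"
  by (auto simp: colour_less_def)

text \<open>The inverse of a sorting permutation gives the rank of each value in the order
  \<open>colour_less\<close>.\<close>

lemma sorts_inv_less_iff:
  assumes "\<sigma> permutes {1..n}" "sorts n sg g \<sigma>" "x \<in> {1..n}" "y \<in> {1..n}"
  shows "perm_inv \<sigma> x < perm_inv \<sigma> y \<longleftrightarrow> colour_less sg g x y"
proof -
  have *: "colour_less sg g x y" if "perm_inv \<sigma> x < perm_inv \<sigma> y" "x \<in> {1..n}" "y \<in> {1..n}" for x y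
  proof -
    have "perm_inv \<sigma> x \<in> {1..n}" "perm_inv \<sigma> y \<in> {1..n}"
      using that(2,3) permutes_in_image[OF permutes_inv[OF assms(1)]] by auto
    then have "colour_less sg g (\<sigma> (perm_inv \<sigma> x)) (\<sigma> (perm_inv \<sigma> y))"
      using assms(2) that(1) unfolding sorts_def by blast
    then show ?thesis by (simp add: permutes_inverses(1)[OF assms(1)])
  qed
  show ?thesis
  proof
    assume xy: "colour_less sg g x y"
    show "perm_inv \<sigma> x < perm_inv \<sigma> y"
    proof (rule ccontr)
      assume "\<not> perm_inv \<sigma> x < perm_inv \<sigma> y"
      then consider "perm_inv \<sigma> x = perm_inv \<sigma> y" | "perm_inv \<sigma> y < perm_inv \<sigma> x" by linarith
      then show False
      proof cases
        case 1
        then have "x = y" by (metis permutes_inverses(1)[OF assms(1)])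
        then show False using xy colour_less_irrefl by simp
      next
        case 2
        then show False using * assms(3,4) xy colour_less_irrefl colour_less_trans by blast
      qed
    qed
  qed (use * assms in blast)
qed

text \<open>Composing one with the inverse of the other gives an increasing permutation of a finite
  interval, which can only be the identity.\<close>

lemma sorts_unique:
  assumes "\<sigma> permutes {1..n}" "sorts n sg g \<sigma>" "\<tau> permutes {1..n}" "sorts n sg g \<tau>"
  shows "\<sigma> = \<tau>"
proof -
  define \<rho> where "\<rho> = perm_inv \<tau> \<circ> \<sigma>"
  have \<rho>: "\<rho> permutes {1..n}"
    unfolding \<rho>_def using assms permutes_inv permutes_compose by blast
  have mono: "\<rho> p < \<rho> q" if "p \<in> {1..n}" "q \<in> {1..n}" "p < q" for p q
  proof -
    have "\<sigma> p \<in> {1..n}" "\<sigma> q \<in> {1..n}" using permutes_in_image[OF assms(1)] that by auto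
    moreover have "colour_less sg g (\<sigma> p) (\<sigma> q)" using assms(2) that by (auto simp: sorts_def)
    ultimately show ?thesis
      using sorts_inv_less_iff[OF assms(3,4)] by (simp add: \<rho>_def)
  qed
  have "i \<le> \<rho> i" if "i \<in> {1..n}" for i
    using that
  proof (induction i)
    case (Suc i)
    show ?case
    proof (cases "i = 0")
      case True
      then show ?thesis using permutes_in_image[OF \<rho>, of 1] Suc.prems by auto
    next
      case False
      then have "i \<le> \<rho> i" "\<rho> i < \<rho> (Suc i)" using Suc mono[of i "Suc i"] by auto
      then show ?thesis by simp
    qed
  qed simp
  then have "\<rho> = id" by (intro permutes_natset_ge[OF \<rho>]) auto
  then have "\<tau> \<circ> (perm_inv \<tau> \<circ> \<sigma>) = \<tau>" by (simp add: \<rho>_def)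
  then show ?thesis by (simp add: o_assoc permutes_inv_o[OF assms(3)])
qed

text \<open>Counting the values up to \<open>x\<close> in the order \<open>colour_less\<close> ranks
  them, and the inverse of this ranking sorts.\<close>

lemma sorts_exists: "\<exists>\<sigma>. \<sigma> permutes {1..n} \<and> sorts n sg g \<sigma>"
proof -
  define down where "down x = {y \<in> {1..n}. y = x \<or> colour_less sg g y x}" for x
  define \<beta> where "\<beta> x = (if x \<in> {1..n} then card (down x) else x)" for x
  have fin: "finite (down x)" for x by (simp add: down_def)
  have less: "\<beta> x < \<beta> y" if "x \<in> {1..n}" "y \<in> {1..n}" "colour_less sg g x y" for x y
  proof -
    have "down x \<subset> down y"
    proof
      show "down x \<subseteq> down y"
        using that colour_less_trans by (auto simp: down_def)
      have "y \<in> down y" "y \<notin> down x"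
        using that colour_less_trans[of sg g x y x] colour_less_irrefl by (auto simp: down_def)
      then show "down x \<noteq> down y" by blast
    qed
    then show ?thesis using that fin by (simp add: \<beta>_def psubset_card_mono)
  qed
  have inj: "inj_on \<beta> {1..n}"
  proof (rule inj_onI, rule ccontr)
    fix x y assume "x \<in> {1..n}" "y \<in> {1..n}" "\<beta> x = \<beta> y" "x \<noteq> y"
    then show False using less[of x y] less[of y x] colour_less_linear[of x y sg g] by auto
  qed
  have "\<beta> x \<in> {1..n}" if "x \<in> {1..n}" for x
  proof -
    have "down x \<subseteq> {1..n}" "x \<in> down x" using that by (auto simp: down_def)
    then have "card (down x) \<le> card {1..n}" "0 < card (down x)"
      using fin[of x] card_mono[of "{1..n}" "down x"] by (auto simp: card_gt_0_iff)
    then show ?thesis using that by (simp add: \<beta>_def)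
  qed
  then have "\<beta> ` {1..n} = {1..n}"
    using inj by (intro endo_inj_surj) auto
  then have \<beta>: "\<beta> permutes {1..n}"
    using inj by (intro bij_imp_permutes) (auto simp: bij_betw_def \<beta>_def)
  have "sorts n sg g (perm_inv \<beta>)"
    unfolding sorts_def
  proof (intro ballI impI)
    fix p q assume pq: "p \<in> {1..n}" "q \<in> {1..n}" "p < q"
    have in_n: "perm_inv \<beta> p \<in> {1..n}" "perm_inv \<beta> q \<in> {1..n}"
      using pq permutes_in_image[OF permutes_inv[OF \<beta>]] by auto
    have eq: "\<beta> (perm_inv \<beta> p) = p" "\<beta> (perm_inv \<beta> q) = q"
      by (simp_all add: permutes_inverses[OF \<beta>])
    then have "perm_inv \<beta> p \<noteq> perm_inv \<beta> q" using pq(3) by auto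
    then show "colour_less sg g (perm_inv \<beta> p) (perm_inv \<beta> q)"
      using colour_less_linear[of "perm_inv \<beta> p" "perm_inv \<beta> q" sg g] less[OF in_n(2,1)] eq pq(3) by auto
  qed
  then show ?thesis using permutes_inv[OF \<beta>] by blast
qed

definition colourings :: "nat \<Rightarrow> nat \<Rightarrow> (nat \<Rightarrow> bool) \<Rightarrow> (nat \<Rightarrow> nat) \<Rightarrow> (nat \<Rightarrow> nat) set" where
  "colourings n m sg \<sigma> = {g \<in> {1..n} \<rightarrow>\<^sub>E {..<m}. sorts n sg g \<sigma>}"

lemma finite_colourings [simp]: "finite (colourings n m sg \<sigma>)"
  by (simp add: colourings_def finite_PiE)

text \<open>A number in base \<open>i\<close> with leading digit \<open>b\<close>. The last digit is
  reversed for negative \<open>b\<close>, because the second sorting then lists the result of the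
  first backwards.\<close>

definition fold_colour :: "nat \<Rightarrow> (nat \<Rightarrow> bool) \<Rightarrow> nat \<Rightarrow> nat \<Rightarrow> nat" where
  "fold_colour i sg b a = b * i + (if sg b then a else i - 1 - a)"

lemma fold_colour_less_iff:
  assumes "a < i" "a' < i"
  shows "fold_colour i sg b a < fold_colour i sg b' a' \<longleftrightarrow>
           b < b' \<or> b = b' \<and> (if sg b then a < a' else a' < a)"
proof -
  have *: "b * i + r < b' * i + r'" if "b < b'" "r < i" for b b' r r' :: nat
  proof -
    have "b * i + r < Suc b * i" using that by simp
    also have "\<dots> \<le> b' * i" using that by (intro mult_right_mono) auto
    finally show ?thesis by simp
  qed
  consider "b < b'" | "b = b'" | "b' < b" by linarith
  then show ?thesis
  proof cases
    case 1
    then show ?thesis using *[of b b'] assms by (simp add: fold_colour_def)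
  next
    case 2
    then show ?thesis using assms by (auto simp: fold_colour_def)
  next
    case 3
    then have "fold_colour i sg b' a' < fold_colour i sg b a"
      using *[of b' b] assms by (simp add: fold_colour_def)
    then show ?thesis using 3 by auto
  qed
qed

lemma fold_colour_eq_iff:
  assumes "a < i" "a' < i"
  shows "fold_colour i sg b a = fold_colour i sg b' a' \<longleftrightarrow> b = b' \<and> a = a'"
  using fold_colour_less_iff[of a i a' sg b b'] fold_colour_less_iff[of a' i a sg b' b] assms
  by (metis linorder_neq_iff)

lemma fold_colour_bound:
  assumes "a < i" "b < j"
  shows "fold_colour i sg b a < i * j"
proof -
  have "fold_colour i sg b a < Suc b * i" using assms by (simp add: fold_colour_def)
  also have "\<dots> \<le> j * i" using assms by (intro mult_right_mono) auto
  finally show ?thesis by (simp add: mult.commute)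
qed

lemma fold_colour_surj:
  assumes "c < i * j"
  obtains a b where "a < i" "b < j" "c = fold_colour i sg b a"
proof -
  have i: "0 < i" using assms by (cases i) auto
  define b where "b = c div i"
  define a where "a = (if sg b then c mod i else i - 1 - c mod i)"
  have "c mod i < i" using i by simp
  moreover have "b < j" using assms i by (simp add: b_def less_mult_imp_div_less mult.commute)
  moreover have "c = b * i + c mod i" by (simp add: b_def)
  ultimately show ?thesis
    by (intro that[of a b]) (auto simp: a_def fold_colour_def)
qed

text \<open>Values are compared by the second colour, then by their position under \<alpha>,
  forwards or backwards; that position depends in turn on the first colour and the value. Ties in
  both colours follow the product of the two signs, which is \<open>sgk\<close>.\<close>

lemma colour_less_fold:
  assumes "\<alpha> permutes {1..n}" "sorts n sgi g \<alpha>" "x \<in> {1..n}" "y \<in> {1..n}" "g x < i" "g y < i"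
    and k: "k x = fold_colour i sgj (h (perm_inv \<alpha> x)) (g x)" "k y = fold_colour i sgj (h (perm_inv \<alpha> y)) (g y)"
    and sgk: "\<And>a b. a < i \<Longrightarrow> sgk (fold_colour i sgj b a) = (sgj b = sgi a)"
  shows "colour_less sgj h (perm_inv \<alpha> x) (perm_inv \<alpha> y) \<longleftrightarrow> colour_less sgk k x y"
proof -
  have xy: "perm_inv \<alpha> x < perm_inv \<alpha> y \<longleftrightarrow> colour_less sgi g x y" "perm_inv \<alpha> y < perm_inv \<alpha> x \<longleftrightarrow> colour_less sgi g y x"
    using sorts_inv_less_iff[OF assms(1,2)] assms(3,4) by auto
  show ?thesis
    unfolding colour_less_def[of sgj] colour_less_def[of sgk] xy k
      fold_colour_less_iff[OF assms(5,6)] fold_colour_eq_iff[OF assms(5,6)] sgk[OF assms(5)]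
    by (auto simp: colour_less_def)
qed

text \<open>A pair of colourings sorted by \<open>\<alpha>\<close> and \<open>\<beta>\<close> is the same as one colouring by pairs sorted
  by \<open>\<alpha> \<circ> \<beta>\<close>, where the pairs are read boustrophedon: the first colour runs backwards
  whenever the second one is negative.\<close>

lemma card_colourings_prod:
  assumes \<sigma>: "\<sigma> permutes {1..n}"
    and sgk: "\<And>a b. a < i \<Longrightarrow> sgk (fold_colour i sgj b a) = (sgj b = sgi a)"
  shows "(\<Sum>(\<alpha>, \<beta>)\<in>{(\<alpha>, \<beta>). \<alpha> permutes {1..n} \<and> \<beta> permutes {1..n} \<and> \<alpha> \<circ> \<beta> = \<sigma>}.
            card (colourings n i sgi \<alpha>) * card (colourings n j sgj \<beta>)) =
         card (colourings n (i * j) sgk \<sigma>)"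
proof -
  let ?S = "{1..n}"
  let ?T = "{(\<alpha>, \<beta>). \<alpha> permutes ?S \<and> \<beta> permutes ?S \<and> \<alpha> \<circ> \<beta> = \<sigma>}"
  \<comment> \<open>Here \<alpha> determines \<beta>. The second colouring lives on positions, so in
    \<open>\<Phi>\<close> it is read at \<open>perm_inv \<alpha> x\<close>.\<close>
  define X where "X = (SIGMA \<alpha>:{\<alpha>. \<alpha> permutes ?S}. colourings n i sgi \<alpha> \<times> colourings n j sgj (perm_inv \<alpha> \<circ> \<sigma>))"
  define \<Phi> where "\<Phi> = (\<lambda>(\<alpha>, g, h). restrict (\<lambda>x. fold_colour i sgj (h (perm_inv \<alpha> x)) (g x)) ?S)"
  have inv_in: "perm_inv \<alpha> x \<in> ?S" if "\<alpha> permutes ?S" "x \<in> ?S" for \<alpha> x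
    using permutes_in_image[OF permutes_inv[OF that(1)]] that(2) by blast
  have "(\<Sum>(\<alpha>, \<beta>)\<in>?T. card (colourings n i sgi \<alpha>) * card (colourings n j sgj \<beta>)) =
      (\<Sum>\<alpha> | \<alpha> permutes ?S. card (colourings n i sgi \<alpha>) * card (colourings n j sgj (perm_inv \<alpha> \<circ> \<sigma>)))"
  proof (rule sum.reindex_bij_witness[of _ "\<lambda>\<alpha>. (\<alpha>, perm_inv \<alpha> \<circ> \<sigma>)" fst])
    fix x assume "x \<in> ?T"
    then obtain \<alpha> \<beta> where x: "x = (\<alpha>, \<beta>)" "\<alpha> permutes ?S" "\<beta> permutes ?S" "\<alpha> \<circ> \<beta> = \<sigma>" by auto
    then have "perm_inv \<alpha> \<circ> \<sigma> = \<beta>"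
      using permutes_inv_o(2)[OF x(2)] by (auto simp: o_assoc)
    then show "(fst x, perm_inv (fst x) \<circ> \<sigma>) = x" "fst x \<in> {\<alpha>. \<alpha> permutes ?S}"
      "card (colourings n i sgi (fst x)) * card (colourings n j sgj (perm_inv (fst x) \<circ> \<sigma>)) =
        (case x of (\<alpha>, \<beta>) \<Rightarrow> card (colourings n i sgi \<alpha>) * card (colourings n j sgj \<beta>))"
      using x by auto
  next
    fix \<alpha> assume "\<alpha> \<in> {\<alpha>. \<alpha> permutes ?S}"
    then have \<alpha>: "\<alpha> permutes ?S" by simp
    then show "(\<alpha>, perm_inv \<alpha> \<circ> \<sigma>) \<in> ?T"
      using permutes_compose[OF \<sigma> permutes_inv[OF \<alpha>]] permutes_inv_o(1)[OF \<alpha>] by (auto simp: o_assoc)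
  qed auto
  also have "\<dots> = card X"
    unfolding X_def by (subst card_SigmaI) (auto simp: finite_permutations card_cartesian_product)
  also have "bij_betw \<Phi> X (colourings n (i * j) sgk \<sigma>)"
    unfolding bij_betw_def
  proof (intro conjI)
    have sort_iff: "sorts n sgj h (perm_inv \<alpha> \<circ> \<sigma>) \<longleftrightarrow> sorts n sgk k \<sigma>"
      if "\<alpha> permutes ?S" "sorts n sgi g \<alpha>" "\<And>x. x \<in> ?S \<Longrightarrow> g x < i"
        "\<And>x. x \<in> ?S \<Longrightarrow> k x = fold_colour i sgj (h (perm_inv \<alpha> x)) (g x)" for \<alpha> g h k
      unfolding sorts_def o_def
      using that permutes_in_image[OF \<sigma>]
      by (intro ball_cong refl imp_cong colour_less_fold[where g = g and sgi = sgi and n = n and i = i] sgk) auto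
    show "\<Phi> ` X = colourings n (i * j) sgk \<sigma>"
    proof (intro equalityI subsetI)
      fix k assume "k \<in> \<Phi> ` X"
      then obtain \<alpha> g h where \<alpha>: "\<alpha> permutes ?S" and g: "g \<in> colourings n i sgi \<alpha>"
        and h: "h \<in> colourings n j sgj (perm_inv \<alpha> \<circ> \<sigma>)" and k: "k = \<Phi> (\<alpha>, g, h)"
        by (auto simp: X_def)
      have gi: "g x < i" if "x \<in> ?S" for x using g that by (auto simp: colourings_def)
      have hj: "h (perm_inv \<alpha> x) < j" if "x \<in> ?S" for x
        using h inv_in[OF \<alpha> that] by (auto simp: colourings_def)
      have "k \<in> ?S \<rightarrow>\<^sub>E {..<i * j}"
        using gi hj fold_colour_bound by (auto simp: k \<Phi>_def)
      moreover have "sorts n sgk k \<sigma>"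
        using sort_iff[of \<alpha> g k h] \<alpha> g h gi by (auto simp: colourings_def k \<Phi>_def)
      ultimately show "k \<in> colourings n (i * j) sgk \<sigma>" by (simp add: colourings_def)
    next
      fix k assume "k \<in> colourings n (i * j) sgk \<sigma>"
      then have k: "k \<in> ?S \<rightarrow>\<^sub>E {..<i * j}" "sorts n sgk k \<sigma>" by (auto simp: colourings_def)
      have "\<forall>x\<in>?S. \<exists>ab. fst ab < i \<and> snd ab < j \<and> k x = fold_colour i sgj (snd ab) (fst ab)"
      proof
        fix x assume "x \<in> ?S"
        then have "k x < i * j" using k(1) by auto
        then obtain a b where "a < i" "b < j" "k x = fold_colour i sgj b a"
          using fold_colour_surj by blast
        then show "\<exists>ab. fst ab < i \<and> snd ab < j \<and> k x = fold_colour i sgj (snd ab) (fst ab)"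
          by (intro exI[of _ "(a, b)"]) simp
      qed
      then obtain f where f: "\<And>x. x \<in> ?S \<Longrightarrow>
          fst (f x) < i \<and> snd (f x) < j \<and> k x = fold_colour i sgj (snd (f x)) (fst (f x))"
        by metis
      \<comment> \<open>The order of the choices is forced: the last digits give \<open>g\<close>,
        \<open>g\<close> determines \<alpha>, and only then can the leading digits be carried back
        to positions to give \<open>h\<close>.\<close>
      define g where "g = restrict (fst \<circ> f) ?S"
      obtain \<alpha> where \<alpha>: "\<alpha> permutes ?S" "sorts n sgi g \<alpha>" using sorts_exists by blast
      define h where "h = restrict (snd \<circ> f \<circ> \<alpha>) ?S"
      have g: "g \<in> colourings n i sgi \<alpha>"
        using f \<alpha> by (auto simp: colourings_def g_def)
      have kx: "k x = fold_colour i sgj (h (perm_inv \<alpha> x)) (g x)" if "x \<in> ?S" for x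
        using f[OF that] that inv_in[OF \<alpha>(1) that]
        by (simp add: g_def h_def permutes_inverses(1)[OF \<alpha>(1)])
      have "sorts n sgj h (perm_inv \<alpha> \<circ> \<sigma>)"
        using sort_iff[of \<alpha> g k h] \<alpha> kx f k(2) by (simp add: g_def)
      then have h: "h \<in> colourings n j sgj (perm_inv \<alpha> \<circ> \<sigma>)"
        using f permutes_in_image[OF \<alpha>(1)] by (auto simp: colourings_def h_def)
      have "k = \<Phi> (\<alpha>, g, h)"
        using kx k(1) by (auto simp: \<Phi>_def fun_eq_iff PiE_def extensional_def)
      moreover have "(\<alpha>, g, h) \<in> X" using \<alpha> g h by (simp add: X_def)
      ultimately show "k \<in> \<Phi> ` X" by blast
    qed
    show "inj_on \<Phi> X"
    proof (rule inj_onI)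
      fix u v assume u: "u \<in> X" and v: "v \<in> X" and eq: "\<Phi> u = \<Phi> v"
      obtain \<alpha> g h where u': "u = (\<alpha>, g, h)" by (cases u)
      obtain \<alpha>' g' h' where v': "v = (\<alpha>', g', h')" by (cases v)
      have \<alpha>: "\<alpha> permutes ?S" "\<alpha>' permutes ?S" using u v by (auto simp: X_def u' v')
      have g: "g \<in> ?S \<rightarrow>\<^sub>E {..<i}" "g' \<in> ?S \<rightarrow>\<^sub>E {..<i}" "sorts n sgi g \<alpha>" "sorts n sgi g' \<alpha>'"
        using u v by (auto simp: X_def u' v' colourings_def)
      have h: "h \<in> ?S \<rightarrow>\<^sub>E {..<j}" "h' \<in> ?S \<rightarrow>\<^sub>E {..<j}"
        using u v by (auto simp: X_def u' v' colourings_def)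
      have *: "h (perm_inv \<alpha> x) = h' (perm_inv \<alpha>' x) \<and> g x = g' x" if x: "x \<in> ?S" for x
      proof -
        have "fold_colour i sgj (h (perm_inv \<alpha> x)) (g x) = fold_colour i sgj (h' (perm_inv \<alpha>' x)) (g' x)"
          using fun_cong[OF eq, of x] x by (simp add: \<Phi>_def u' v')
        moreover have "g x < i" "g' x < i" using g x by auto
        ultimately show ?thesis using fold_colour_eq_iff by blast
      qed
      have gg: "g = g'" using * g by (intro PiE_ext[OF g(1,2)]) auto
      have aa: "\<alpha> = \<alpha>'" using sorts_unique[OF \<alpha>(1) g(3) \<alpha>(2)] g(4) gg by simp
      have "h = h'"
      proof (rule PiE_ext[OF h])
        fix p assume "p \<in> ?S"
        then have "\<alpha> p \<in> ?S" using permutes_in_image[OF \<alpha>(1)] by blast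
        then show "h p = h' p" using *[of "\<alpha> p"] aa by (simp add: permutes_inverses(2)[OF \<alpha>(2)])
      qed
      then show "u = v" using gg aa by (simp add: u' v')
    qed
  qed
  then have "card X = card (colourings n (i * j) sgk \<sigma>)" by (rule bij_betw_same_card)
  finally show ?thesis .
qed

section \<open>The embedding into the group algebra\<close>

definition dirs :: "nat \<Rightarrow> (nat \<Rightarrow> nat) \<Rightarrow> bool list" where
  "dirs n \<sigma> = map (\<lambda>p. \<sigma> p < \<sigma> (Suc p)) [1..<n]"

lemma length_dirs [simp]: "length (dirs n \<sigma>) = n - 1"
  by (simp add: dirs_def)

lemma nth_dirs: "i < n - 1 \<Longrightarrow> dirs n \<sigma> ! i \<longleftrightarrow> \<sigma> (Suc i) < \<sigma> (Suc (Suc i))"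
  by (simp add: dirs_def)

lemma composition_descents_attach:
  assumes "K \<noteq> []"
  shows "composition_descents (attach d K) = (if d then {} else {1}) \<union> Suc ` composition_descents K"
proof -
  obtain k L where K: "K = k # L" using assms by (cases K) auto
  show ?thesis
  proof (cases d)
    case True
    have "sum_list (take r (Suc k # L)) = Suc (sum_list (take r (k # L)))" if "1 \<le> r" for r
      using that by (cases r) auto
    then show ?thesis
      using True K by (force simp: composition_descents_def attach_def image_def)
  next
    case False
    have "composition_descents (1 # K) = insert 1 (Suc ` composition_descents K)"
    proof (intro equalityI subsetI)
      fix x assume "x \<in> composition_descents (1 # K)"
      then obtain r where r: "1 \<le> r" "r < Suc (length K)" "x = sum_list (take r (1 # K))"
        by (auto simp: composition_descents_def)
      then obtain r' where r': "r = Suc r'" by (cases r) auto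
      show "x \<in> insert 1 (Suc ` composition_descents K)"
      proof (cases "r' = 0")
        case False
        then have "sum_list (take r' K) \<in> composition_descents K"
          using r r' by (auto simp: composition_descents_def)
        then show ?thesis using r r' by simp
      qed (use r r' in simp)
    next
      fix x assume "x \<in> insert 1 (Suc ` composition_descents K)"
      then consider "x = 1" | r where "1 \<le> r" "r < length K" "x = Suc (sum_list (take r K))"
        by (auto simp: composition_descents_def)
      then show "x \<in> composition_descents (1 # K)"
      proof cases
        case 1
        then show ?thesis
          using assms unfolding composition_descents_def by (auto intro!: exI[of _ 1])
      next
        case 2
        then show ?thesis
          unfolding composition_descents_def by (auto intro!: exI[of _ "Suc r"])
      qed
    qed
    then show ?thesis using False by (simp add: attach_def)
  qed
qed

lemma composition_descents_word_comp:
  "composition_descents (word_comp w) = {Suc i |i. i < length w \<and> \<not> w ! i}"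
proof (induction w)
  case Nil
  then show ?case by (auto simp: composition_descents_def)
next
  case (Cons d w)
  have "{Suc i |i. i < length (d # w) \<and> \<not> (d # w) ! i} =
      (if d then {} else {1}) \<union> Suc ` {Suc i |i. i < length w \<and> \<not> w ! i}" (is "?L = ?R")
  proof (intro equalityI subsetI)
    fix x assume "x \<in> ?L"
    then obtain i where i: "x = Suc i" "i < length (d # w)" "\<not> (d # w) ! i" by blast
    then show "x \<in> ?R" by (cases i) auto
  qed (auto split: if_splits)
  then show ?case using Cons by (simp add: composition_descents_attach)
qed

lemma ex_word_comp:
  assumes "composition K" "K \<noteq> []"
  shows "\<exists>w. K = word_comp w"
  using assms
proof (induction rule: composition_induct)
  case single
  then show ?case by (intro exI[of _ "[]"]) simp
next
  case (attach d K)
  then show ?case by (metis word_comp.simps(2))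
qed

lemma perm_descents_eq_iff:
  assumes "\<sigma> permutes {1..n}" "length w = n - 1"
  shows "perm_descents n \<sigma> = composition_descents (word_comp w) \<longleftrightarrow> w = dirs n \<sigma>"
proof -
  have neq: "\<sigma> i \<noteq> \<sigma> (Suc i)" for i
    using permutes_inj[OF assms(1)] by (simp add: inj_eq)
  have pd: "perm_descents n \<sigma> = {Suc i |i. i < length (dirs n \<sigma>) \<and> \<not> dirs n \<sigma> ! i}"
  proof (intro equalityI subsetI)
    fix x assume "x \<in> perm_descents n \<sigma>"
    then have "1 \<le> x" "x < n" "\<sigma> x > \<sigma> (Suc x)" by (auto simp: perm_descents_def)
    then show "x \<in> {Suc i |i. i < length (dirs n \<sigma>) \<and> \<not> dirs n \<sigma> ! i}"
      by (cases x) (auto simp: nth_dirs)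
  next
    fix x assume "x \<in> {Suc i |i. i < length (dirs n \<sigma>) \<and> \<not> dirs n \<sigma> ! i}"
    then show "x \<in> perm_descents n \<sigma>"
      using neq by (auto simp: perm_descents_def nth_dirs not_less order_le_less) metis
  qed
  show ?thesis
  proof
    assume "perm_descents n \<sigma> = composition_descents (word_comp w)"
    then have *: "{Suc i |i. i < length (dirs n \<sigma>) \<and> \<not> dirs n \<sigma> ! i} = {Suc i |i. i < length w \<and> \<not> w ! i}"
      using pd composition_descents_word_comp by simp
    show "w = dirs n \<sigma>"
    proof (rule nth_equalityI)
      fix i assume i: "i < length w"
      have "Suc i \<in> {Suc i |i. i < length (dirs n \<sigma>) \<and> \<not> dirs n \<sigma> ! i} \<longleftrightarrow>
          Suc i \<in> {Suc i |i. i < length w \<and> \<not> w ! i}" using * by simp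
      then show "w ! i = dirs n \<sigma> ! i" using i assms(2) by auto
    qed (use assms in simp)
  qed (use pd composition_descents_word_comp in simp)
qed

text \<open>Exactly one composition of \<open>n\<close> has the descent set of \<sigma>, so the
  embedding reads off a single coefficient.\<close>

lemma descent_embed_eq:
  assumes "1 \<le> n"
  shows "descent_embed n F \<sigma> = (if \<sigma> permutes {1..n} then F (word_comp (dirs n \<sigma>)) else 0)"
proof (cases "\<sigma> permutes {1..n}")
  case True
  let ?C = "{I. composition I \<and> sum_list I = n}"
  have fin: "finite ?C" by (rule finite_subset[OF _ finite_compositions_le[of n]]) auto
  have "perm_descents n \<sigma> = composition_descents I \<longleftrightarrow> I = word_comp (dirs n \<sigma>)" if I: "I \<in> ?C" for I
  proof -
    obtain w where w: "I = word_comp w" using I assms ex_word_comp[of I] by fastforce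
    then have "length w = n - 1" using I by simp
    then show ?thesis using perm_descents_eq_iff[OF True] w
      by (metis composition_descents_word_comp perm_descents_eq_iff True length_dirs)
  qed
  then have "descent_embed n F \<sigma> = (\<Sum>I\<in>?C. if I = word_comp (dirs n \<sigma>) then F I else 0)"
    unfolding descent_embed_def using True by (intro sum.cong) auto
  also have "\<dots> = F (word_comp (dirs n \<sigma>))"
    using assms fin by (simp add: sum.delta)
  finally show ?thesis using True by simp
qed (simp add: descent_embed_def)

lemma sorts_iff_adjacent:
  "sorts n sg g \<sigma> \<longleftrightarrow> (\<forall>i<n - 1. colour_less sg g (\<sigma> (Suc i)) (\<sigma> (Suc (Suc i))))"
proof
  assume *: "\<forall>i<n - 1. colour_less sg g (\<sigma> (Suc i)) (\<sigma> (Suc (Suc i)))"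
  have "colour_less sg g (\<sigma> p) (\<sigma> (p + Suc d))" if "1 \<le> p" "p + Suc d \<le> n" for p d
    using that
  proof (induction d)
    case 0
    then show ?case using *[rule_format, of "p - 1"] by simp
  next
    case (Suc d)
    then have "colour_less sg g (\<sigma> p) (\<sigma> (p + Suc d))" by simp
    moreover have "colour_less sg g (\<sigma> (p + Suc d)) (\<sigma> (p + Suc (Suc d)))"
      using *[rule_format, of "p + d"] Suc.prems by simp
    ultimately show ?case by (rule colour_less_trans)
  qed
  then show "sorts n sg g \<sigma>"
    unfolding sorts_def by (metis atLeastAtMost_iff less_iff_Suc_add add_Suc_right)
qed (auto simp: sorts_def)

text \<open>A colouring is read along the entries of \<sigma>. Being sorted is a condition on
  adjacent entries, the one that defines \<open>colour_chains\<close>.\<close>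

lemma card_colourings:
  assumes "1 \<le> n" "\<sigma> permutes {1..n}"
  shows "card (colourings n m (\<lambda>v. even v = s) \<sigma>) = V_coeff m s (dirs n \<sigma>)"
proof -
  let ?S = "{1..n}"
  let ?f = "\<lambda>g. map (g \<circ> \<sigma>) [1..<Suc n]"
  have in_S: "\<sigma> p \<in> ?S \<longleftrightarrow> p \<in> ?S" for p using permutes_in_image[OF assms(2)] .
  have neq: "\<sigma> (Suc i) \<noteq> \<sigma> (Suc (Suc i))" for i
    using permutes_inj[OF assms(2)] by (simp add: inj_eq)
  have nth: "?f g ! i = g (\<sigma> (Suc i))" if "i < n" for g :: "nat \<Rightarrow> nat" and i
    using that by (simp add: nth_map del: upt_Suc)
  have valid: "?f g \<in> colour_chains m s (dirs n \<sigma>) \<longleftrightarrow>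
      (\<forall>x\<in>?S. g x < m) \<and> sorts n (\<lambda>v. even v = s) g \<sigma>" for g
  proof -
    have "set (?f g) = g ` (\<sigma> ` ?S)" by (auto simp: atLeastLessThanSuc_atLeastAtMost)
    then have "set (?f g) = g ` ?S" by (simp only: permutes_image[OF assms(2)])
    moreover have "sorts n (\<lambda>v. even v = s) g \<sigma> \<longleftrightarrow> (\<forall>i<n - 1. ?f g ! i < ?f g ! Suc i \<or>
        ?f g ! i = ?f g ! Suc i \<and> (even (?f g ! i) = s) = dirs n \<sigma> ! i)"
      unfolding sorts_iff_adjacent
    proof (intro all_cong1 imp_cong refl)
      fix i assume i: "i < n - 1"
      show "colour_less (\<lambda>v. even v = s) g (\<sigma> (Suc i)) (\<sigma> (Suc (Suc i))) \<longleftrightarrow> (?f g ! i < ?f g ! Suc i \<or>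
        ?f g ! i = ?f g ! Suc i \<and> (even (?f g ! i) = s) = dirs n \<sigma> ! i)"
        using i neq[of i] nth[of i g] nth[of "Suc i" g]
        by (auto simp: colour_less_def nth_dirs simp del: upt_Suc)
    qed
    ultimately show ?thesis
      using assms(1) unfolding colour_chains_def by (simp del: upt_Suc)
  qed
  have "bij_betw ?f (colourings n m (\<lambda>v. even v = s) \<sigma>) (colour_chains m s (dirs n \<sigma>))"
    unfolding bij_betw_def
  proof (intro conjI equalityI subsetI)
    show "inj_on ?f (colourings n m (\<lambda>v. even v = s) \<sigma>)"
    proof (rule inj_onI)
      fix g g' assume g: "g \<in> colourings n m (\<lambda>v. even v = s) \<sigma>" "g' \<in> colourings n m (\<lambda>v. even v = s) \<sigma>"
        and eq: "?f g = ?f g'"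
      have "g \<in> ?S \<rightarrow>\<^sub>E {..<m}" "g' \<in> ?S \<rightarrow>\<^sub>E {..<m}"
        using g by (simp_all add: colourings_def)
      then show "g = g'"
      proof (rule PiE_ext)
        fix x assume x: "x \<in> ?S"
        then obtain p where p: "p \<in> ?S" "x = \<sigma> p" using permutes_image[OF assms(2)] by blast
        then obtain i where i: "p = Suc i" "i < n" by (cases p) auto
        have "?f g ! i = ?f g' ! i" by (simp only: eq)
        then show "g x = g' x" using p i nth[of i] by simp
      qed
    qed
  next
    fix xs assume "xs \<in> ?f ` colourings n m (\<lambda>v. even v = s) \<sigma>"
    then show "xs \<in> colour_chains m s (dirs n \<sigma>)"
      using valid by (auto simp: colourings_def simp del: upt_Suc)
  next
    fix xs assume xs: "xs \<in> colour_chains m s (dirs n \<sigma>)"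
    define g where "g = restrict (\<lambda>x. xs ! (perm_inv \<sigma> x - 1)) ?S"
    have len: "length xs = n" using xs assms(1) by (simp add: colour_chains_def)
    have "?f g = xs"
    proof (rule nth_equalityI)
      fix i assume "i < length (?f g)"
      then have i: "i < n" by (simp del: upt_Suc)
      then have "\<sigma> (Suc i) \<in> ?S" using in_S[of "Suc i"] by simp
      then show "?f g ! i = xs ! i"
        using nth[OF i, of g] by (simp add: g_def permutes_inverses[OF assms(2)] del: upt_Suc)
    qed (simp add: len del: upt_Suc)
    then show "xs \<in> ?f ` colourings n m (\<lambda>v. even v = s) \<sigma>"
      using valid[of g] xs by (intro image_eqI[of _ _ g]) (auto simp: colourings_def g_def simp del: upt_Suc)
  qed
  then show ?thesis using card_colour_chains by (simp add: bij_betw_same_card)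
qed

lemma descent_embed_V:
  assumes "1 \<le> n"
  shows "descent_embed n (V m s) \<sigma> =
    (if \<sigma> permutes {1..n} then of_nat (card (colourings n m (\<lambda>v. even v = s) \<sigma>)) else 0)"
  using assms by (simp add: descent_embed_eq V_word_comp card_colourings)

section \<open>The multiplication table\<close>

text \<open>For even \<open>i\<close> the leading digit does not affect the parity and reversing the
  last digit changes it; for odd \<open>i\<close> both digits count and reversal keeps the parity.
  Hence the sign of a product is \<open>s\<close> or \<open>s = t\<close>.\<close>

lemma sign_fold_colour:
  assumes "a < i"
  shows "(even (fold_colour i (\<lambda>v. even v = t) b a) = (if even i then s else s = t)) =
    ((even b = t) = (even a = s))"
  using assms by (cases "even i"; cases "even b"; cases "even a"; cases t) (auto simp: fold_colour_def)

definition gmult :: "nat \<Rightarrow> ((nat \<Rightarrow> nat) \<Rightarrow> rat) \<Rightarrow> ((nat \<Rightarrow> nat) \<Rightarrow> rat) \<Rightarrow> (nat \<Rightarrow> nat) \<Rightarrow> rat" where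
  "gmult n f g = (\<lambda>\<sigma>. \<Sum>(\<alpha>, \<beta>) \<in> {(\<alpha>, \<beta>). \<alpha> permutes {1..n} \<and> \<beta> permutes {1..n} \<and> \<alpha> \<circ> \<beta> = \<sigma>}. f \<alpha> * g \<beta>)"

lemma gmult_sum_left: "gmult n (\<lambda>\<sigma>. \<Sum>i\<in>A. c i * f i \<sigma>) g \<sigma> = (\<Sum>i\<in>A. c i * gmult n (f i) g \<sigma>)"
  unfolding gmult_def sum_distrib_left by (subst sum.swap) (auto simp: sum_distrib_right sum_distrib_left mult_ac intro!: sum.cong)

lemma gmult_sum_right: "gmult n f (\<lambda>\<sigma>. \<Sum>i\<in>A. c i * g i \<sigma>) \<sigma> = (\<Sum>i\<in>A. c i * gmult n f (g i) \<sigma>)"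
  unfolding gmult_def sum_distrib_left by (subst sum.swap) (auto simp: sum_distrib_left mult_ac intro!: sum.cong)

lemma gmult_V:
  assumes "1 \<le> n"
  shows "gmult n (descent_embed n (V i s)) (descent_embed n (V j t)) =
           descent_embed n (V (i * j) (if even i then s else s = t))"
proof
  fix \<sigma>
  let ?T = "{(\<alpha>, \<beta>). \<alpha> permutes {1..n} \<and> \<beta> permutes {1..n} \<and> \<alpha> \<circ> \<beta> = \<sigma>}"
  let ?u = "if even i then s else s = t"
  show "gmult n (descent_embed n (V i s)) (descent_embed n (V j t)) \<sigma> = descent_embed n (V (i * j) ?u) \<sigma>"
  proof (cases "\<sigma> permutes {1..n}")
    case True
    have "gmult n (descent_embed n (V i s)) (descent_embed n (V j t)) \<sigma> =
        of_nat (\<Sum>(\<alpha>, \<beta>)\<in>?T. card (colourings n i (\<lambda>v. even v = s) \<alpha>) * card (colourings n j (\<lambda>v. even v = t) \<beta>))"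
      unfolding gmult_def of_nat_sum by (intro sum.cong) (auto simp: descent_embed_V[OF assms])
    also have "\<dots> = of_nat (card (colourings n (i * j) (\<lambda>v. even v = ?u) \<sigma>))"
      using card_colourings_prod[OF True, of i "\<lambda>v. even v = ?u" "\<lambda>v. even v = t" "\<lambda>v. even v = s" j]
        sign_fold_colour by simp
    finally show ?thesis using True by (simp add: descent_embed_V[OF assms])
  next
    case False
    then have "?T = {}" using permutes_compose by blast
    then have "gmult n (descent_embed n (V i s)) (descent_embed n (V j t)) \<sigma> = 0"
      unfolding gmult_def by (simp only: sum.empty)
    then show ?thesis using False by (simp add: descent_embed_V[OF assms])
  qed
qed

definition E_emb :: "nat \<Rightarrow> bool \<Rightarrow> bool \<Rightarrow> nat \<Rightarrow> (nat \<Rightarrow> nat) \<Rightarrow> rat" where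
  "E_emb n s b k = descent_embed n (E_sgn s b k)"

lemma descent_embed_V_sum:
  assumes "1 \<le> n"
  shows "descent_embed n (V m s) = (\<lambda>\<sigma>. \<Sum>k\<le>n. of_nat m ^ k * E_emb n s (even m) k \<sigma>)"
  using assms by (auto simp: E_emb_def descent_embed_eq V_eq_sum_E fun_eq_iff)

text \<open>A product of two \<open>V\<close> involves only powers of \<open>i * j\<close>, so
  comparing coefficients of \<open>j^l\<close> and then of \<open>i^k\<close> leaves only
  \<open>k = l\<close>. The disjunction \<open>b \<or> c\<close> is the evenness of
  \<open>i * j\<close>.\<close>

lemma gmult_E:
  assumes "1 \<le> n" "k \<le> n" "l \<le> n"
  shows "gmult n (E_emb n s b k) (E_emb n t c l) =
    (if k = l then E_emb n (if b then s else s = t) (b \<or> c) k else (\<lambda>\<sigma>. 0))"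
proof
  fix \<sigma>
  let ?u = "if b then s else s = t"
  let ?G = "\<lambda>k l. gmult n (E_emb n s b k) (E_emb n t c l) \<sigma>"
  let ?E = "\<lambda>k. E_emb n ?u (b \<or> c) k \<sigma>"
  have *: "(\<Sum>l\<le>n. of_nat j ^ l * (\<Sum>k\<le>n. of_nat i ^ k * ?G k l)) = (\<Sum>l\<le>n. of_nat j ^ l * (of_nat i ^ l * ?E l))"
    if "even i = b" "even j = c" for i j
  proof -
    have "gmult n (descent_embed n (V i s)) (descent_embed n (V j t)) \<sigma> =
        (\<Sum>k\<le>n. of_nat i ^ k * (\<Sum>l\<le>n. of_nat j ^ l * ?G k l))"
      by (simp add: descent_embed_V_sum[OF assms(1)] gmult_sum_left gmult_sum_right that)
    also have "\<dots> = (\<Sum>l\<le>n. of_nat j ^ l * (\<Sum>k\<le>n. of_nat i ^ k * ?G k l))"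
      unfolding sum_distrib_left by (subst sum.swap) (simp add: mult_ac)
    finally have "(\<Sum>l\<le>n. of_nat j ^ l * (\<Sum>k\<le>n. of_nat i ^ k * ?G k l)) =
        gmult n (descent_embed n (V i s)) (descent_embed n (V j t)) \<sigma>" ..
    also have "\<dots> = descent_embed n (V (i * j) ?u) \<sigma>"
      by (simp only: gmult_V[OF assms(1)] that)
    also have "\<dots> = (\<Sum>l\<le>n. of_nat j ^ l * (of_nat i ^ l * ?E l))"
      by (simp only: descent_embed_V_sum[OF assms(1)] even_mult_iff that of_nat_mult power_mult_distrib mult_ac)
    finally show ?thesis .
  qed
  have "(\<Sum>k\<le>n. of_nat i ^ k * ?G k l) = (\<Sum>k\<le>n. of_nat i ^ k * (if k = l then ?E l else 0))"
    if "even i = b" for i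
  proof -
    have "(\<Sum>k\<le>n. of_nat i ^ k * ?G k l) = of_nat i ^ l * ?E l"
      using power_sum_coeffs_eq[where b = c and n = n and a = "\<lambda>l. \<Sum>k\<le>n. of_nat i ^ k * ?G k l"
          and a' = "\<lambda>l. of_nat i ^ l * ?E l" and k = l] *[OF that] assms by blast
    \<comment> \<open>The monomial is written as a polynomial in \<open>i\<close> with one
      coefficient, ready for the second comparison.\<close>
    also have "\<dots> = (\<Sum>k\<le>n. of_nat i ^ k * (if k = l then ?E l else 0))"
      using assms by (simp add: if_distrib[of "(*) _"] sum.delta cong: if_cong)
    finally show ?thesis .
  qed
  then have "?G k l = (if k = l then ?E l else 0)"
    using power_sum_coeffs_eq[where b = b and n = n and a = "\<lambda>k. ?G k l"
        and a' = "\<lambda>k. if k = l then ?E l else 0" and k = k] assms by blast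
  then show "gmult n (E_emb n s b k) (E_emb n t c l) \<sigma> =
    (if k = l then E_emb n ?u (b \<or> c) k else (\<lambda>\<sigma>. 0)) \<sigma>" by simp
qed

section \<open>Alternating runs\<close>

definition ascent :: "(nat \<Rightarrow> nat) \<Rightarrow> nat \<Rightarrow> bool" where
  "ascent \<sigma> p \<longleftrightarrow> \<sigma> p < \<sigma> (Suc p)"

lemma monotone_on_interval:
  fixes a b :: nat
  assumes "\<And>p. a \<le> p \<Longrightarrow> p < b \<Longrightarrow> R (f p) (f (Suc p))" "transp R"
  shows "monotone_on {a..b} (<) R f"
proof (rule monotone_onI)
  fix p q assume pq: "p \<in> {a..b}" "q \<in> {a..b}" "p < q"
  have "p + Suc d \<le> b \<Longrightarrow> R (f p) (f (p + Suc d))" for d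
  proof (induction d)
    case 0
    then show ?case using assms(1)[of p] pq by simp
  next
    case (Suc d)
    then have "R (f p) (f (p + Suc d))" by simp
    moreover have "R (f (p + Suc d)) (f (p + Suc (Suc d)))"
      using assms(1)[of "p + Suc d"] Suc.prems pq by simp
    ultimately show ?case using assms(2) by (meson transpD)
  qed
  from this[of "q - p - 1"] show "R (f p) (f q)" using pq by simp
qed

lemma monotone_segment_iff:
  assumes \<sigma>: "\<sigma> permutes {1..n}" and "a < b"
  shows "monotone_segment n \<sigma> a b \<longleftrightarrow> 1 \<le> a \<and> b \<le> n \<and> (\<forall>p\<in>{a..<b}. ascent \<sigma> p = ascent \<sigma> a)"
proof -
  have neq: "\<sigma> p \<noteq> \<sigma> (Suc p)" for p using permutes_inj[OF \<sigma>] by (simp add: inj_eq)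
  have "strict_mono_on {a..b} \<sigma> \<longleftrightarrow> (\<forall>p\<in>{a..<b}. ascent \<sigma> p)"
  proof
    assume "strict_mono_on {a..b} \<sigma>"
    then show "\<forall>p\<in>{a..<b}. ascent \<sigma> p"
      by (auto simp: ascent_def monotone_on_def)
  next
    assume "\<forall>p\<in>{a..<b}. ascent \<sigma> p"
    then show "strict_mono_on {a..b} \<sigma>"
      by (intro monotone_on_interval) (auto simp: ascent_def transp_def)
  qed
  moreover have "strict_antimono_on {a..b} \<sigma> \<longleftrightarrow> (\<forall>p\<in>{a..<b}. \<not> ascent \<sigma> p)"
  proof
    assume "strict_antimono_on {a..b} \<sigma>"
    then show "\<forall>p\<in>{a..<b}. \<not> ascent \<sigma> p"
      by (auto simp: ascent_def monotone_on_def not_less intro!: less_imp_le)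
  next
    assume *: "\<forall>p\<in>{a..<b}. \<not> ascent \<sigma> p"
    show "strict_antimono_on {a..b} \<sigma>"
    proof (rule monotone_on_interval)
      fix p assume "a \<le> p" "p < b"
      then have "\<not> ascent \<sigma> p" using * by simp
      then show "\<sigma> p > \<sigma> (Suc p)" using neq[of p] by (simp add: ascent_def)
    qed (auto simp: transp_def)
  qed
  moreover have "(\<forall>p\<in>{a..<b}. ascent \<sigma> p) \<or> (\<forall>p\<in>{a..<b}. \<not> ascent \<sigma> p) \<longleftrightarrow>
      (\<forall>p\<in>{a..<b}. ascent \<sigma> p = ascent \<sigma> a)"
    using \<open>a < b\<close> by (cases "ascent \<sigma> a") auto
  ultimately show ?thesis
    using \<open>a < b\<close> by (auto simp: monotone_segment_def)
qed

text \<open>Neighbouring runs share their turning point, so runs are counted by their first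
  positions. Position \<open>n\<close> is excluded, as every run has at least two entries.\<close>

definition run_starts :: "nat \<Rightarrow> (nat \<Rightarrow> nat) \<Rightarrow> nat set" where
  "run_starts n \<sigma> = {a \<in> {1..<n}. a = 1 \<or> ascent \<sigma> (a - 1) \<noteq> ascent \<sigma> a}"

context
  fixes n :: nat and \<sigma> :: "nat \<Rightarrow> nat"
  assumes n: "2 \<le> n" and \<sigma>: "\<sigma> permutes {1..n}"
begin

lemma segment_2: "1 \<le> a \<Longrightarrow> a < n \<Longrightarrow> monotone_segment n \<sigma> a (Suc a)"
  using monotone_segment_iff[OF \<sigma>, of a "Suc a"] by auto

text \<open>As \<open>n \<ge> 2\<close>, every position lies in a segment of two entries, so a
  single entry is never maximal.\<close>

lemma alternating_run_less:
  assumes "(a, b) \<in> alternating_runs n \<sigma>"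
  shows "a < b"
proof (rule ccontr)
  assume "\<not> a < b"
  then have ab: "a = b" "1 \<le> a" "a \<le> n" using assms by (auto simp: alternating_runs_def monotone_segment_def)
  show False
  proof (cases "a < n")
    case True
    then have "monotone_segment n \<sigma> a (Suc a)" "{a..b} \<subset> {a..Suc a}" using segment_2 ab unfolding atLeastatMost_psubset_iff by auto
    then show False using assms by (auto simp: alternating_runs_def)
  next
    case False
    then have "monotone_segment n \<sigma> (a - 1) a" "{a..b} \<subset> {a - 1..a}" using segment_2[of "a - 1"] ab n unfolding atLeastatMost_psubset_iff by auto
    then show False using assms by (auto simp: alternating_runs_def)
  qed
qed

lemma alternating_run_start:
  assumes "(a, b) \<in> alternating_runs n \<sigma>"
  shows "a \<in> run_starts n \<sigma>"
proof -
  have ab: "a < b" by (rule alternating_run_less[OF assms])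
  have seg: "1 \<le> a" "b \<le> n" "\<And>p. p \<in> {a..<b} \<Longrightarrow> ascent \<sigma> p = ascent \<sigma> a"
  proof -
    have "monotone_segment n \<sigma> a b" using assms by (simp add: alternating_runs_def)
    then show "1 \<le> a" "b \<le> n" "\<And>p. p \<in> {a..<b} \<Longrightarrow> ascent \<sigma> p = ascent \<sigma> a"
      using monotone_segment_iff[OF \<sigma> ab] by blast+
  qed
  show ?thesis
  proof (rule ccontr)
    assume "a \<notin> run_starts n \<sigma>"
    then have a: "a \<noteq> 1" "ascent \<sigma> (a - 1) = ascent \<sigma> a"
      using seg(1,2) ab by (auto simp: run_starts_def)
    have "ascent \<sigma> p = ascent \<sigma> (a - 1)" if "p \<in> {a - 1..<b}" for p
    proof (cases "p = a - 1")
      case False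
      then have "p \<in> {a..<b}" using that by auto
      then show ?thesis using seg(3)[of p] a(2) by simp
    qed simp
    moreover have "a - 1 < b" "1 \<le> a - 1" using ab a(1) seg(1) by auto
    ultimately have "monotone_segment n \<sigma> (a - 1) b"
      using monotone_segment_iff[OF \<sigma>, of "a - 1" b] seg(2) by blast
    moreover have "{a..b} \<subset> {a - 1..b}" using a(1) seg(1) ab unfolding atLeastatMost_psubset_iff by auto
    ultimately show False using assms by (auto simp: alternating_runs_def)
  qed
qed

lemma alternating_run_exists:
  assumes "a \<in> run_starts n \<sigma>"
  shows "\<exists>b. (a, b) \<in> alternating_runs n \<sigma>"
proof -
  have a: "1 \<le> a" "a < n" using assms by (auto simp: run_starts_def)
  let ?B = "{b. monotone_segment n \<sigma> a b}"
  have fin: "finite ?B" by (rule finite_subset[of _ "{..n}"]) (auto simp: monotone_segment_def)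
  have Suc: "Suc a \<in> ?B" using segment_2 a by simp
  \<comment> \<open>The longest segment from \<open>a\<close> is a run: a strictly larger one would
    have to begin before \<open>a\<close>, which \<open>run_starts\<close> rules out.\<close>
  define b where "b = Max ?B"
  have b: "monotone_segment n \<sigma> a b" using Max_in[OF fin] Suc unfolding b_def by blast
  have ab: "a < b" using Max_ge[OF fin Suc] by (simp add: b_def)
  have "\<not> (monotone_segment n \<sigma> c d \<and> {a..b} \<subset> {c..d})" for c d
  proof
    assume cd: "monotone_segment n \<sigma> c d \<and> {a..b} \<subset> {c..d}"
    then have le: "c \<le> a" "b \<le> d" using ab unfolding atLeastatMost_psubset_iff by auto
    have seg: "1 \<le> c" "\<And>p. p \<in> {c..<d} \<Longrightarrow> ascent \<sigma> p = ascent \<sigma> c"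
    proof -
      have "c < d" using le ab by linarith
      then show "1 \<le> c" "\<And>p. p \<in> {c..<d} \<Longrightarrow> ascent \<sigma> p = ascent \<sigma> c"
        using cd monotone_segment_iff[OF \<sigma>] by blast+
    qed
    show False
    proof (cases "c = a")
      case True
      then have "d \<le> b" using cd Max_ge[OF fin, of d] by (simp add: b_def)
      then show False using cd le True by (auto simp: atLeastatMost_psubset_iff)
    next
      case False
      then have "ascent \<sigma> (a - 1) = ascent \<sigma> c" "ascent \<sigma> a = ascent \<sigma> c"
        using le ab by (intro seg(2); auto)+
      then show False using assms False le seg(1) by (auto simp: run_starts_def)
    qed
  qed
  then show ?thesis using b by (auto simp: alternating_runs_def)
qed

lemma card_alternating_runs: "card (alternating_runs n \<sigma>) = card (run_starts n \<sigma>)"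
proof -
  have "bij_betw fst (alternating_runs n \<sigma>) (run_starts n \<sigma>)"
    unfolding bij_betw_def
  proof
    show "inj_on fst (alternating_runs n \<sigma>)"
    proof (rule inj_onI)
      fix x y assume xy: "x \<in> alternating_runs n \<sigma>" "y \<in> alternating_runs n \<sigma>" "fst x = fst y"
      obtain a b b' where ab: "x = (a, b)" "y = (a, b')" using xy(3) by (cases x; cases y) auto
      have less: "a < b" "a < b'" using alternating_run_less xy ab by auto
      have "\<not> {a..b} \<subset> {a..b'}" "\<not> {a..b'} \<subset> {a..b}"
        using xy ab by (auto simp: alternating_runs_def)
      then have "b = b'" using less by (cases b b' rule: linorder_cases) (auto simp: atLeastatMost_psubset_iff)
      then show "x = y" using ab by simp
    qed
    show "fst ` alternating_runs n \<sigma> = run_starts n \<sigma>"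
      using alternating_run_start alternating_run_exists by force
  qed
  then show ?thesis by (rule bij_betw_same_card)
qed

lemma first_run_iff:
  "(\<exists>b. (1, b) \<in> alternating_runs n \<sigma> \<and> strict_mono_on {1..b} \<sigma>) \<longleftrightarrow> ascent \<sigma> 1"
  "(\<exists>b. (1, b) \<in> alternating_runs n \<sigma> \<and> strict_antimono_on {1..b} \<sigma>) \<longleftrightarrow> \<not> ascent \<sigma> 1"
proof -
  have up: "ascent \<sigma> 1" if "(1, b) \<in> alternating_runs n \<sigma>" "strict_mono_on {1..b} \<sigma>" for b
    using alternating_run_less[OF that(1)] that(2) by (auto simp: ascent_def monotone_on_def)
  have down: "\<not> ascent \<sigma> 1" if "(1, b) \<in> alternating_runs n \<sigma>" "strict_antimono_on {1..b} \<sigma>" for b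
  proof -
    have "\<sigma> 1 > \<sigma> (Suc 1)"
      using alternating_run_less[OF that(1)] that(2) unfolding monotone_on_def by auto
    then show ?thesis by (simp add: ascent_def)
  qed
  have "1 \<in> run_starts n \<sigma>" using n by (simp add: run_starts_def)
  then obtain b where b: "(1, b) \<in> alternating_runs n \<sigma>" using alternating_run_exists by blast
  then have "strict_mono_on {1..b} \<sigma> \<or> strict_antimono_on {1..b} \<sigma>"
    by (auto simp: alternating_runs_def monotone_segment_def)
  then show "(\<exists>b. (1, b) \<in> alternating_runs n \<sigma> \<and> strict_mono_on {1..b} \<sigma>) \<longleftrightarrow> ascent \<sigma> 1"
    "(\<exists>b. (1, b) \<in> alternating_runs n \<sigma> \<and> strict_antimono_on {1..b} \<sigma>) \<longleftrightarrow> \<not> ascent \<sigma> 1"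
    using up down b by blast+
qed

end

lemma nruns_eq_card: "w \<noteq> [] \<Longrightarrow> nruns w = Suc (card {i. Suc i < length w \<and> w ! i \<noteq> w ! Suc i})"
proof (induction w rule: nruns.induct)
  case (3 d e w)
  let ?C = "\<lambda>w. {i. Suc i < length w \<and> w ! i \<noteq> w ! Suc i}"
  have "?C (d # e # w) = (if d = e then {} else {0}) \<union> Suc ` ?C (e # w)" (is "?L = ?R")
  proof (intro equalityI subsetI)
    fix i assume "i \<in> ?L"
    then show "i \<in> ?R" by (cases i) auto
  qed (auto split: if_splits)
  moreover have "finite (?C (e # w))" by (rule finite_subset[of _ "{..length (e # w)}"]) auto
  ultimately have "card (?C (d # e # w)) = (if d = e then 0 else 1) + card (?C (e # w))"
    by (simp add: card_insert_if card_image)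
  then show ?case using 3 by simp
qed auto

lemma nruns_dirs:
  assumes "2 \<le> n"
  shows "nruns (dirs n \<sigma>) = card (run_starts n \<sigma>)"
proof -
  let ?C = "{i. Suc i < length (dirs n \<sigma>) \<and> dirs n \<sigma> ! i \<noteq> dirs n \<sigma> ! Suc i}"
  have "dirs n \<sigma> \<noteq> []" using assms length_dirs[of n \<sigma>] by (metis One_nat_def Suc_1 diff_is_0_eq list.size(3) not_less_eq_eq)
  then have "nruns (dirs n \<sigma>) = Suc (card ?C)" by (rule nruns_eq_card)
  \<comment> \<open>Letter \<open>i\<close> compares positions \<open>i + 1\<close> and
    \<open>i + 2\<close>, so a change between letters \<open>i\<close> and \<open>i + 1\<close>
    starts a run at position \<open>i + 2\<close>.\<close>
  moreover have "run_starts n \<sigma> = insert 1 ((\<lambda>i. i + 2) ` ?C)" (is "?L = ?R")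
  proof (intro equalityI subsetI)
    fix a assume a: "a \<in> ?L"
    show "a \<in> ?R"
    proof (cases "a = 1")
      case False
      then have "2 \<le> a" using a by (auto simp: run_starts_def)
      then obtain i where i: "a = i + 2" by (metis add.commute le_add_diff_inverse)
      then have "i \<in> ?C" using a by (auto simp: run_starts_def nth_dirs ascent_def)
      then show ?thesis using i by blast
    qed simp
  qed (use assms in \<open>auto simp: run_starts_def nth_dirs ascent_def\<close>)
  moreover have "card (insert 1 ((\<lambda>i. i + 2) ` ?C)) = Suc (card ?C)"
  proof -
    have "finite ((\<lambda>i. i + 2) ` ?C)"
      by (intro finite_imageI finite_subset[of ?C "{..length (dirs n \<sigma>)}"]) auto
    moreover have "1 \<notin> (\<lambda>i. i + 2) ` ?C" by auto
    ultimately have "card (insert 1 ((\<lambda>i. i + 2) ` ?C)) = Suc (card ((\<lambda>i. i + 2) ` ?C))"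
      by (rule card_insert_disjoint)
    also have "card ((\<lambda>i. i + 2) ` ?C) = card ?C" by (rule card_image) (simp add: inj_on_def)
    finally show ?thesis .
  qed
  ultimately show ?thesis by (simp only:)
qed

lemma hd_dirs: "2 \<le> n \<Longrightarrow> hd (dirs n \<sigma>) \<longleftrightarrow> ascent \<sigma> 1"
  by (simp add: dirs_def ascent_def hd_map upt_conv_Cons)

lemma dirs_neq_Nil: "2 \<le> n \<Longrightarrow> dirs n \<sigma> \<noteq> []"
  by (simp add: dirs_def)

section \<open>The span of the sums over runs\<close>

lemma W_plus_eq:
  assumes "2 \<le> n"
  shows "W_plus n k \<sigma> = (if \<sigma> permutes {1..n} \<and> nruns (dirs n \<sigma>) = k \<and> hd (dirs n \<sigma>) then 1 else 0)"
  using card_alternating_runs[OF assms, of \<sigma>] first_run_iff(1)[OF assms, of \<sigma>] nruns_dirs[OF assms, of \<sigma>]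
    hd_dirs[OF assms, of \<sigma>]
  unfolding W_plus_def by auto

lemma W_minus_eq:
  assumes "2 \<le> n"
  shows "W_minus n k \<sigma> = (if \<sigma> permutes {1..n} \<and> nruns (dirs n \<sigma>) = k \<and> \<not> hd (dirs n \<sigma>) then 1 else 0)"
  using card_alternating_runs[OF assms, of \<sigma>] first_run_iff(2)[OF assms, of \<sigma>] nruns_dirs[OF assms, of \<sigma>]
    hd_dirs[OF assms, of \<sigma>]
  unfolding W_minus_def by auto

text \<open>The \<open>W_plus n k\<close> and \<open>W_minus n k\<close> are the indicator functions
  of the classes given by number of runs and first direction, so their span consists of the
  functions constant on classes.\<close>

lemma W_carrier_iff:
  assumes n: "2 \<le> n"
  shows "f \<in> carrier (W_algebra n) \<longleftrightarrow>
    (\<forall>\<sigma>. \<not> \<sigma> permutes {1..n} \<longrightarrow> f \<sigma> = 0) \<and>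
    (\<forall>\<sigma> \<tau>. \<sigma> permutes {1..n} \<and> \<tau> permutes {1..n} \<and> hd (dirs n \<sigma>) = hd (dirs n \<tau>) \<and>
       nruns (dirs n \<sigma>) = nruns (dirs n \<tau>) \<longrightarrow> f \<sigma> = f \<tau>)" (is "_ \<longleftrightarrow> ?z \<and> ?c")
proof
  assume "f \<in> carrier (W_algebra n)"
  then obtain x y where f: "f = (\<lambda>\<sigma>. \<Sum>k\<in>{1..n-1}. x k * W_plus n k \<sigma> + y k * W_minus n k \<sigma>)"
    by (auto simp: W_algebra_def)
  show "?z \<and> ?c" unfolding f W_plus_eq[OF n] W_minus_eq[OF n] by simp
next
  assume zc: "?z \<and> ?c"
  define Q where "Q h k \<sigma> \<longleftrightarrow> \<sigma> permutes {1..n} \<and> nruns (dirs n \<sigma>) = k \<and> hd (dirs n \<sigma>) = h" for h k \<sigma>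
  \<comment> \<open>On an empty class the choice is arbitrary, which is harmless since the
    corresponding \<open>W\<close> is 0.\<close>
  define x where "x h k = f (SOME \<sigma>. Q h k \<sigma>)" for h k
  have x: "x h k = f \<sigma>" if "Q h k \<sigma>" for h k \<sigma>
  proof -
    have "Q h k (SOME \<sigma>. Q h k \<sigma>)" using that by (rule someI[of "Q h k"])
    then show ?thesis
      using that zc[THEN conjunct2, rule_format, of "SOME \<sigma>. Q h k \<sigma>" \<sigma>]
      unfolding x_def Q_def[of h k \<sigma>] Q_def[of h k "SOME \<sigma>. Q h k \<sigma>"] by argo
  qed
  have "f \<sigma> = (\<Sum>k\<in>{1..n-1}. x True k * W_plus n k \<sigma> + x False k * W_minus n k \<sigma>)" for \<sigma>
  proof (cases "\<sigma> permutes {1..n}")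
    case True
    let ?k = "nruns (dirs n \<sigma>)"
    have k: "?k \<in> {1..n-1}"
      using nruns_pos[OF dirs_neq_Nil[OF n]] nruns_le_length[of "dirs n \<sigma>"] by (simp add: Suc_leI)
    have "(\<Sum>k\<in>{1..n-1}. x True k * W_plus n k \<sigma> + x False k * W_minus n k \<sigma>) =
        (\<Sum>k\<in>{1..n-1}. if k = ?k then f \<sigma> else 0)"
    proof (intro sum.cong refl)
      fix k
      show "x True k * W_plus n k \<sigma> + x False k * W_minus n k \<sigma> = (if k = ?k then f \<sigma> else 0)"
        using x[of "hd (dirs n \<sigma>)" ?k \<sigma>] True
        unfolding W_plus_eq[OF n] W_minus_eq[OF n] Q_def by (cases "hd (dirs n \<sigma>)") auto
    qed
    then show ?thesis using k by simp
  qed (use zc in \<open>simp add: W_plus_def W_minus_def\<close>)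
  then show "f \<in> carrier (W_algebra n)"
    unfolding W_algebra_def by auto
qed

section \<open>The idempotents\<close>

lemma descent_embed_V_V_coeff:
  assumes "1 \<le> n"
  shows "descent_embed n (V m s) \<sigma> = (if \<sigma> permutes {1..n} then of_nat (V_coeff m s (dirs n \<sigma>)) else 0)"
  by (simp add: descent_embed_eq[OF assms] V_word_comp)

lemma V_carrier:
  assumes "2 \<le> n"
  shows "descent_embed n (V m s) \<in> carrier (W_algebra n)"
  unfolding W_carrier_iff[OF assms]
proof (intro conjI allI impI)
  have n1: "1 \<le> n" using assms by simp
  fix \<sigma> \<tau>
  assume "\<sigma> permutes {1..n} \<and> \<tau> permutes {1..n} \<and> hd (dirs n \<sigma>) = hd (dirs n \<tau>) \<and>
    nruns (dirs n \<sigma>) = nruns (dirs n \<tau>)"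
  then show "descent_embed n (V m s) \<sigma> = descent_embed n (V m s) \<tau>"
    using V_coeff_cong[OF dirs_neq_Nil[OF assms] dirs_neq_Nil[OF assms], of \<sigma> \<tau> m s]
    by (simp add: descent_embed_V_V_coeff[OF n1])
qed (use assms in \<open>simp add: descent_embed_V_V_coeff\<close>)

text \<open>Being constant on classes passes from the values of a polynomial in \<open>m\<close> to
  its coefficients.\<close>

lemma E_carrier:
  assumes n: "2 \<le> n" and k: "k \<le> n"
  shows "E_emb n s b k \<in> carrier (W_algebra n)"
  unfolding W_carrier_iff[OF n]
proof (intro conjI allI impI)
  have n1: "1 \<le> n" using n by simp
  show "E_emb n s b k \<sigma> = 0" if "\<not> \<sigma> permutes {1..n}" for \<sigma>
    using that by (simp add: E_emb_def descent_embed_eq[OF n1])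
  fix \<sigma> \<tau>
  assume *: "\<sigma> permutes {1..n} \<and> \<tau> permutes {1..n} \<and> hd (dirs n \<sigma>) = hd (dirs n \<tau>) \<and>
    nruns (dirs n \<sigma>) = nruns (dirs n \<tau>)"
  show "E_emb n s b k \<sigma> = E_emb n s b k \<tau>"
  proof (rule power_sum_coeffs_eq[where b = b, OF _ k])
    fix m :: nat assume m: "even m = b"
    have "descent_embed n (V m s) \<sigma> = descent_embed n (V m s) \<tau>"
      using V_carrier[OF n, of m s] * unfolding W_carrier_iff[OF n] by blast
    then show "(\<Sum>k\<le>n. of_nat m ^ k * E_emb n s b k \<sigma>) = (\<Sum>k\<le>n. of_nat m ^ k * E_emb n s b k \<tau>)"
      by (simp only: descent_embed_V_sum[OF n1] m)
  qed
qed

lemma carrier_add: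
  assumes "2 \<le> n" "f \<in> carrier (W_algebra n)" "g \<in> carrier (W_algebra n)"
  shows "(\<lambda>\<sigma>. f \<sigma> + g \<sigma>) \<in> carrier (W_algebra n)"
  unfolding W_carrier_iff[OF assms(1)]
proof (intro conjI allI impI)
  note f = assms(2)[unfolded W_carrier_iff[OF assms(1)]] and g = assms(3)[unfolded W_carrier_iff[OF assms(1)]]
  show "f \<sigma> + g \<sigma> = 0" if "\<not> \<sigma> permutes {1..n}" for \<sigma>
    using f[THEN conjunct1, rule_format, OF that] g[THEN conjunct1, rule_format, OF that] by simp
  fix \<sigma> \<tau>
  assume "\<sigma> permutes {1..n} \<and> \<tau> permutes {1..n} \<and> hd (dirs n \<sigma>) = hd (dirs n \<tau>) \<and>
    nruns (dirs n \<sigma>) = nruns (dirs n \<tau>)"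
  then have "f \<sigma> = f \<tau>" "g \<sigma> = g \<tau>" using f g by blast+
  then show "f \<sigma> + g \<sigma> = f \<tau> + g \<tau>" by simp
qed

lemma carrier_scale:
  assumes "2 \<le> n" "f \<in> carrier (W_algebra n)"
  shows "(\<lambda>\<sigma>. c * f \<sigma>) \<in> carrier (W_algebra n)"
  unfolding W_carrier_iff[OF assms(1)]
proof (intro conjI allI impI)
  note f = assms(2)[unfolded W_carrier_iff[OF assms(1)]]
  show "c * f \<sigma> = 0" if "\<not> \<sigma> permutes {1..n}" for \<sigma>
    using f[THEN conjunct1, rule_format, OF that] by simp
  fix \<sigma> \<tau>
  assume "\<sigma> permutes {1..n} \<and> \<tau> permutes {1..n} \<and> hd (dirs n \<sigma>) = hd (dirs n \<tau>) \<and>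
    nruns (dirs n \<sigma>) = nruns (dirs n \<tau>)"
  then have "f \<sigma> = f \<tau>" using f by blast
  then show "c * f \<sigma> = c * f \<tau>" by simp
qed

text \<open>\<open>V k s\<close> is positive on the class with \<open>k\<close> runs and first
  direction \<open>s\<close>, and 0 on the opposite class and on all classes with more runs.
  Subtracting multiples clears the classes from many runs to few, so the \<open>V\<close> span the
  algebra.\<close>

lemma carrier_V_induct [consumes 2, case_names zero add scale V]:
  assumes n: "2 \<le> n" and f: "f \<in> carrier (W_algebra n)"
    and zero: "P (\<lambda>\<sigma>. 0)"
    and add: "\<And>f g. P f \<Longrightarrow> P g \<Longrightarrow> P (\<lambda>\<sigma>. f \<sigma> + g \<sigma>)"
    and scale: "\<And>c f. P f \<Longrightarrow> P (\<lambda>\<sigma>. c * f \<sigma>)"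
    and V: "\<And>m s. P (descent_embed n (V m s))"
  shows "P f"
proof -
  have n1: "1 \<le> n" using n by simp
  have main: "P f" if "f \<in> carrier (W_algebra n)"
    "\<And>\<sigma>. \<sigma> permutes {1..n} \<Longrightarrow> k < nruns (dirs n \<sigma>) \<Longrightarrow> f \<sigma> = 0" for f k
    using that
  proof (induction k arbitrary: f)
    case 0
    have "f \<sigma> = 0" for \<sigma>
    proof (cases "\<sigma> permutes {1..n}")
      case True
      then show ?thesis by (rule 0(2)[OF _ nruns_pos[OF dirs_neq_Nil[OF n]]])
    next
      case False
      then show ?thesis by (rule 0(1)[unfolded W_carrier_iff[OF n], THEN conjunct1, rule_format])
    qed
    then have "f = (\<lambda>\<sigma>. 0)" by auto
    then show ?case using zero by simp
  next
    case (Suc k)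
    define Q where "Q s \<sigma> \<longleftrightarrow> \<sigma> permutes {1..n} \<and> nruns (dirs n \<sigma>) = Suc k \<and> hd (dirs n \<sigma>) = s" for s \<sigma>
    define v where "v s = descent_embed n (V (Suc k) s)" for s
    define z where "z s = f (SOME \<sigma>. Q s \<sigma>) / v s (SOME \<sigma>. Q s \<sigma>)" for s
    have v: "v s \<sigma> = of_nat (V_coeff (Suc k) s (dirs n \<sigma>))" if "\<sigma> permutes {1..n}" for s \<sigma>
      using that by (simp add: v_def descent_embed_V_V_coeff[OF n1] del: V.simps)
    have zv: "z s * v s \<sigma> = f \<sigma>" if "Q s \<sigma>" for s \<sigma>
    proof -
      have some: "Q s (SOME \<sigma>. Q s \<sigma>)" using that by (rule someI[of "Q s"])
      have const: "g \<sigma> = g (SOME \<sigma>. Q s \<sigma>)" if "g \<in> carrier (W_algebra n)" for g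
        using that[unfolded W_carrier_iff[OF n], THEN conjunct2, rule_format, of \<sigma> "SOME \<sigma>. Q s \<sigma>"]
          some \<open>Q s \<sigma>\<close>
        unfolding Q_def[of s \<sigma>] Q_def[of s "SOME \<sigma>. Q s \<sigma>"] by argo
      have "0 < v s \<sigma>"
        using that V_coeff_pos[OF dirs_neq_Nil[OF n], of \<sigma> s "Suc k"] v[of \<sigma> s] by (simp add: Q_def)
      then show ?thesis
        using const[OF Suc.prems(1)] const[of "v s"] V_carrier[OF n] by (simp add: z_def v_def del: V.simps)
    qed
    define g where "g = (\<lambda>\<sigma>. f \<sigma> + ((- z True) * v True \<sigma> + (- z False) * v False \<sigma>))"
    have "P g"
    proof (rule Suc.IH)
      show "g \<in> carrier (W_algebra n)"
        unfolding g_def v_def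
        by (intro carrier_add[OF n] carrier_scale[OF n] Suc.prems(1) V_carrier[OF n])
      fix \<sigma> assume \<sigma>: "\<sigma> permutes {1..n}" "k < nruns (dirs n \<sigma>)"
      have vanish: "v s \<sigma> = 0" if "hd (dirs n \<sigma>) \<noteq> s \<or> Suc k < nruns (dirs n \<sigma>)" for s
        using that \<sigma> V_coeff_eq_0[OF dirs_neq_Nil[OF n], of "Suc k" \<sigma> s] v[OF \<sigma>(1), of s]
        by (cases "hd (dirs n \<sigma>) = s") auto
      show "g \<sigma> = 0"
      proof (cases "nruns (dirs n \<sigma>) = Suc k")
        case True
        then have "Q (hd (dirs n \<sigma>)) \<sigma>" using \<sigma> by (simp add: Q_def)
        then show ?thesis
          using zv[of "hd (dirs n \<sigma>)" \<sigma>] vanish[of "\<not> hd (dirs n \<sigma>)"]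
          by (cases "hd (dirs n \<sigma>)") (simp_all add: g_def)
      next
        case False
        then show ?thesis using vanish \<sigma> Suc.prems(2)[of \<sigma>] by (simp add: g_def)
      qed
    qed
    then have "P (\<lambda>\<sigma>. g \<sigma> + (z True * v True \<sigma> + z False * v False \<sigma>))"
      unfolding v_def by (intro add scale V)
    then show ?case by (simp add: g_def)
  qed
  show ?thesis
  proof (rule main[OF f, of n])
    fix \<sigma> assume "n < nruns (dirs n \<sigma>)"
    then show "f \<sigma> = 0" using nruns_le_length[of "dirs n \<sigma>"] by simp
  qed
qed

lemma gmult_add_left: "gmult n (\<lambda>\<sigma>. f \<sigma> + g \<sigma>) h = (\<lambda>\<sigma>. gmult n f h \<sigma> + gmult n g h \<sigma>)"
  by (auto simp: gmult_def distrib_right case_prod_unfold sum.distrib)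

lemma gmult_add_right: "gmult n h (\<lambda>\<sigma>. f \<sigma> + g \<sigma>) = (\<lambda>\<sigma>. gmult n h f \<sigma> + gmult n h g \<sigma>)"
  by (auto simp: gmult_def distrib_left case_prod_unfold sum.distrib)

lemma gmult_scale_left: "gmult n (\<lambda>\<sigma>. c * f \<sigma>) h = (\<lambda>\<sigma>. c * gmult n f h \<sigma>)"
  by (auto simp: gmult_def case_prod_unfold sum_distrib_left mult_ac)

lemma gmult_scale_right: "gmult n h (\<lambda>\<sigma>. c * f \<sigma>) = (\<lambda>\<sigma>. c * gmult n h f \<sigma>)"
  by (auto simp: gmult_def case_prod_unfold sum_distrib_left mult_ac)

lemma gmult_zero [simp]: "gmult n (\<lambda>\<sigma>. 0) h = (\<lambda>\<sigma>. 0)" "gmult n h (\<lambda>\<sigma>. 0) = (\<lambda>\<sigma>. 0)"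
  by (auto simp: gmult_def)

section \<open>Blocks of fixed index and primitivity\<close>

text \<open>By \<open>gmult_E\<close> the span for a fixed \<open>k\<close> is closed under products
  and different \<open>k\<close> annihilate each other, so multiplication reduces to arithmetic with
  four rationals.\<close>

definition IJ_comb :: "nat \<Rightarrow> nat \<Rightarrow> rat \<Rightarrow> rat \<Rightarrow> rat \<Rightarrow> rat \<Rightarrow> (nat \<Rightarrow> nat) \<Rightarrow> rat" where
  "IJ_comb n k a b c d = (\<lambda>\<sigma>. (a * E_emb n True True k \<sigma> + b * E_emb n False True k \<sigma>) +
     (c * E_emb n True False k \<sigma> + d * E_emb n False False k \<sigma>))"

lemma IJ_comb_carrier:
  assumes "2 \<le> n" "k \<le> n"
  shows "IJ_comb n k a b c d \<in> carrier (W_algebra n)"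
  unfolding IJ_comb_def using assms by (intro carrier_add carrier_scale E_carrier)

lemma gmult_IJ_comb:
  assumes "1 \<le> n" "k \<le> n" "l \<le> n"
  shows "gmult n (IJ_comb n k a b c d) (IJ_comb n l a' b' c' d') =
    (if k = l then IJ_comb n k (a * (a' + b' + c' + d') + c * a' + d * b') (b * (a' + b' + c' + d') + c * b' + d * a')
       (c * c' + d * d') (c * d' + d * c') else (\<lambda>\<sigma>. 0))"
proof -
  note [simp] = gmult_E[OF assms(1)]
  show ?thesis
    using assms unfolding IJ_comb_def
    by (auto simp: gmult_add_left gmult_add_right gmult_scale_left gmult_scale_right fun_eq_iff algebra_simps)
qed

lemma E_emb_eq_IJ_comb:
  "E_emb n s b k = IJ_comb n k (if s \<and> b then 1 else 0) (if \<not> s \<and> b then 1 else 0)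
     (if s \<and> \<not> b then 1 else 0) (if \<not> s \<and> \<not> b then 1 else 0)"
  by (cases s; cases b) (simp_all add: IJ_comb_def)

lemma W_algebra_simps [simp]:
  "monoid.mult (W_algebra n) = gmult n"
  "zero (W_algebra n) = (\<lambda>\<sigma>. 0)"
  "ring.add (W_algebra n) = (\<lambda>f g \<sigma>. f \<sigma> + g \<sigma>)"
  "one (W_algebra n) = (\<lambda>\<sigma>. if \<sigma> = id then 1 else 0)"
  by (simp_all add: W_algebra_def sym_group_algebra_def gmult_def fun_eq_iff)

text \<open>A summand \<open>f\<close> of \<open>e\<close> in an orthogonal splitting satisfies
  \<open>f = e f e = z e\<close>, and idempotence forces \<open>z\<close> to be 0 or 1. The
  hypothesis \<open>corner\<close> covers the index \<open>k\<close>; other indices are annihilated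
  by \<open>e\<close>.\<close>

lemma primitive_idempotent_IJ_comb:
  fixes a b c d :: rat
  assumes n: "2 \<le> n" and k: "k \<le> n" and nz: "IJ_comb n k a b c d \<noteq> (\<lambda>\<sigma>. 0)"
    and idem: "gmult n (IJ_comb n k a b c d) (IJ_comb n k a b c d) = IJ_comb n k a b c d"
    and corner: "\<And>s t. \<exists>z. gmult n (IJ_comb n k a b c d) (gmult n (E_emb n s t k) (IJ_comb n k a b c d)) =
      (\<lambda>\<sigma>. z * IJ_comb n k a b c d \<sigma>)"
  shows "primitive_idempotent (W_algebra n) (IJ_comb n k a b c d)"
proof -
  let ?e = "IJ_comb n k a b c d"
  have n1: "1 \<le> n" using n by simp
  have corner': "\<exists>z. gmult n ?e (gmult n f ?e) = (\<lambda>\<sigma>. z * ?e \<sigma>)" if "f \<in> carrier (W_algebra n)" for f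
    using n that
  proof (induction rule: carrier_V_induct)
    case zero
    then show ?case by (intro exI[of _ 0]) simp
  next
    case (add f g)
    then obtain y z where "gmult n ?e (gmult n f ?e) = (\<lambda>\<sigma>. y * ?e \<sigma>)" "gmult n ?e (gmult n g ?e) = (\<lambda>\<sigma>. z * ?e \<sigma>)"
      by auto
    then show ?case
      by (intro exI[of _ "y + z"]) (simp add: gmult_add_left gmult_add_right distrib_right)
  next
    case (scale x f)
    then obtain z where "gmult n ?e (gmult n f ?e) = (\<lambda>\<sigma>. z * ?e \<sigma>)" by auto
    then show ?case
      by (intro exI[of _ "x * z"]) (simp add: gmult_scale_left gmult_scale_right mult.assoc)
  next
    case (V m s)
    have "gmult n (descent_embed n (V m s)) ?e \<sigma> = of_nat m ^ k * gmult n (E_emb n s (even m) k) ?e \<sigma>" for \<sigma>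
    proof -
      have "gmult n (E_emb n s (even m) l) ?e = (\<lambda>\<sigma>. 0)" if "l \<le> n" "l \<noteq> k" for l
        using that k by (simp add: E_emb_eq_IJ_comb gmult_IJ_comb[OF n1])
      then have "gmult n (descent_embed n (V m s)) ?e \<sigma> =
          (\<Sum>l\<le>n. if l = k then of_nat m ^ k * gmult n (E_emb n s (even m) k) ?e \<sigma> else 0)"
        unfolding descent_embed_V_sum[OF n1] gmult_sum_left by (intro sum.cong) auto
      then show ?thesis using k by simp
    qed
    then have "gmult n (descent_embed n (V m s)) ?e = (\<lambda>\<sigma>. of_nat m ^ k * gmult n (E_emb n s (even m) k) ?e \<sigma>)"
      by (rule ext)
    moreover obtain z where "gmult n ?e (gmult n (E_emb n s (even m) k) ?e) = (\<lambda>\<sigma>. z * ?e \<sigma>)"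
      using corner by blast
    ultimately show ?case
      by (intro exI[of _ "of_nat m ^ k * z"]) (simp add: gmult_scale_right mult.assoc)
  qed
  have "f = (\<lambda>\<sigma>. 0) \<or> g = (\<lambda>\<sigma>. 0)"
    if f: "f \<in> carrier (W_algebra n)" "gmult n f f = f"
      and orth: "gmult n f g = (\<lambda>\<sigma>. 0)" "gmult n g f = (\<lambda>\<sigma>. 0)"
      and e: "?e = (\<lambda>\<sigma>. f \<sigma> + g \<sigma>)" for f g
  proof -
    have "gmult n f ?e = f" "gmult n ?e f = f"
      unfolding e by (simp_all add: gmult_add_left gmult_add_right f orth)
    then obtain z where z: "f = (\<lambda>\<sigma>. z * ?e \<sigma>)" using corner'[OF f(1)] by metis
    have "gmult n f f = (\<lambda>\<sigma>. z * (z * ?e \<sigma>))"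
      by (subst (1 2) z) (simp add: gmult_scale_left gmult_scale_right idem)
    then have "z * (z * ?e \<sigma>) = z * ?e \<sigma>" for \<sigma> using f(2) z by (metis)
    moreover obtain \<tau> where "?e \<tau> \<noteq> 0" using nz by auto
    ultimately have "z = 0 \<or> z = 1" by (metis mult.assoc mult_cancel_right mult_cancel_right1)
    then show ?thesis
    proof
      assume "z = 1"
      then have "g \<sigma> = 0" for \<sigma> using fun_cong[OF e, of \<sigma>] fun_cong[OF z, of \<sigma>] by simp
      then show ?thesis by auto
    qed (use z in auto)
  qed
  then show ?thesis
    using nz idem IJ_comb_carrier[OF n k]
    by (auto simp: primitive_idempotent_def idempotent_elem_def orthogonal_elems_def)
qed

section \<open>Nonvanishing and sum of the family\<close>

fun idem_IJ_comb :: "nat \<Rightarrow> idem_index \<Rightarrow> (nat \<Rightarrow> nat) \<Rightarrow> rat" where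
  "idem_IJ_comb n (Idx_I k) = IJ_comb n k (1/2) (1/2) 0 0"
| "idem_IJ_comb n (Idx_JI k) = IJ_comb n k (-1/2) (-1/2) (1/2) (1/2)"
| "idem_IJ_comb n (Idx_J k) = IJ_comb n k 0 0 (1/2) (-1/2)"

lemma descent_embed_idem_nsym:
  assumes "1 \<le> n"
  shows "descent_embed n (idem_nsym i) = idem_IJ_comb n i"
  by (cases i)
    (auto simp: IJ_comb_def E_emb_def E_sgn_def I_sgn_def J_sgn_def descent_embed_eq[OF assms] field_simps)

lemma word_comp_replicate_True: "word_comp (replicate m True) = [Suc m]"
  by (induction m) (auto simp: attach_def)

lemma E_emb_id:
  assumes "1 \<le> n"
  shows "E_emb n s b k id = (if b then I_sgn s k (row n) else J_sgn s k (row n))"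
proof -
  have "dirs n id = replicate (n - 1) True" by (simp add: dirs_def map_replicate_const)
  then have "word_comp (dirs n id) = row n"
    using assms by (simp add: word_comp_replicate_True row_def)
  then show ?thesis
    by (simp add: E_emb_def descent_embed_eq[OF assms] permutes_id E_sgn_def)
qed

lemma cong_2_iff: "[k = n] (mod 2) \<longleftrightarrow> even (n + k)" for k n :: nat
  by (auto simp: cong_def mod2_eq_if)

lemma idem_IJ_comb_nonzero:
  assumes n: "2 \<le> n" and i: "i \<in> idem_indices n"
  shows "idem_IJ_comb n i \<noteq> (\<lambda>\<sigma>. 0)"
proof -
  have n1: "1 \<le> n" using n by simp
  have "0 < idem_IJ_comb n i id"
  proof (cases i)
    case (Idx_I k)
    then have "1 \<le> k" "k \<le> n" "even (n + k)" using i by (auto simp: idem_indices_def cong_2_iff)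
    then show ?thesis
      using I_row_pos[of k n] by (simp add: Idx_I IJ_comb_def E_emb_id[OF n1] add_pos_pos)
  next
    case (Idx_JI k)
    then have "k + 4 \<le> n" "even (n + k)" using i by (auto simp: idem_indices_def cong_2_iff)
    then show ?thesis using JI_row_pos[of k n] by (simp add: Idx_JI IJ_comb_def E_emb_id[OF n1])
  next
    case (Idx_J k)
    then have "k + 2 \<le> n" "even (n + k)" using i by (auto simp: idem_indices_def cong_2_iff)
    then show ?thesis using J_diff_row_pos[of k n] by (simp add: Idx_J IJ_comb_def E_emb_id[OF n1])
  qed
  then show ?thesis by auto
qed

lemma E_emb_word:
  assumes "2 \<le> n" "\<sigma> permutes {1..n}"
  obtains K where "composition K" "sum_list K = n" "K \<noteq> []"
    "\<And>s b k. E_emb n s b k \<sigma> = (if b then I_sgn s k K else J_sgn s k K)"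
proof
  show "E_emb n s b k \<sigma> = (if b then I_sgn s k (word_comp (dirs n \<sigma>)) else J_sgn s k (word_comp (dirs n \<sigma>)))" for s b k
    using assms by (simp add: E_emb_def descent_embed_eq E_sgn_def)
qed (use assms in auto)

text \<open>There are four reasons: parity, equality of all top components, the identity of
  \<open>J_sgn_subtop\<close>, and the absence of \<open>I_sgn s 0\<close> from positive degrees.
  The sum over the family may therefore run over all \<open>k \<le> n\<close>.\<close>

lemma idem_IJ_comb_outside:
  assumes n: "2 \<le> n" and i: "i \<in> Idx_I ` {..n} \<union> Idx_JI ` {..n} \<union> Idx_J ` {..n}" "i \<notin> idem_indices n"
  shows "idem_IJ_comb n i \<sigma> = 0"
proof (cases "\<sigma> permutes {1..n}")
  case False
  then show ?thesis
    using n by (cases i) (simp_all add: IJ_comb_def E_emb_def descent_embed_eq)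
next
  case True
  then obtain K where K: "composition K" "sum_list K = n" "K \<noteq> []"
    and E: "\<And>s b k. E_emb n s b k \<sigma> = (if b then I_sgn s k K else J_sgn s k K)"
    using E_emb_word[OF n] by blast
  have odd: "E_emb n s b k \<sigma> = 0" if "k \<le> n" "odd (n + k)" for s b k
    using E_sgn_parity[of k K s b] that K(2) by (simp add: E E_sgn_def add.commute)
  have top: "E_emb n s b n \<sigma> = 1 / fact n" for s b
    using I_sgn_top[OF K(1), of s] J_sgn_top[OF K(1), of s] K(2) by (simp add: E)
  have sub: "J_sgn True (n - 2) K + J_sgn False (n - 2) K = I_sgn True (n - 2) K + I_sgn False (n - 2) K"
    using J_sgn_subtop[OF K(1)] K(2) n by simp
  have zero: "E_emb n s True 0 \<sigma> = 0" for s using K(3) by (simp add: E ribbon_def)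
  show ?thesis
  proof (cases i)
    case (Idx_I k)
    then have "k = 0 \<or> odd (n + k)" "k \<le> n" using i by (auto simp: idem_indices_def cong_2_iff)
    then show ?thesis using odd zero by (auto simp: Idx_I IJ_comb_def)
  next
    case (Idx_JI k)
    then have "k \<le> n" "n < k + 4 \<or> odd (n + k)" using i by (auto simp: idem_indices_def cong_2_iff)
    then have "odd (n + k) \<or> k = n \<or> k = n - 2" by presburger
    then consider "odd (n + k)" | "k = n" | "k = n - 2" by blast
    then show ?thesis
    proof cases
      case 1
      then show ?thesis using odd \<open>k \<le> n\<close> by (simp add: Idx_JI IJ_comb_def)
    next
      case 2
      then show ?thesis using top by (simp add: Idx_JI IJ_comb_def)
    next
      case 3
      then show ?thesis using sub by (simp add: Idx_JI IJ_comb_def E)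
    qed
  next
    case (Idx_J k)
    then have "k \<le> n" "n < k + 2 \<or> odd (n + k)" using i by (auto simp: idem_indices_def cong_2_iff)
    then have "odd (n + k) \<or> k = n" by presburger
    then consider "odd (n + k)" | "k = n" by blast
    then show ?thesis
    proof cases
      case 1
      then show ?thesis using odd \<open>k \<le> n\<close> by (simp add: Idx_J IJ_comb_def)
    next
      case 2
      then show ?thesis using top by (simp add: Idx_J IJ_comb_def)
    qed
  qed
qed

lemma idem_indices_subset: "idem_indices n \<subseteq> Idx_I ` {..n} \<union> Idx_JI ` {..n} \<union> Idx_J ` {..n}"
  by (auto simp: idem_indices_def)

lemma finite_idem_indices: "finite (idem_indices n)"
  by (rule finite_subset[OF idem_indices_subset]) auto

text \<open>With one colour, of positive sign, there is only the constant colouring, and the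
  identity sorts it.\<close>

lemma descent_embed_V_1:
  assumes "1 \<le> n"
  shows "descent_embed n (V 1 True) = (\<lambda>\<sigma>. if \<sigma> = id then 1 else 0)"
proof
  fix \<sigma>
  let ?sg = "\<lambda>v. even v = True"
  let ?g = "restrict (\<lambda>x. 0) {1..n} :: nat \<Rightarrow> nat"
  have "g = ?g" if "g \<in> {1..n} \<rightarrow>\<^sub>E {..<1}" for g
  proof
    fix x
    show "g x = ?g x"
      using that PiE_mem[OF that, of x] PiE_arb[OF that, of x] by (cases "x \<in> {1..n}") auto
  qed
  then have "{1..n} \<rightarrow>\<^sub>E {..<1::nat} = {?g}" by auto
  then have col: "colourings n 1 ?sg \<sigma> = (if sorts n ?sg ?g \<sigma> then {?g} else {})" for \<sigma>
    unfolding colourings_def by auto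
  have id: "sorts n ?sg ?g id" by (simp add: sorts_def colour_less_def)
  then have "\<sigma> permutes {1..n} \<and> sorts n ?sg ?g \<sigma> \<longleftrightarrow> \<sigma> = id"
    using sorts_unique[of \<sigma> n ?sg ?g id] permutes_id by blast
  then show "descent_embed n (V 1 True) \<sigma> = (if \<sigma> = id then 1 else 0)"
    using col[of \<sigma>] by (auto simp: descent_embed_V[OF assms] simp del: V.simps)
qed

lemma sum_idem_IJ_comb:
  assumes n: "2 \<le> n"
  shows "(\<Sum>i\<in>idem_indices n. idem_IJ_comb n i \<sigma>) = (if \<sigma> = id then 1 else 0)"
proof -
  have n1: "1 \<le> n" using n by simp
  have "(\<Sum>i\<in>idem_indices n. idem_IJ_comb n i \<sigma>) =
      (\<Sum>i\<in>Idx_I ` {..n} \<union> Idx_JI ` {..n} \<union> Idx_J ` {..n}. idem_IJ_comb n i \<sigma>)"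
    using idem_indices_subset idem_IJ_comb_outside[OF n] by (intro sum.mono_neutral_left) auto
  also have "\<dots> = (\<Sum>k\<le>n. idem_IJ_comb n (Idx_I k) \<sigma>) + (\<Sum>k\<le>n. idem_IJ_comb n (Idx_JI k) \<sigma>) + (\<Sum>k\<le>n. idem_IJ_comb n (Idx_J k) \<sigma>)"
    by (subst sum.union_disjoint, simp, simp, force, subst sum.union_disjoint, simp, simp, force)
      (simp add: sum.reindex inj_on_def)
  \<comment> \<open>For each \<open>k\<close> the three members add up to the positive
    \<open>J\<close>, and these sum to the expansion of \<open>V m True\<close> at
    \<open>m = 1\<close>.\<close>
  also have "\<dots> = (\<Sum>k\<le>n. E_emb n True False k \<sigma>)"
    unfolding sum.distrib[symmetric] by (intro sum.cong refl) (simp add: IJ_comb_def algebra_simps)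
  also have "\<dots> = descent_embed n (V 1 True) \<sigma>"
    by (simp add: descent_embed_V_sum[OF n1] del: V.simps)
  finally show ?thesis by (simp only: descent_embed_V_1[OF n1])
qed

lemma abelian_monoid_W:
  assumes "2 \<le> n"
  shows "abelian_monoid (W_algebra n)"
proof -
  have "(\<lambda>\<sigma>. 0) \<in> carrier (W_algebra n)" by (simp add: W_carrier_iff[OF assms])
  then show ?thesis
    by (intro abelian_monoidI) (simp_all add: carrier_add[OF assms] add_ac)
qed

lemma finsum_W:
  assumes n: "2 \<le> n" and "finite A" "\<And>i. i \<in> A \<Longrightarrow> e i \<in> carrier (W_algebra n)"
  shows "finsum (W_algebra n) e A = (\<lambda>\<sigma>. \<Sum>i\<in>A. e i \<sigma>)"
proof -
  interpret abelian_monoid "W_algebra n" by (rule abelian_monoid_W[OF n])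
  show ?thesis
    using assms(2,3) by (induction A) (auto simp: Pi_def)
qed

theorem theorem5p5:
  fixes n :: nat
  assumes "n \<ge> 2"
  shows "complete_primitive_orthogonal_idempotents (W_algebra n) (idem_indices n)
           (\<lambda>i. descent_embed n (idem_nsym i))"
proof -
  have n1: "1 \<le> n" using assms by simp
  have carrier: "idem_IJ_comb n i \<in> carrier (W_algebra n)" if "i \<in> idem_indices n" for i
    using that IJ_comb_carrier[OF assms] by (cases i) (auto simp: idem_indices_def)
  have prim: "primitive_idempotent (W_algebra n) (idem_IJ_comb n i)" if i: "i \<in> idem_indices n" for i
  proof -
    have nz: "idem_IJ_comb n i \<noteq> (\<lambda>\<sigma>. 0)" by (rule idem_IJ_comb_nonzero[OF assms i])
    show ?thesis
    proof (cases i)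
      case (Idx_I k)
      then have k: "k \<le> n" using i by (auto simp: idem_indices_def)
      show ?thesis
        unfolding Idx_I idem_IJ_comb.simps
      proof (rule primitive_idempotent_IJ_comb[OF assms k])
        fix s t
        \<comment> \<open>An \<open>I\<close> times any element of the block is that
          \<open>I\<close> times the sum of the coefficients. This sum is multiplicative and equals
          1 for all factors, so \<open>z = 1\<close>.\<close>
        show "\<exists>z. gmult n (IJ_comb n k (1/2) (1/2) 0 0) (gmult n (E_emb n s t k) (IJ_comb n k (1/2) (1/2) 0 0)) =
            (\<lambda>\<sigma>. z * IJ_comb n k (1/2) (1/2) 0 0 \<sigma>)"
          by (intro exI[of _ 1]) (cases s; cases t; simp add: E_emb_eq_IJ_comb gmult_IJ_comb[OF n1 k k])
      qed (use nz in \<open>simp_all add: Idx_I gmult_IJ_comb[OF n1 k k]\<close>)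
    next
      case (Idx_JI k)
      then have k: "k \<le> n" using i by (auto simp: idem_indices_def)
      show ?thesis
        unfolding Idx_JI idem_IJ_comb.simps
      proof (rule primitive_idempotent_IJ_comb[OF assms k])
        fix s t
        \<comment> \<open>The coefficients add up to 0, so an \<open>I\<close> on the left
          annihilates the element; a \<open>J\<close> on the left fixes it by its symmetry in the
          sign.\<close>
        show "\<exists>z. gmult n (IJ_comb n k (-1/2) (-1/2) (1/2) (1/2)) (gmult n (E_emb n s t k) (IJ_comb n k (-1/2) (-1/2) (1/2) (1/2))) =
            (\<lambda>\<sigma>. z * IJ_comb n k (-1/2) (-1/2) (1/2) (1/2) \<sigma>)"
          by (intro exI[of _ "if t then 0 else 1"])
            (cases s; cases t; simp add: E_emb_eq_IJ_comb gmult_IJ_comb[OF n1 k k]; simp add: IJ_comb_def)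
      qed (use nz in \<open>simp_all add: Idx_JI gmult_IJ_comb[OF n1 k k]\<close>)
    next
      case (Idx_J k)
      then have k: "k \<le> n" using i by (auto simp: idem_indices_def)
      show ?thesis
        unfolding Idx_J idem_IJ_comb.simps
      proof (rule primitive_idempotent_IJ_comb[OF assms k])
        fix s t
        \<comment> \<open>Again an \<open>I\<close> on the left gives 0. The negative
          \<open>J\<close> exchanges the signs, under which this element is antisymmetric, hence the
          value \<open>- 1\<close>.\<close>
        show "\<exists>z. gmult n (IJ_comb n k 0 0 (1/2) (-1/2)) (gmult n (E_emb n s t k) (IJ_comb n k 0 0 (1/2) (-1/2))) =
            (\<lambda>\<sigma>. z * IJ_comb n k 0 0 (1/2) (-1/2) \<sigma>)"
          by (intro exI[of _ "if t then 0 else if s then 1 else - 1"])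
            (cases s; cases t; simp add: E_emb_eq_IJ_comb gmult_IJ_comb[OF n1 k k]; simp add: IJ_comb_def)
      qed (use nz in \<open>simp_all add: Idx_J gmult_IJ_comb[OF n1 k k]\<close>)
    qed
  qed
  have orth: "gmult n (idem_IJ_comb n i) (idem_IJ_comb n j) = (\<lambda>\<sigma>. 0)"
    if "i \<in> idem_indices n" "j \<in> idem_indices n" "i \<noteq> j" for i j
  proof -
    have z: "IJ_comb n k 0 0 0 0 = (\<lambda>\<sigma>. 0)" for k by (simp add: IJ_comb_def)
    show ?thesis
      using that idem_indices_subset[of n]
      by (cases i; cases j) (auto simp: gmult_IJ_comb[OF n1] z idem_indices_def)
  qed
  have "finsum (W_algebra n) (idem_IJ_comb n) (idem_indices n) = (\<lambda>\<sigma>. if \<sigma> = id then 1 else 0)"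
    using finsum_W[OF assms finite_idem_indices, of n "idem_IJ_comb n"] carrier sum_idem_IJ_comb[OF assms] by simp
  then show ?thesis
    unfolding complete_primitive_orthogonal_idempotents_def descent_embed_idem_nsym[OF n1]
    using finite_idem_indices prim orth by (auto simp: orthogonal_elems_def)
qed

end
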